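(* Let $\mathcal{C}\subset\mathbb{R}^2$ be a curve of finite length that is piecewise $C^1$ and has a piecewise bi-Lipschitz continuous unit tangent vector. Then for every $p>6$ there exists a constant $C>0$, depending on $\mathcal{C}$ (and on $p$) but not on $n$, such that for all $n\in\mathbb{N}$, $$\mathrm{Fav}_{\mathcal{C}}(K_n)\le C\,n^{-1/p},$$ where $K_n$ is the $n$-th generation of the four-corner Cantor set and $\mathrm{Fav}_{\mathcal{C}}$ is the Favard curve length.
   Context: Favard curve length: for a curve $\mathcal{C}\subset\mathbb{R}^2$, $\alpha\in\mathbb{R}$ and $p\in\mathbb{R}^2$, let $\Phi_\alpha(p)=\{\beta\in\mathbb{R}:(\alpha,\beta)\in p-\mathcal{C}\}$, where $p-\mathcal{C}=\{p-z:z\in\mathcal{C}\}$, and $\Phi_\alpha(E)=\bigcup_{p\in E}\Phi_\alpha(p)$. Also $\Phi_\alpha^{-1}(\beta)=\{p:\beta\in\Phi_\alpha(p)\}=(\alpha,\beta)+\mathcal{C}$. For $E\subset\mathbb{R}^2$, $$\mathrm{Fav}_{\mathcal{C}}(E)=\left|\{(\alpha,\beta)\in\mathbb{R}^2:((\alpha,\beta)+\mathcal{C})\cap E\neq\emptyset\}\right|=\int_{\mathbb{R}}|\Phi_\alpha(E)|\,d\alpha=|E-\mathcal{C}|,$$ where $|\cdot|$ is Lebesgue measure (of the appropriate dimension). Four-corner Cantor set: $C_0=[0,1]$ and for $n\ge 1$, $C_n=\bigcup_{a_1,\dots,a_n\in\{0,3\}}\left[\sum_{j=1}^n a_j4^{-j},\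 \sum_{j=1}^n a_j4^{-j}+4^{-n}\right]$; $K_n=C_n\times C_n$. Curve class: "piecewise $C^1$ with a piecewise bi-Lipschitz continuous unit tangent vector" means that $\mathcal{C}$ can be written as a disjoint union of finitely many subcurves, each of which is $C^1$ with a unit tangent vector $T$ that is bi-Lipschitz along the subcurve (as a function of arclength $s$: there is $\lambda\ge 1$ with $\lambda^{-1}|s-t|\le|T(s)-T(t)|\le\lambda|s-t|$ for all $s,t$ in the parameter interval of that subcurve). *)

theory Defs
  imports "HOL-Analysis.Analysis"
begin

definition curve_length :: "real set \<Rightarrow> (real \<Rightarrow> 'a::metric_space) \<Rightarrow> ennreal" where
  "curve_length J g =
     (SUP (m, t) \<in> {(m::nat, t). mono_on {..m} t \<and> t ` {..m} \<subseteq> J}.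
        \<Sum>i<m. ennreal (dist (g (t i)) (g (t (Suc i)))))"

definition finite_length_curve :: "(real \<times> real) set \<Rightarrow> bool" where
  "finite_length_curve \<C> \<longleftrightarrow>
     (\<exists>J g. is_interval J \<and> J \<noteq> {} \<and> continuous_on J g \<and> \<C> = g ` J \<and> curve_length J g < \<infinity>)"

(* The parameter interval I is bounded and nondegenerate, but each endpoint may or may not
   belong to it: disjoint subcurves of a connected curve cannot all contain their endpoints.
   At an endpoint in I the derivative is one-sided. The parametrization has unit speed, so
   the parameter is arclength and the derivative T is the unit tangent vector. *)
definition bilipschitz_tangent_arc :: "(real \<times> real) set \<Rightarrow> bool" where
  "bilipschitz_tangent_arc S \<longleftrightarrow>
     (\<exists>a b I \<gamma> T K.
        a < b \<and> {a<..<b} \<subseteq> I \<and> I \<subseteq> {a..b} \<and> S = \<gamma> ` I \<and>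
        (\<forall>s\<in>I. (\<gamma> has_vector_derivative T s) (at s within I)) \<and>
        continuous_on I T \<and> (\<forall>s\<in>I. norm (T s) = 1) \<and>
        1 \<le> K \<and>
        (\<forall>s\<in>I. \<forall>t\<in>I. inverse K * \<bar>s - t\<bar> \<le> norm (T s - T t) \<and>
                       norm (T s - T t) \<le> K * \<bar>s - t\<bar>))"

definition piecewise_bilipschitz_tangent :: "(real \<times> real) set \<Rightarrow> bool" where
  "piecewise_bilipschitz_tangent \<C> \<longleftrightarrow>
     (\<exists>P. finite P \<and> disjoint P \<and> \<Union>P = \<C> \<and> (\<forall>S\<in>P. bilipschitz_tangent_arc S))"

(* For the curves and sets E considered here (compact E, and a finite union of continuous
   images of intervals) the measured set E - \<C> is sigma-compact, hence measurable. *)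
definition favard_curve_length :: "(real \<times> real) set \<Rightarrow> (real \<times> real) set \<Rightarrow> ennreal" where
  "favard_curve_length \<C> E =
     emeasure lebesgue {(\<alpha>, \<beta>). (\<lambda>z. (\<alpha>, \<beta>) + z) ` \<C> \<inter> E \<noteq> {}}"

definition cantor_gen :: "nat \<Rightarrow> real set" where
  "cantor_gen n =
     (\<Union>a \<in> {1..n} \<rightarrow> {0, 3}. {(\<Sum>j=1..n. a j / 4 ^ j) .. (\<Sum>j=1..n. a j / 4 ^ j) + 1 / 4 ^ n})"

definition four_corner_gen :: "nat \<Rightarrow> (real \<times> real) set" where
  "four_corner_gen n = cantor_gen n \<times> cantor_gen n"

end

theory Submission
  imports Defs
begin

text \<open>Zoom in until the curve is straight. Write \<open>n = m + l\<close> with \<open>m\<close> about \<open>n / 2\<close>. The set \<open>K\<^sub>n\<close> is a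
union of \<open>4 ^ m\<close> copies of \<open>K\<^sub>l\<close> scaled by \<open>4 ^ - m\<close>, and over a parameter interval of length about
\<open>4 ^ - m\<close> the curve leaves its tangent by only about \<open>16 ^ - m\<close>, which is less than the size \<open>4 ^ - n\<close>
of the smallest squares. Each such piece of the curve therefore sees a copy of \<open>K\<^sub>l\<close> as its tangent line
does: the translations for which they meet form a sheared strip whose cross-section is the projection of
\<open>K\<^sub>l\<close> along the tangent. The tangent direction is bi-Lipschitz in the parameter, so that adding up the
strips integrates the length of the projection over the directions, with bounded overlap
(\<open>flat_arc_cover\<close>). Hence the Favard curve length of \<open>K\<^sub>n\<close> is at most a constant times the classical
mean projection length of \<open>K\<^sub>l\<close>, called \<open>mean_shadow l\<close> below.

For the mean projection a power law is proved along the lines of Nazarov, Peres and Volberg. Fix a slope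
\<open>t\<close> and a level \<open>K\<close>, and count for each cell of the projection how many squares project into it. There are
two cases (\<open>shadow_len_small_or_energy_small\<close>).

\<^item> Stacks of at least \<open>K\<close> squares over one cell, at scales down to \<open>4 ^ - N\<close>, occupy a length of order at
  least \<open>1 / K\<^sup>2\<close>. The squares in a stack have total mass \<open>K\<close> times the length that they cover; removing
  them and repeating the argument inside all remaining squares (\<open>shadow_len_recursion\<close>) leaves a
  projection of length \<open>O(1 / K)\<close> after about \<open>K log K\<close> rounds.

\<^item> Otherwise the counting function has square integral \<open>O(K)\<close> at all scales down to \<open>4 ^ - N\<close>
  (\<open>energy_le_of_small_stacks\<close>).

In the second case the Fourier transform of the projected measure has a bounded \<open>L\<^sup>2\<close> norm on a range
of frequencies with about \<open>N / log K\<close> separate blocks, so on most blocks its \<open>L\<^sup>2\<close> norm is small. The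
transform is the product of a high-frequency and a low-frequency part. The former is large on average
on each block (\<open>transform_lower\<close>), so the mass of the former sits where the latter is small. The latter
is bounded below by a product of two sines, and polar coordinates adapted to slopes (\<open>v = t y\<close>) turn the
average over \<open>t\<close> of that mass into a product of two one-dimensional integrals of Riesz products near
the zeros of a sine, which scale explicitly (\<open>small_mass_average\<close>). Thus the second case happens only
for a small set of slopes. Combining the levels \<open>K = 4 ^ i\<close> for \<open>i \<le> I\<close> in
\<open>shadow_len_pointwise\<close> costs \<open>N K log K\<close> generations, of order \<open>4 ^ (5 I)\<close> up to a factor \<open>I\<^sup>2\<close>, and gives
a mean projection of length \<open>O(I\<^sup>2 4 ^ - I)\<close>.\<close>

section \<open>Words, cells and stacks\<close>

text \<open>The digit \<open>(p, q)\<close> selects one of the four corner squares: the right ones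
if \<open>p\<close>, the upper ones if \<open>q\<close>.\<close>

type_synonym digit = "bool \<times> bool"

abbreviation words :: "nat \<Rightarrow> digit list set" where
  "words n \<equiv> {w. length w = n}"

text \<open>The first letter is the most significant one, so that \<open>pos d w / 4 ^ n\<close> is
\<open>\<Sum>j. d (w j) / 4 ^ j\<close> for a word \<open>w\<close> of length \<open>n\<close>.
Multiplying by \<open>4 ^ n\<close> makes the cells of every level unit intervals.\<close>

fun pos :: "(digit \<Rightarrow> real) \<Rightarrow> digit list \<Rightarrow> real" where
  "pos d [] = 0"
| "pos d (x # w) = 4 ^ length w * d x + pos d w"

text \<open>The radius 2 is large enough for the cells to be nested: a prefix of a word in a cell is
in the parent cell, see \<open>prefix_in_parent_cell\<close>.\<close>

definition cell_words :: "(digit \<Rightarrow> real) \<Rightarrow> nat \<Rightarrow> int \<Rightarrow> digit list set" where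
  "cell_words d n i = {w. length w = n \<and> \<bar>pos d w - of_int i\<bar> \<le> 2}"

definition stack :: "(digit \<Rightarrow> real) \<Rightarrow> nat \<Rightarrow> int \<Rightarrow> nat" where
  "stack d n i = card (cell_words d n i)"

text \<open>Outside the range of summation \<open>stack d n\<close> vanishes when
\<open>\<bar>d\<bar> \<le> 1\<close>. Up to constants, \<open>energy d n / 4 ^ n\<close> is the
square integral of the function that counts the squares over a point of the line.\<close>

definition energy :: "(digit \<Rightarrow> real) \<Rightarrow> nat \<Rightarrow> real" where
  "energy d n = (\<Sum>i\<in>{- (4 ^ n + 2)..4 ^ n + 2}. real (stack d n i) ^ 2)"

lemma finite_words [simp]: "finite (words n)"
  using finite_lists_length_eq[of "UNIV :: digit set" n] by simp

lemma card_words: "card (words n) = 4 ^ n"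
  using card_lists_length_eq[of "UNIV :: digit set" n] by simp

lemma finite_cell_words [simp]: "finite (cell_words d n i)"
  unfolding cell_words_def by (rule finite_subset[OF _ finite_words[of n]]) auto

lemma pos_append: "pos d (u @ v) = 4 ^ length v * pos d u + pos d v"
  by (induction u) (auto simp: algebra_simps power_add)

lemma abs_pos_le:
  assumes "\<And>x. \<bar>d x\<bar> \<le> 1"
  shows "\<bar>pos d w\<bar> \<le> 4 ^ length w / 3 - 1 / 3"
proof (induction w)
  case (Cons x w)
  have "\<bar>4 ^ length w * d x\<bar> \<le> 4 ^ length w"
    using assms[of x] by (simp add: abs_mult)
  then have "\<bar>4 ^ length w * d x + pos d w\<bar> \<le> 4 ^ length w + 4 ^ length w / 3 - 1 / 3"
    using Cons by linarith
  then show ?case by (simp add: field_simps)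
qed auto

lemma floor_div_bounds:
  fixes i :: int and l :: nat
  shows "of_int (i div 4 ^ l) \<le> of_int i / (4::real) ^ l"
    "of_int i / (4::real) ^ l \<le> of_int (i div 4 ^ l) + 1 - 1 / 4 ^ l"
proof -
  obtain q r where q: "q = i div 4 ^ l" and r: "r = i mod 4 ^ l" by blast
  have i: "i = q * 4 ^ l + r" unfolding q r by (rule div_mult_mod_eq[symmetric])
  have "0 \<le> r" "r < 4 ^ l" unfolding r by simp_all
  then have "real_of_int 0 \<le> real_of_int r" "real_of_int (r + 1) \<le> real_of_int (4 ^ l)"
    unfolding of_int_le_iff by linarith+
  then have r0: "0 \<le> real_of_int r" and r3: "real_of_int r \<le> 4 ^ l - 1" by simp_all
  have e: "real_of_int i / 4 ^ l = real_of_int q + real_of_int r / 4 ^ l"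
    unfolding i by (simp add: add_divide_distrib)
  have "real_of_int r / 4 ^ l \<le> (4 ^ l - 1) / 4 ^ l" using r3 by (rule divide_right_mono) simp
  also have "(4 ^ l - 1) / 4 ^ l = 1 - 1 / (4::real) ^ l" by (simp add: diff_divide_distrib)
  finally show "of_int i / (4::real) ^ l \<le> of_int (i div 4 ^ l) + 1 - 1 / 4 ^ l"
    unfolding e q[symmetric] by simp
  show "of_int (i div 4 ^ l) \<le> of_int i / (4::real) ^ l"
    unfolding e q[symmetric] using r0 by simp
qed

lemma prefix_in_parent_cell:
  assumes d: "\<And>x. \<bar>d x\<bar> \<le> 1" and w: "u @ v \<in> cell_words d (k + l) i" and l: "length v = l"
  shows "u \<in> cell_words d k (i div 4 ^ l)"
proof -
  let ?q = "real_of_int (i div 4 ^ l)"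
  have len: "length u = k" using w l by (auto simp: cell_words_def)
  have "\<bar>4 ^ l * pos d u + pos d v - of_int i\<bar> \<le> 2"
    using w l by (auto simp: cell_words_def pos_append)
  moreover have "\<bar>pos d v\<bar> \<le> 4 ^ l / 3 - 1 / 3" using abs_pos_le[of d v] d l by auto
  ultimately have 1: "\<bar>4 ^ l * pos d u - of_int i\<bar> \<le> 2 + (4 ^ l / 3 - 1 / 3)" by linarith
  have 2: "4 ^ l * ?q \<le> of_int i" "of_int i \<le> 4 ^ l * ?q + 4 ^ l - 1"
    using floor_div_bounds[where i=i and l=l] by (auto simp: field_simps)
  have "\<bar>X - Y\<bar> \<le> c * 2"
    if "\<bar>X - i\<bar> \<le> 2 + (c / 3 - 1 / 3)" "Y \<le> i" "i \<le> Y + c - 1" "1 \<le> c" for X Y i c :: real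
    using that by linarith
  from this[OF 1 2] have "\<bar>4 ^ l * pos d u - 4 ^ l * ?q\<bar> \<le> 4 ^ l * 2" by simp
  then have "4 ^ l * \<bar>pos d u - ?q\<bar> \<le> 4 ^ l * 2"
    by (simp only: abs_mult power_abs abs_numeral flip: right_diff_distrib)
  then have "\<bar>pos d u - ?q\<bar> \<le> 2" by (rule mult_left_le_imp_le) simp
  then show ?thesis using len unfolding cell_words_def by simp
qed

lemma stack_0_le: "stack d 0 i \<le> 1"
proof -
  have "cell_words d 0 i \<subseteq> {[]}" by (auto simp: cell_words_def)
  then have "card (cell_words d 0 i) \<le> card {[] :: digit list}" by (intro card_mono) auto
  then show ?thesis by (simp add: stack_def)
qed

lemma stack_Suc_le:
  assumes d: "\<And>x. \<bar>d x\<bar> \<le> 1"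
  shows "stack d (Suc k) i \<le> 4 * stack d k (i div 4)"
proof -
  have "cell_words d (Suc k) i \<subseteq> (\<lambda>(u, x). u @ [x]) ` (cell_words d k (i div 4) \<times> UNIV)"
  proof
    fix w assume w: "w \<in> cell_words d (Suc k) i"
    then have "w \<noteq> []" by (auto simp: cell_words_def)
    then have e: "w = butlast w @ [last w]" by simp
    have "butlast w \<in> cell_words d k (i div 4 ^ 1)"
      using prefix_in_parent_cell[of d "butlast w" "[last w]" k 1 i] w e d by simp
    then show "w \<in> (\<lambda>(u, x). u @ [x]) ` (cell_words d k (i div 4) \<times> UNIV)"
      using e by (auto intro!: image_eqI[of _ _ "(butlast w, last w)"])
  qed
  then have "stack d (Suc k) i \<le> card ((\<lambda>(u, x). u @ [x]) ` (cell_words d k (i div 4) \<times> (UNIV::digit set)))"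
    unfolding stack_def by (intro card_mono finite_imageI finite_cartesian_product) auto
  also have "\<dots> \<le> card (cell_words d k (i div 4) \<times> (UNIV::digit set))"
    by (intro card_image_le finite_cartesian_product) auto
  also have "\<dots> = 4 * stack d k (i div 4)" by (simp add: card_cartesian_product stack_def)
  finally show ?thesis .
qed

lemma stack_outside:
  assumes d: "\<And>x. \<bar>d x\<bar> \<le> 1" and i: "i \<notin> {- (4 ^ n + 2)..4 ^ n + 2}"
  shows "stack d n i = 0"
proof -
  have "w \<notin> cell_words d n i" for w
  proof
    assume w: "w \<in> cell_words d n i"
    then have 1: "\<bar>pos d w\<bar> \<le> 4 ^ n / 3 - 1 / 3" using abs_pos_le[of d w] d by (auto simp: cell_words_def)
    have 2: "\<bar>pos d w - of_int i\<bar> \<le> 2" using w by (auto simp: cell_words_def)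
    have "\<bar>y\<bar> \<le> c + 2" if "\<bar>X\<bar> \<le> c / 3 - 1 / 3" "\<bar>X - y\<bar> \<le> 2" "1 \<le> c" for X y c :: real
      using that by linarith
    from this[OF 1 2] have "\<bar>real_of_int i\<bar> \<le> 4 ^ n + 2" by simp
    then have "real_of_int \<bar>i\<bar> \<le> real_of_int (4 ^ n + 2)" by simp
    then have "\<bar>i\<bar> \<le> 4 ^ n + 2" by (simp only: of_int_le_iff)
    then show False using i by auto
  qed
  then have "cell_words d n i = {}" by auto
  then show ?thesis by (simp add: stack_def)
qed

lemma sum_stack_sq_le_energy:
  assumes d: "\<And>x. \<bar>d x\<bar> \<le> 1" and "finite A"
  shows "(\<Sum>i\<in>A. real (stack d n i) ^ 2) \<le> energy d n"
proof -
  let ?B = "{- (4 ^ n + 2)..4 ^ n + (2::int)}"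
  have "(\<Sum>i\<in>A. real (stack d n i) ^ 2) = (\<Sum>i\<in>A \<inter> ?B. real (stack d n i) ^ 2)"
    using stack_outside[OF d] by (intro sum.mono_neutral_right assms) auto
  also have "\<dots> \<le> energy d n" unfolding energy_def by (intro sum_mono2) auto
  finally show ?thesis .
qed

text \<open>Each word lies in at most five cells.\<close>

lemma sum_stack_le:
  assumes "finite A"
  shows "(\<Sum>i\<in>A. stack d n i) \<le> 5 * 4 ^ n"
proof -
  have "(\<Sum>i\<in>A. stack d n i) = (\<Sum>i\<in>A. \<Sum>w\<in>words n. if \<bar>pos d w - of_int i\<bar> \<le> 2 then 1 else 0)"
  proof (intro sum.cong refl)
    fix i
    have "cell_words d n i = words n \<inter> {w. \<bar>pos d w - of_int i\<bar> \<le> 2}"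
      by (auto simp: cell_words_def)
    then show "stack d n i = (\<Sum>w\<in>words n. if \<bar>pos d w - of_int i\<bar> \<le> 2 then 1 else 0)"
      using finite_words[of n] by (simp add: stack_def sum.If_cases)
  qed
  also have "\<dots> = (\<Sum>w\<in>words n. \<Sum>i\<in>A. if \<bar>pos d w - of_int i\<bar> \<le> 2 then 1 else 0)"
    by (rule sum.swap)
  also have "\<dots> \<le> (\<Sum>w\<in>words n. 5)"
  proof (rule sum_mono)
    fix w
    have "A \<inter> {i. \<bar>pos d w - of_int i\<bar> \<le> 2} \<subseteq> {\<lceil>pos d w\<rceil> - 2..\<lceil>pos d w\<rceil> + 2}"
      by (auto simp: abs_le_iff) linarith+
    then have "card (A \<inter> {i. \<bar>pos d w - of_int i\<bar> \<le> 2}) \<le> card {\<lceil>pos d w\<rceil> - 2..\<lceil>pos d w\<rceil> + 2}"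
      by (intro card_mono) auto
    then show "(\<Sum>i\<in>A. if \<bar>pos d w - of_int i\<bar> \<le> 2 then 1 else 0) \<le> (5::nat)"
      using assms by (simp add: sum.If_cases)
  qed
  also have "\<dots> = 5 * 4 ^ n" using card_words[of n] by simp
  finally show ?thesis .
qed

text \<open>Below a cell the counting function is a sum of \<open>stack d k i'\<close> translated
copies of the one of level \<open>l\<close>, one for each word in the cell; the Cauchy-Schwarz
inequality bounds the square of the sum. A translation by a real number is absorbed by two
neighbouring cells, which costs the factor 4.\<close>

lemma energy_descendants:
  assumes d: "\<And>x. \<bar>d x\<bar> \<le> 1" and A: "finite A" "\<And>i. i \<in> A \<Longrightarrow> i div 4 ^ l = i'"
  shows "(\<Sum>i\<in>A. real (stack d (k + l) i) ^ 2) \<le> 4 * real (stack d k i') ^ 2 * energy d l"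
proof -
  let ?U = "cell_words d k i'"
  define c where "c = (\<lambda>u. \<lceil>4 ^ l * pos d u\<rceil>)"
  define g where "g = (\<lambda>u i. real (stack d l (i - c u)) + real (stack d l (i - c u + 1)))"
  have le: "real (stack d (k + l) i) \<le> (\<Sum>u\<in>?U. g u i)" if "i \<in> A" for i
  proof -
    have "cell_words d (k + l) i \<subseteq>
        (\<Union>u\<in>?U. (\<lambda>v. u @ v) ` (cell_words d l (i - c u) \<union> cell_words d l (i - c u + 1)))"
    proof
      fix w assume w: "w \<in> cell_words d (k + l) i"
      define u v where "u = take k w" and "v = drop k w"
      have wuv: "w = u @ v" and lv: "length v = l" using w by (auto simp: u_def v_def cell_words_def)
      have u: "u \<in> ?U" using prefix_in_parent_cell[of d u v k l i] d w wuv lv A(2)[OF that] by auto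
      have "\<bar>4 ^ l * pos d u + pos d v - of_int i\<bar> \<le> 2"
        using w lv wuv by (auto simp: cell_words_def pos_append)
      moreover have "of_int (c u) - 1 < 4 ^ l * pos d u" "4 ^ l * pos d u \<le> of_int (c u)"
        unfolding c_def by linarith+
      ultimately have "\<bar>pos d v - of_int (i - c u)\<bar> \<le> 2 \<or> \<bar>pos d v - of_int (i - c u + 1)\<bar> \<le> 2"
        unfolding of_int_diff of_int_add of_int_1 by linarith
      then have "v \<in> cell_words d l (i - c u) \<union> cell_words d l (i - c u + 1)"
        using lv unfolding cell_words_def by simp
      then show "w \<in> (\<Union>u\<in>?U. (\<lambda>v. u @ v) ` (cell_words d l (i - c u) \<union> cell_words d l (i - c u + 1)))"
        using u wuv by blast
    qed
    then have "stack d (k + l) i \<le> card (\<Union>u\<in>?U. (\<lambda>v. u @ v) ` (cell_words d l (i - c u) \<union> cell_words d l (i - c u + 1)))"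
      unfolding stack_def by (intro card_mono) auto
    also have "\<dots> \<le> (\<Sum>u\<in>?U. card ((\<lambda>v. u @ v) ` (cell_words d l (i - c u) \<union> cell_words d l (i - c u + 1))))"
      by (rule card_UN_le) simp
    also have "\<dots> \<le> (\<Sum>u\<in>?U. stack d l (i - c u) + stack d l (i - c u + 1))"
      unfolding stack_def by (intro sum_mono order_trans[OF card_image_le card_Un_le]) simp
    finally have "real (stack d (k + l) i) \<le> real (\<Sum>u\<in>?U. stack d l (i - c u) + stack d l (i - c u + 1))"
      by (rule of_nat_mono)
    then show ?thesis by (simp add: g_def)
  qed
  have shift: "(\<Sum>i\<in>A. real (stack d l (i + e)) ^ 2) \<le> energy d l" for e
  proof -
    have "(\<Sum>i\<in>A. real (stack d l (i + e)) ^ 2) = (\<Sum>i\<in>(\<lambda>i. i + e) ` A. real (stack d l i) ^ 2)"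
      by (subst sum.reindex) (auto simp: inj_on_def)
    also have "\<dots> \<le> energy d l" by (intro sum_stack_sq_le_energy d) (use A in auto)
    finally show ?thesis .
  qed
  have "(\<Sum>i\<in>A. real (stack d (k + l) i) ^ 2) \<le> (\<Sum>i\<in>A. (\<Sum>u\<in>?U. g u i) ^ 2)"
    by (intro sum_mono power_mono le) auto
  also have "\<dots> \<le> (\<Sum>i\<in>A. real (stack d k i') * (\<Sum>u\<in>?U. g u i ^ 2))"
  proof (intro sum_mono)
    fix i
    have "(\<Sum>u\<in>?U. 1 * g u i) ^ 2 \<le> (\<Sum>u\<in>?U. 1 ^ 2) * (\<Sum>u\<in>?U. g u i ^ 2)"
      by (rule Cauchy_Schwarz_ineq_sum)
    then show "(\<Sum>u\<in>?U. g u i) ^ 2 \<le> real (stack d k i') * (\<Sum>u\<in>?U. g u i ^ 2)"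
      by (simp add: stack_def)
  qed
  also have "\<dots> = real (stack d k i') * (\<Sum>u\<in>?U. \<Sum>i\<in>A. g u i ^ 2)"
    by (simp add: sum_distrib_left) (rule sum.swap)
  also have "\<dots> \<le> real (stack d k i') * (\<Sum>u\<in>?U. 4 * energy d l)"
  proof (intro mult_left_mono sum_mono)
    fix u
    have "(\<Sum>i\<in>A. g u i ^ 2) \<le> (\<Sum>i\<in>A. 2 * real (stack d l (i + (- c u))) ^ 2 + 2 * real (stack d l (i + (1 - c u))) ^ 2)"
    proof (rule sum_mono)
      fix i
      have *: "(x + y)\<^sup>2 \<le> 2 * x\<^sup>2 + 2 * y\<^sup>2" for x y :: real
        using sum_squares_bound[of x y] unfolding power2_sum by linarith
      have "i + (- c u) = i - c u" "i + (1 - c u) = i - c u + 1" by simp_all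
      then show "g u i ^ 2 \<le> 2 * real (stack d l (i + (- c u))) ^ 2 + 2 * real (stack d l (i + (1 - c u))) ^ 2"
        unfolding g_def by (simp only: *)
    qed
    also have "\<dots> = 2 * (\<Sum>i\<in>A. real (stack d l (i + (- c u))) ^ 2) + 2 * (\<Sum>i\<in>A. real (stack d l (i + (1 - c u))) ^ 2)"
      by (simp add: sum.distrib sum_distrib_left)
    also have "\<dots> \<le> 4 * energy d l" using shift[of "- c u"] shift[of "1 - c u"] by linarith
    finally show "(\<Sum>i\<in>A. g u i ^ 2) \<le> 4 * energy d l" .
  qed auto
  also have "\<dots> = 4 * real (stack d k i') ^ 2 * energy d l"
    by (simp add: stack_def power2_eq_square)
  finally show ?thesis .
qed

section \<open>Stacks and the length of shadows\<close>

text \<open>A finite Vitali covering lemma: keep an element of least level, discard everything near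
it, and repeat.\<close>

lemma greedy_selection:
  fixes lev :: "'a \<Rightarrow> nat" and near :: "'a \<Rightarrow> 'a \<Rightarrow> bool"
  assumes "finite X" and refl: "\<And>x. near x x"
    and sym: "\<And>x y. lev x = lev y \<Longrightarrow> near x y \<Longrightarrow> near y x"
  shows "\<exists>S\<subseteq>X. (\<forall>x\<in>X. \<exists>s\<in>S. lev s \<le> lev x \<and> near s x) \<and>
    (\<forall>s\<in>S. \<forall>s'\<in>S. s \<noteq> s' \<longrightarrow> lev s \<le> lev s' \<longrightarrow> \<not> near s s')"
  using \<open>finite X\<close>
proof (induction "card X" arbitrary: X rule: less_induct)
  case less
  show ?case
  proof (cases "X = {}")
    case False
    define x0 where "x0 = arg_min_on lev X"
    have x0: "x0 \<in> X" "\<And>x. x \<in> X \<Longrightarrow> lev x0 \<le> lev x"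
      using arg_min_if_finite[OF less.prems False, of lev] arg_min_least[OF less.prems False, of _ lev]
      unfolding x0_def by auto
    let ?X = "{x \<in> X. \<not> near x0 x}"
    have "?X \<subset> X" using x0(1) refl by auto
    then have "card ?X < card X" using less.prems by (rule psubset_card_mono[rotated])
    from less.hyps[OF this] less.prems obtain S where S: "S \<subseteq> ?X"
      "\<forall>x\<in>?X. \<exists>s\<in>S. lev s \<le> lev x \<and> near s x"
      "\<forall>s\<in>S. \<forall>s'\<in>S. s \<noteq> s' \<longrightarrow> lev s \<le> lev s' \<longrightarrow> \<not> near s s'"
      by auto
    have 1: "\<not> near s x0" if "s \<in> S" "lev s \<le> lev x0" for s
    proof
      assume "near s x0"
      moreover have "s \<in> ?X" using that S(1) by auto
      moreover from this have "lev s = lev x0" using x0(2)[of s] that by auto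
      ultimately show False using sym[of s x0] by auto
    qed
    show ?thesis
    proof (intro exI[of _ "insert x0 S"] conjI ballI impI)
      show "insert x0 S \<subseteq> X" using S(1) x0 by auto
      fix x assume "x \<in> X"
      then show "\<exists>s\<in>insert x0 S. lev s \<le> lev x \<and> near s x"
        using S(2) x0 by (cases "near x0 x") auto
    next
      fix s s' assume "s \<in> insert x0 S" "s' \<in> insert x0 S" "s \<noteq> s'" "lev s \<le> lev s'"
      then show "\<not> near s s'" using S(1,3) 1 by blast
    qed
  qed auto
qed

text \<open>\<open>S\<close> is a Vitali family of stacks, that is, of cells \<open>(k, i)\<close>
of level \<open>k \<le> N\<close> that contain at least \<open>K\<close> words: every stack is
within distance 4 of a selected one of the same or a lower level, and the selected ones are further
apart than that. Since cells have radius 2, distance 4 is what keeps the words in different selected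
cells from being prefixes of each other.\<close>

definition stack_selection :: "(digit \<Rightarrow> real) \<Rightarrow> nat \<Rightarrow> nat \<Rightarrow> (nat \<times> int) set \<Rightarrow> bool" where
  "stack_selection d N K S \<longleftrightarrow> finite S \<and>
     (\<forall>k i. (k, i) \<in> S \<longrightarrow> k \<le> N \<and> K \<le> stack d k i) \<and>
     (\<forall>k i. k \<le> N \<and> K \<le> stack d k i \<longrightarrow>
        (\<exists>k0 i0. (k0, i0) \<in> S \<and> k0 \<le> k \<and> \<bar>i div 4 ^ (k - k0) - i0\<bar> \<le> 4)) \<and>
     (\<forall>k i k' i'. (k, i) \<in> S \<and> (k', i') \<in> S \<and> (k, i) \<noteq> (k', i') \<and> k \<le> k' \<longrightarrow>
        4 < \<bar>i' div 4 ^ (k' - k) - i\<bar>)"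

lemma stack_selectionD:
  assumes "stack_selection d N K S"
  shows "finite S"
    and "(k, i) \<in> S \<Longrightarrow> k \<le> N"
    and "(k, i) \<in> S \<Longrightarrow> K \<le> stack d k i"
    and "k \<le> N \<Longrightarrow> K \<le> stack d k i \<Longrightarrow>
      \<exists>k0 i0. (k0, i0) \<in> S \<and> k0 \<le> k \<and> \<bar>i div 4 ^ (k - k0) - i0\<bar> \<le> 4"
    and "(k, i) \<in> S \<Longrightarrow> (k', i') \<in> S \<Longrightarrow> (k, i) \<noteq> (k', i') \<Longrightarrow> k \<le> k' \<Longrightarrow>
      4 < \<bar>i' div 4 ^ (k' - k) - i\<bar>"
  using assms unfolding stack_selection_def by blast+

definition stack_length :: "(nat \<times> int) set \<Rightarrow> real" where
  "stack_length S = (\<Sum>(k, i)\<in>S. 1 / 4 ^ k)"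

lemma stack_selection_exists:
  assumes d: "\<And>x. \<bar>d x\<bar> \<le> 1" and K: "1 \<le> K"
  shows "\<exists>S. stack_selection d N K S"
proof -
  define X where "X = {x. fst x \<le> N \<and> K \<le> stack d (fst x) (snd x)}"
  define near where "near = (\<lambda>x y::nat \<times> int. \<bar>snd y div 4 ^ (fst y - fst x) - snd x\<bar> \<le> 4)"
  have "X \<subseteq> (SIGMA k:{..N}. {- (4 ^ k + 2)..4 ^ k + 2})"
  proof
    fix x assume "x \<in> X"
    then have "fst x \<le> N" "stack d (fst x) (snd x) \<noteq> 0" using K by (auto simp: X_def)
    moreover have "snd x \<in> {- (4 ^ fst x + 2)..4 ^ fst x + 2}"
    proof (rule ccontr)
      assume "snd x \<notin> {- (4 ^ fst x + 2)..4 ^ fst x + 2}"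
      from stack_outside[of d, OF d this] show False using \<open>stack d (fst x) (snd x) \<noteq> 0\<close> by simp
    qed
    ultimately have "(fst x, snd x) \<in> (SIGMA k:{..N}. {- (4 ^ k + 2)..4 ^ k + 2})" by (intro SigmaI) simp_all
    then show "x \<in> (SIGMA k:{..N}. {- (4 ^ k + 2)..4 ^ k + 2})" by simp
  qed
  moreover have "finite (SIGMA k:{..N}. {- (4 ^ k + 2)..4 ^ k + (2::int)})" by auto
  ultimately have fin: "finite X" by (rule finite_subset)
  have r: "near x x" for x by (simp add: near_def)
  have sy: "near y x" if "fst x = fst y" "near x y" for x y
    using that by (simp add: near_def abs_minus_commute)
  have "\<exists>S\<subseteq>X. (\<forall>x\<in>X. \<exists>s\<in>S. fst s \<le> fst x \<and> near s x) \<and>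
      (\<forall>s\<in>S. \<forall>s'\<in>S. s \<noteq> s' \<longrightarrow> fst s \<le> fst s' \<longrightarrow> \<not> near s s')"
    by (rule greedy_selection[where near=near and lev=fst, OF fin r]) (rule sy)
  then obtain S where S: "S \<subseteq> X"
     "\<forall>x\<in>X. \<exists>s\<in>S. fst s \<le> fst x \<and> near s x"
     "\<forall>s\<in>S. \<forall>s'\<in>S. s \<noteq> s' \<longrightarrow> fst s \<le> fst s' \<longrightarrow> \<not> near s s'"
    by (elim exE conjE) (rule that; assumption)
  have "finite S" using S(1) fin by (rule finite_subset)
  moreover have "k \<le> N \<and> K \<le> stack d k i" if "(k, i) \<in> S" for k i
    using S(1) that unfolding X_def by fastforce
  moreover have "\<exists>k0 i0. (k0, i0) \<in> S \<and> k0 \<le> k \<and> \<bar>i div 4 ^ (k - k0) - i0\<bar> \<le> 4"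
    if "k \<le> N \<and> K \<le> stack d k i" for k i
  proof -
    have "(k, i) \<in> X" using that by (simp add: X_def)
    then obtain s where "s \<in> S" "fst s \<le> k" "near s (k, i)" using S(2) by force
    then show ?thesis by (intro exI[of _ "fst s"] exI[of _ "snd s"]) (simp add: near_def)
  qed
  moreover have "4 < \<bar>i' div 4 ^ (k' - k) - i\<bar>"
    if "(k, i) \<in> S \<and> (k', i') \<in> S \<and> (k, i) \<noteq> (k', i') \<and> k \<le> k'" for k i k' i'
    using S(3)[rule_format, of "(k, i)" "(k', i')"] that by (simp add: near_def)
  ultimately have "stack_selection d N K S"
    unfolding stack_selection_def by blast
  then show ?thesis ..
qed

text \<open>Cells with fewer than \<open>K\<close> words contribute at most \<open>K\<close> times
the number of incidences. Any other cell has a first ancestor that is a stack, and near it there is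
a selected stack \<open>s\<close>; the ancestor at the level of \<open>s\<close> still contains at
most \<open>4 K\<close> words, since the number of words grows at most by the factor 4 from one
level to the next. Below this ancestor \<open>energy_descendants\<close> and the induction
hypothesis apply, and the total contribution is at most half of the claimed bound because the
selected stacks are short.\<close>

lemma energy_le_of_small_stacks:
  assumes d: "\<And>x. \<bar>d x\<bar> \<le> 1" and K: "2 \<le> K" and S: "stack_selection d N K S"
    and V: "1152 * real K ^ 2 * stack_length S \<le> 1"
  shows "n \<le> N \<Longrightarrow> energy d n \<le> 10 * real K * 4 ^ n"
proof (induction n rule: less_induct)
  case (less n)
  let ?R = "{- (4 ^ n + 2)..4 ^ n + (2::int)}"
  define Lo where "Lo = {i \<in> ?R. stack d n i < K}"
  define Hi where "Hi = {i \<in> ?R. K \<le> stack d n i}"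
  have "finite ?R" by simp
  moreover have "Lo \<subseteq> ?R" "Hi \<subseteq> ?R" unfolding Lo_def Hi_def by auto
  ultimately have fin: "finite Lo" "finite Hi" "finite S"
    using stack_selectionD(1)[OF S] finite_subset by (blast, blast, blast)
  have "energy d n = (\<Sum>i\<in>Lo \<union> Hi. real (stack d n i) ^ 2)"
    unfolding energy_def by (rule sum.cong) (auto simp: Lo_def Hi_def)
  also have "\<dots> = (\<Sum>i\<in>Lo. real (stack d n i) ^ 2) + (\<Sum>i\<in>Hi. real (stack d n i) ^ 2)"
    by (rule sum.union_disjoint) (use fin in \<open>auto simp: Lo_def Hi_def\<close>)
  finally have split: "energy d n = (\<Sum>i\<in>Lo. real (stack d n i) ^ 2) + (\<Sum>i\<in>Hi. real (stack d n i) ^ 2)" .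
  have "(\<Sum>i\<in>Lo. real (stack d n i) ^ 2) \<le> (\<Sum>i\<in>Lo. real K * real (stack d n i))"
    by (rule sum_mono) (auto simp: Lo_def power2_eq_square intro!: mult_right_mono)
  also have "\<dots> = real K * real (\<Sum>i\<in>Lo. stack d n i)" by (simp add: sum_distrib_left)
  also have "\<dots> \<le> real K * real (5 * 4 ^ n)"
    by (intro mult_left_mono of_nat_mono sum_stack_le fin) auto
  finally have low: "(\<Sum>i\<in>Lo. real (stack d n i) ^ 2) \<le> 5 * real K * 4 ^ n" by simp
  have "\<exists>s\<in>S. fst s \<le> n \<and> \<bar>i div 4 ^ (n - fst s) - snd s\<bar> \<le> 4 \<and>
      stack d (fst s) (i div 4 ^ (n - fst s)) \<le> 4 * K" if "i \<in> Hi" for i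
  proof -
    define P where "P = (\<lambda>k. k \<le> n \<and> K \<le> stack d k (i div 4 ^ (n - k)))"
    define k where "k = (LEAST k. P k)"
    have "P n" using that by (simp add: P_def Hi_def)
    then have Pk: "P k" unfolding k_def by (rule LeastI)
    have least: "stack d k' (i div 4 ^ (n - k')) < K" if "k' < k" for k'
    proof -
      have "\<not> P k'" using not_less_Least[of k' P] that by (simp add: k_def)
      then show ?thesis using Pk that by (simp add: P_def)
    qed
    have kn: "k \<le> n" "k \<le> N" using Pk less.prems by (auto simp: P_def)
    obtain k0 i0 where s: "(k0, i0) \<in> S" "k0 \<le> k" "\<bar>i div 4 ^ (n - k) div 4 ^ (k - k0) - i0\<bar> \<le> 4"
      using stack_selectionD(4)[OF S kn(2)] Pk unfolding P_def by blast
    have dd: "i div 4 ^ (n - k) div 4 ^ (k - j) = i div 4 ^ (n - j)" if "j \<le> k" for j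
    proof -
      have "(4::int) ^ (n - j) = 4 ^ (n - k) * 4 ^ (k - j)"
        using that kn by (simp flip: power_add)
      then show ?thesis by (simp add: zdiv_zmult2_eq)
    qed
    have "k \<noteq> 0"
      using Pk stack_0_le[of d "i div 4 ^ n"] K by (cases "k = 0") (auto simp: P_def)
    \<comment> \<open>The first stacked ancestor need not be the selected stack itself, only close to it; at its level the ancestor has not yet exceeded \<open>4 K\<close>.\<close>
    have "stack d k0 (i div 4 ^ (n - k0)) \<le> 4 * K"
    proof (cases "k0 < k")
      case True
      then show ?thesis using least[of k0] by simp
    next
      case False
      then have "k0 = k" using s by simp
      obtain k1 where k1: "k = Suc k1" using \<open>k \<noteq> 0\<close> by (cases k) auto
      have "stack d k (i div 4 ^ (n - k)) \<le> 4 * stack d k1 (i div 4 ^ (n - k) div 4)"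
        unfolding k1 by (rule stack_Suc_le[OF d])
      also have "i div 4 ^ (n - k) div 4 = i div 4 ^ (n - k1)" using dd[of k1] k1 by simp
      finally show ?thesis using least[of k1] k1 \<open>k0 = k\<close> by simp
    qed
    then show ?thesis using s kn dd[OF s(2)] by (intro bexI[of _ "(k0, i0)"]) auto
  qed
  then obtain \<phi> where \<phi>: "\<And>i. i \<in> Hi \<Longrightarrow> \<phi> i \<in> S \<and> fst (\<phi> i) \<le> n \<and>
      \<bar>i div 4 ^ (n - fst (\<phi> i)) - snd (\<phi> i)\<bar> \<le> 4 \<and>
      stack d (fst (\<phi> i)) (i div 4 ^ (n - fst (\<phi> i))) \<le> 4 * K"
    by metis
  \<comment> \<open>Sort the stacked cells by the selected stack and by the ancestor at its level, one of nine cells near that stack.\<close>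
  define g where "g = (\<lambda>i. (\<phi> i, i div 4 ^ (n - fst (\<phi> i))))"
  define T where "T = (SIGMA s:{s\<in>S. fst s \<le> n}. {snd s - 4..snd s + 4})"
  have finT: "finite T" using fin by (auto simp: T_def)
  have gT: "g ` Hi \<subseteq> T"
  proof
    fix y assume "y \<in> g ` Hi"
    then obtain i where i: "i \<in> Hi" "y = g i" by blast
    show "y \<in> T" using \<phi>[OF i(1)] unfolding i(2) g_def T_def by (auto simp: abs_le_iff)
  qed
  have "(\<Sum>i\<in>Hi. real (stack d n i) ^ 2) = (\<Sum>y\<in>T. \<Sum>i\<in>{i \<in> Hi. g i = y}. real (stack d n i) ^ 2)"
    by (rule sum.group[symmetric, OF fin(2) finT gT])
  also have "\<dots> \<le> (\<Sum>y\<in>T. 640 * real K ^ 3 * 4 ^ n * (1 / 4 ^ fst (fst y)))"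
  proof (rule sum_mono)
    fix y assume y: "y \<in> T"
    obtain k i0 j where yy: "y = ((k, i0), j)" by (metis prod.exhaust)
    have kn: "k \<le> n" "(k, i0) \<in> S" using y by (auto simp: T_def yy)
    let ?A = "{i \<in> Hi. g i = y}"
    have A: "i div 4 ^ (n - k) = j" "stack d k j \<le> 4 * K" if "i \<in> ?A" for i
      using that \<phi>[of i] by (auto simp: g_def yy)
    show "(\<Sum>i\<in>?A. real (stack d n i) ^ 2) \<le> 640 * real K ^ 3 * 4 ^ n * (1 / 4 ^ fst (fst y))"
    proof (cases "?A = {}")
      case False
      then have jK: "stack d k j \<le> 4 * K" using A(2) by blast
      have "K \<le> stack d k i0" using stack_selectionD(3)[OF S kn(2)] .
      then have "k \<noteq> 0" using K stack_0_le[of d i0] by (cases "k = 0") simp_all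
      then have E: "energy d (n - k) \<le> 10 * real K * 4 ^ (n - k)"
        using less.IH[of "n - k"] less.prems kn by simp
      have "(\<Sum>i\<in>?A. real (stack d (k + (n - k)) i) ^ 2) \<le> 4 * real (stack d k j) ^ 2 * energy d (n - k)"
        by (rule energy_descendants[OF d]) (use fin A in auto)
      also have "\<dots> \<le> 4 * (4 * real K) ^ 2 * (10 * real K * 4 ^ (n - k))"
        using jK E by (intro mult_mono power_mono) (auto simp: energy_def sum_nonneg)
      also have "\<dots> = 640 * real K ^ 3 * 4 ^ n * (1 / 4 ^ k)"
        using kn by (simp add: power2_eq_square power3_eq_cube power_diff)
      finally show ?thesis using kn by (simp add: yy)
    qed (simp only: sum.empty, simp)
  qed
  also have "\<dots> = 640 * real K ^ 3 * 4 ^ n * (\<Sum>s\<in>{s\<in>S. fst s \<le> n}. 9 * (1 / 4 ^ fst s))"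
  proof -
    have "(\<Sum>y\<in>T. 1 / 4 ^ fst (fst y)) =
        (\<Sum>s\<in>{s\<in>S. fst s \<le> n}. \<Sum>j\<in>{snd s - 4..snd s + 4}. 1 / (4::real) ^ fst s)"
      unfolding T_def by (subst sum.Sigma) (use fin in \<open>auto simp: split_beta\<close>)
    also have "\<dots> = (\<Sum>s\<in>{s\<in>S. fst s \<le> n}. 9 * (1 / 4 ^ fst s))" by simp
    finally show ?thesis by (simp only: flip: sum_distrib_left)
  qed
  also have "\<dots> \<le> 640 * real K ^ 3 * 4 ^ n * (\<Sum>s\<in>S. 9 * (1 / 4 ^ fst s))"
    using fin by (intro mult_left_mono sum_mono2) auto
  also have "(\<Sum>s\<in>S. 9 * (1 / 4 ^ fst s)) = 9 * stack_length S"
    unfolding stack_length_def sum_distrib_left by (rule sum.cong) auto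
  also have "640 * real K ^ 3 * 4 ^ n * (9 * stack_length S) =
      5 * real K * 4 ^ n * (1152 * real K ^ 2 * stack_length S)"
    by (simp add: power2_eq_square power3_eq_cube)
  also have "\<dots> \<le> 5 * real K * 4 ^ n * 1" using V by (intro mult_left_mono) auto
  finally show ?case using split low by linarith
qed

text \<open>Up to scaling and translation this contains the projection of the \<open>n\<close>-th
generation; the radius \<open>2 / 4 ^ n\<close> exceeds what the squares need and leaves room for
perturbing the direction and for replacing a curve by its tangent.\<close>

definition shadow :: "(digit \<Rightarrow> real) \<Rightarrow> nat \<Rightarrow> real set" where
  "shadow d n = (\<Union>w\<in>words n. cball (pos d w / 4 ^ n) (2 / 4 ^ n))"

definition shadow_len :: "(digit \<Rightarrow> real) \<Rightarrow> nat \<Rightarrow> real" where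
  "shadow_len d n = measure lebesgue (shadow d n)"

lemma compact_shadow: "compact (shadow d n)"
  unfolding shadow_def by (intro compact_UN) auto

lemma measure_cball_real: "0 \<le> r \<Longrightarrow> measure lebesgue (cball (x::real) r) = 2 * r"
  by (simp add: cball_eq_atLeastAtMost)

lemma shadow_len_0: "shadow_len d 0 = 4"
  using measure_cball_real[of 2 0] by (simp add: shadow_len_def shadow_def)

lemma shadow_Suc:
  assumes d: "\<And>x. \<bar>d x\<bar> \<le> 1"
  shows "shadow d (Suc n) \<subseteq> shadow d n"
proof
  fix x assume "x \<in> shadow d (Suc n)"
  then obtain w where w: "length w = Suc n" "\<bar>pos d w / 4 ^ Suc n - x\<bar> \<le> 2 / 4 ^ Suc n"
    by (auto simp: shadow_def dist_real_def)
  then have e: "w = butlast w @ [last w]" by (cases w rule: rev_cases) auto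
  have "pos d w = 4 * pos d (butlast w) + d (last w)"
    by (subst e, subst pos_append) simp
  moreover have "\<bar>d (last w)\<bar> \<le> 1" by (rule d)
  ultimately have "\<bar>pos d w / 4 ^ Suc n - pos d (butlast w) / 4 ^ n\<bar> \<le> 1 / 4 ^ Suc n"
    by (simp add: add_divide_distrib)
       (simp add: divide_right_mono flip: abs_divide)
  moreover have "1 / 4 ^ Suc n + 2 / 4 ^ Suc n \<le> 2 / (4::real) ^ n" by (simp add: field_simps)
  ultimately have "\<bar>pos d (butlast w) / 4 ^ n - x\<bar> \<le> 2 / 4 ^ n" using w(2) by linarith
  then show "x \<in> shadow d n" using w(1) unfolding shadow_def dist_real_def mem_cball UN_iff
    by (intro bexI[of _ "butlast w"]) (auto simp: dist_real_def)
qed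

lemma shadow_len_mono:
  assumes d: "\<And>x. \<bar>d x\<bar> \<le> 1" and "n \<le> m"
  shows "shadow_len d m \<le> shadow_len d n"
proof -
  have "shadow d m \<subseteq> shadow d n" using \<open>n \<le> m\<close>
    by (rule lift_Suc_antimono_le[rotated]) (rule shadow_Suc[OF d])
  then show ?thesis unfolding shadow_len_def
    by (intro measure_mono_fmeasurable) (auto simp: compact_shadow lmeasurable_compact fmeasurableD)
qed

text \<open>The selected cells are so far apart that no word has prefixes in two of them. Each
selected cell of level \<open>k\<close> thus removes at least \<open>K 4 ^ (N - k)\<close> words
that no other cell removes.\<close>

lemma card_avoiding_le:
  assumes d: "\<And>x. \<bar>d x\<bar> \<le> 1" and S: "stack_selection d N K S"
  shows "real (card {w \<in> words N. \<forall>(k, i)\<in>S. take k w \<notin> cell_words d k i})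
    \<le> 4 ^ N * (1 - real K * stack_length S)"
proof -
  let ?R = "{w \<in> words N. \<forall>(k, i)\<in>S. take k w \<notin> cell_words d k i}"
  define B where "B = (\<lambda>(k, i). {w \<in> words N. take k w \<in> cell_words d k i})"
  have fS: "finite S" and SK: "\<And>k i. (k, i) \<in> S \<Longrightarrow> k \<le> N \<and> K \<le> stack d k i"
    using stack_selectionD[OF S] by blast+
  have finB: "finite (B s)" for s unfolding B_def using finite_words[of N] by (auto split: prod.splits)
  have disj: "B s \<inter> B s' = {}" if "s \<in> S" "s' \<in> S" "s \<noteq> s'" "fst s \<le> fst s'" for s s'
  proof (rule ccontr)
    assume "B s \<inter> B s' \<noteq> {}"
    obtain k i k' i' where s: "s = (k, i)" "s' = (k', i')" by (metis prod.exhaust)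
    with \<open>B s \<inter> B s' \<noteq> {}\<close> obtain w where w: "w \<in> words N" "take k w \<in> cell_words d k i" "take k' w \<in> cell_words d k' i'"
      by (auto simp: B_def)
    have kk: "k \<le> k'" "k' \<le> N" using that SK s by auto
    have e: "take k' w = take k w @ drop k (take k' w)"
      using kk by (metis append_take_drop_id min.absorb1 take_take)
    have "length (drop k (take k' w)) = k' - k" using kk w by simp
    then have "take k w \<in> cell_words d k (i' div 4 ^ (k' - k))"
      using prefix_in_parent_cell[of d "take k w" "drop k (take k' w)" k "k' - k" i'] d w e kk by simp
    then have "\<bar>pos d (take k w) - of_int (i' div 4 ^ (k' - k))\<bar> \<le> 2" "\<bar>pos d (take k w) - of_int i\<bar> \<le> 2"
      using w by (auto simp: cell_words_def)
    then have "\<bar>real_of_int (i' div 4 ^ (k' - k)) - of_int i\<bar> \<le> 4" by linarith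
    then have "real_of_int \<bar>i' div 4 ^ (k' - k) - i\<bar> \<le> real_of_int 4" by simp
    then have "\<bar>i' div 4 ^ (k' - k) - i\<bar> \<le> 4" by (simp only: of_int_le_iff)
    moreover have "4 < \<bar>i' div 4 ^ (k' - k) - i\<bar>"
      using stack_selectionD(5)[OF S] that kk s by blast
    ultimately show False by simp
  qed
  have cardB: "real (card (B s)) \<ge> real K * 4 ^ N * (1 / 4 ^ fst s)" if "s \<in> S" for s
  proof -
    obtain k i where s: "s = (k, i)" by (metis prod.exhaust)
    have k: "k \<le> N" "K \<le> stack d k i" using SK that s by auto
    have "(\<lambda>(u, v). u @ v) ` (cell_words d k i \<times> words (N - k)) \<subseteq> B s"
      using k by (auto simp: B_def s cell_words_def)
    moreover have "inj_on (\<lambda>(u, v). u @ v) (cell_words d k i \<times> words (N - k))"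
      by (auto simp: inj_on_def cell_words_def)
    ultimately have "card (cell_words d k i \<times> words (N - k)) \<le> card (B s)"
      by (metis card_image card_mono finB)
    then have "stack d k i * 4 ^ (N - k) \<le> card (B s)"
      using card_words[of "N - k"] by (simp add: card_cartesian_product stack_def)
    from of_nat_mono[OF this, where 'a=real]
    have "real (stack d k i) * 4 ^ (N - k) \<le> real (card (B s))" by simp
    moreover have "real K * 4 ^ (N - k) \<le> real (stack d k i) * 4 ^ (N - k)" using k by simp
    moreover have "real K * 4 ^ N * (1 / 4 ^ k) = real K * 4 ^ (N - k)"
      using k by (simp add: power_diff)
    ultimately show ?thesis unfolding s fst_conv by linarith
  qed
  have finR: "finite ?R" using finite_words[of N] by simp
  have RB: "?R \<inter> (\<Union>s\<in>S. B s) = {}" by (auto simp: B_def)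
  have "card (\<Union>s\<in>S. B s) = (\<Sum>s\<in>S. card (B s))"
  proof (rule card_UN_disjoint)
    show "\<forall>i\<in>S. \<forall>j\<in>S. i \<noteq> j \<longrightarrow> B i \<inter> B j = {}"
      using disj by (metis Int_commute nat_le_linear)
  qed (use fS finB in auto)
  moreover have "card ?R + card (\<Union>s\<in>S. B s) = card (?R \<union> (\<Union>s\<in>S. B s))"
    using finR RB fS finB by (subst card_Un_disjoint) auto
  moreover have "card (?R \<union> (\<Union>s\<in>S. B s)) \<le> card (words N)"
    by (rule card_mono) (auto simp: B_def)
  ultimately have "card ?R + (\<Sum>s\<in>S. card (B s)) \<le> 4 ^ N" by (simp add: card_words)
  from of_nat_mono[OF this, where 'a=real]
  have "real (card ?R) + (\<Sum>s\<in>S. real (card (B s))) \<le> 4 ^ N" by simp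
  moreover have "(\<Sum>s\<in>S. real K * 4 ^ N * (1 / 4 ^ fst s)) \<le> (\<Sum>s\<in>S. real (card (B s)))"
    by (intro sum_mono cardB)
  moreover have "(\<Sum>s\<in>S. real K * 4 ^ N * (1 / 4 ^ fst s)) = real K * 4 ^ N * stack_length S"
    unfolding stack_length_def sum_distrib_left by (rule sum.cong) auto
  ultimately show ?thesis by (simp add: algebra_simps)
qed

text \<open>A word of length \<open>N + n\<close> either has a prefix in a selected cell, and then
it projects into an interval of length \<open>9 / 4 ^ k\<close> around that cell, or its first
\<open>N\<close> letters form one of the remaining words, below which the picture is a copy of the
\<open>n\<close>-th generation.\<close>

lemma shadow_len_recursion:
  assumes d: "\<And>x. \<bar>d x\<bar> \<le> 1" and S: "stack_selection d N K S"
  shows "shadow_len d (N + n) \<le> 9 * stack_length S + (1 - real K * stack_length S) * shadow_len d n"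
proof -
  define R where "R = {w \<in> words N. \<forall>(k, i)\<in>S. take k w \<notin> cell_words d k i}"
  define C where "C = (\<lambda>s::nat \<times> int. cball (of_int (snd s) / 4 ^ fst s) ((9 / 2) / 4 ^ fst s) :: real set)"
  define T where "T = (\<lambda>r. (\<lambda>y. (1 / 4 ^ N) *\<^sub>R y + pos d r / 4 ^ N) ` shadow d n)"
  have finS: "finite S" by (rule stack_selectionD(1)[OF S])
  have finR: "finite R" unfolding R_def using finite_words[of N] by simp
  have sub: "shadow d (N + n) \<subseteq> (\<Union>s\<in>S. C s) \<union> (\<Union>r\<in>R. T r)"
  proof
    fix x assume "x \<in> shadow d (N + n)"
    then obtain w where w: "length w = N + n" "\<bar>pos d w / 4 ^ (N + n) - x\<bar> \<le> 2 / 4 ^ (N + n)"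
      by (auto simp: shadow_def dist_real_def)
    have split: "pos d w / 4 ^ (N + n) = pos d (take k w) / 4 ^ k + pos d (drop k w) / 4 ^ (N + n)"
      if "k \<le> N + n" for k
    proof -
      have "pos d w = 4 ^ (N + n - k) * pos d (take k w) + pos d (drop k w)"
        using pos_append[of d "take k w" "drop k w"] w(1) by simp
      moreover have "(4::real) ^ (N + n) = 4 ^ (N + n - k) * 4 ^ k"
        using that by (simp flip: power_add)
      ultimately show ?thesis by (simp add: add_divide_distrib)
    qed
    show "x \<in> (\<Union>s\<in>S. C s) \<union> (\<Union>r\<in>R. T r)"
    proof (cases "take N w \<in> R")
      case True
      let ?y = "4 ^ N * x - pos d (take N w)"
      have "\<bar>pos d (drop N w) / 4 ^ n - ?y\<bar> \<le> 2 / 4 ^ n"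
      proof -
        have "pos d (drop N w) / 4 ^ n - ?y = 4 ^ N * (pos d w / 4 ^ (N + n) - x)"
          using split[of N] by (simp add: power_add field_simps)
        then have "\<bar>pos d (drop N w) / 4 ^ n - ?y\<bar> = 4 ^ N * \<bar>pos d w / 4 ^ (N + n) - x\<bar>"
          by (simp only: abs_mult power_abs abs_numeral)
        also have "\<dots> \<le> 4 ^ N * (2 / 4 ^ (N + n))" using w(2) by (intro mult_left_mono) auto
        also have "\<dots> = 2 / 4 ^ n" by (simp add: power_add)
        finally show ?thesis .
      qed
      then have "?y \<in> shadow d n"
        unfolding shadow_def using w(1) by (intro UN_I[of "drop N w"]) (auto simp: dist_real_def)
      moreover have "x = (1 / 4 ^ N) *\<^sub>R ?y + pos d (take N w) / 4 ^ N"
        by (simp add: field_simps)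
      ultimately have "x \<in> T (take N w)" unfolding T_def by blast
      then show ?thesis using True by blast
    next
      case False
      have "take N w \<in> words N" using w(1) by simp
      with False obtain k i where ki: "(k, i) \<in> S" "take k (take N w) \<in> cell_words d k i"
        unfolding R_def by blast
      have k: "k \<le> N" using stack_selectionD(2)[OF S ki(1)] .
      have a: "\<bar>pos d (take k w) - of_int i\<bar> \<le> 2" using ki(2) k by (simp add: cell_words_def min_def)
      have b: "\<bar>pos d (drop k w)\<bar> \<le> 4 ^ (N + n - k) / 3 - 1 / 3"
        using abs_pos_le[of d "drop k w", OF d] w(1) by simp
      have pk: "(4::real) ^ (N + n) = 4 ^ (N + n - k) * 4 ^ k"
        using k by (simp flip: power_add)
      have "\<bar>pos d (drop k w) / 4 ^ (N + n)\<bar> \<le> (4 ^ (N + n - k) / 3) / 4 ^ (N + n)"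
        unfolding abs_divide power_abs abs_numeral using b by (intro divide_right_mono) auto
      also have "\<dots> = (1 / 3) / 4 ^ k" unfolding pk by simp
      finally have b': "\<bar>pos d (drop k w) / 4 ^ (N + n)\<bar> \<le> (1 / 3) / 4 ^ k" .
      have a': "\<bar>pos d (take k w) / 4 ^ k - of_int i / 4 ^ k\<bar> \<le> 2 / 4 ^ k"
        using divide_right_mono[OF a, of "4 ^ k"] by (simp add: diff_divide_distrib abs_divide flip: diff_divide_distrib)
      have c': "2 / 4 ^ (N + n) \<le> 2 / (4::real) ^ k" using k by (intro divide_left_mono power_increasing) auto
      have "\<bar>of_int i / 4 ^ k - x\<bar> \<le> 2 / 4 ^ k + (1 / 3) / 4 ^ k + 2 / 4 ^ k"
        using a' b' c' w(2) split[of k] k by linarith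
      also have "\<dots> = (13 / 3) / 4 ^ k" by simp
      also have "\<dots> \<le> (9 / 2) / 4 ^ k" by (rule divide_right_mono) auto
      finally have "x \<in> C (k, i)" by (simp add: C_def dist_real_def)
      then show ?thesis using ki(1) by blast
    qed
  qed
  have Tc: "compact (T r)" for r
    unfolding T_def by (intro compact_continuous_image continuous_intros compact_shadow)
  have Tm: "measure lebesgue (T r) = 1 / 4 ^ N * shadow_len d n" for r
    unfolding T_def using measure_lebesgue_affine[of "1 / 4 ^ N" "pos d r / 4 ^ N" "shadow d n"]
    by (simp add: shadow_len_def)
  have Cm: "measure lebesgue (C s) = 9 * (1 / 4 ^ fst s)" for s
    unfolding C_def by (subst measure_cball_real) auto
  have lm: "(\<Union>s\<in>S. C s) \<in> lmeasurable" "(\<Union>r\<in>R. T r) \<in> lmeasurable"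
    using finS finR Tc by (auto intro!: lmeasurable_compact compact_UN simp: C_def)
  have "shadow_len d (N + n) \<le> measure lebesgue ((\<Union>s\<in>S. C s) \<union> (\<Union>r\<in>R. T r))"
    unfolding shadow_len_def using sub lm
    by (intro measure_mono_fmeasurable) (auto simp: compact_shadow lmeasurable_compact fmeasurableD)
  also have "\<dots> \<le> measure lebesgue (\<Union>s\<in>S. C s) + measure lebesgue (\<Union>r\<in>R. T r)"
    using lm by (intro measure_Un_le) (auto simp: fmeasurableD)
  also have "measure lebesgue (\<Union>s\<in>S. C s) \<le> (\<Sum>s\<in>S. measure lebesgue (C s))"
    using finS by (intro measure_UNION_le) (auto simp: C_def)
  also have "(\<Sum>s\<in>S. measure lebesgue (C s)) = 9 * stack_length S"
    unfolding Cm stack_length_def sum_distrib_left by (rule sum.cong) auto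
  also have "measure lebesgue (\<Union>r\<in>R. T r) \<le> (\<Sum>r\<in>R. measure lebesgue (T r))"
    using finR Tc by (intro measure_UNION_le) (auto intro!: fmeasurableD lmeasurable_compact)
  also have "(\<Sum>r\<in>R. measure lebesgue (T r)) = real (card R) * (1 / 4 ^ N * shadow_len d n)"
    by (simp add: Tm)
  also have "\<dots> \<le> 4 ^ N * (1 - real K * stack_length S) * (1 / 4 ^ N * shadow_len d n)"
    using card_avoiding_le[OF d S] unfolding R_def
    by (intro mult_right_mono) (auto simp: shadow_len_def)
  also have "\<dots> = (1 - real K * stack_length S) * shadow_len d n" by simp
  finally show ?thesis by simp
qed

lemma stack_weight_le_1:
  assumes d: "\<And>x. \<bar>d x\<bar> \<le> 1" and S: "stack_selection d N K S"
  shows "real K * stack_length S \<le> 1"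
proof -
  have "4 ^ N * 0 \<le> 4 ^ N * (1 - real K * stack_length S)" using card_avoiding_le[OF d S] by linarith
  then have "0 \<le> 1 - real K * stack_length S" by (rule mult_left_le_imp_le) simp
  then show ?thesis by simp
qed

lemma shadow_len_iterate:
  assumes d: "\<And>x. \<bar>d x\<bar> \<le> 1" and S: "stack_selection d N K S" and K: "1 \<le> K"
  shows "shadow_len d (j * N) \<le> 9 / real K + 4 * (1 - real K * stack_length S) ^ j"
proof (induction j)
  case 0
  then show ?case using K by (simp add: shadow_len_0)
next
  case (Suc j)
  let ?V = "stack_length S" and ?q = "1 - real K * stack_length S"
  have q: "0 \<le> ?q" using stack_weight_le_1[OF d S] by simp
  have "shadow_len d (Suc j * N) \<le> 9 * ?V + ?q * shadow_len d (j * N)"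
    using shadow_len_recursion[OF d S, of "j * N"] by simp
  also have "\<dots> \<le> 9 * ?V + ?q * (9 / real K + 4 * ?q ^ j)"
    using Suc q by (intro add_left_mono mult_left_mono)
  also have "\<dots> = 9 / real K + 4 * ?q ^ Suc j" using K by (simp add: field_simps)
  finally show ?case .
qed

text \<open>If the selected stacks are longer than about \<open>1 / K\<^sup>2\<close>, with \<open>K
= 4 ^ i\<close>, then each round of \<open>shadow_len_recursion\<close> removes a proportion of
order \<open>1 / K\<close> of the mass, so that of order \<open>i K\<close> rounds reduce it to
\<open>1 / K\<close>.\<close>

lemma shadow_len_small_or_energy_small:
  assumes d: "\<And>x. \<bar>d x\<bar> \<le> 1" and i: "1 \<le> i" and M: "2304 * i * 4 ^ i * N \<le> M"
  shows "shadow_len d M \<le> 13 / 4 ^ i \<or> (\<forall>n\<le>N. energy d n \<le> 10 * 4 ^ i * 4 ^ n)"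
proof (rule disjCI)
  define K :: nat where "K = 4 ^ i"
  have "(4::nat) ^ 1 \<le> 4 ^ i" using i by (intro power_increasing) auto
  then have K: "2 \<le> K" by (simp add: K_def)
  obtain S where S: "stack_selection d N K S"
    using stack_selection_exists[where d=d and K=K and N=N, OF d] K by auto
  assume "\<not> (\<forall>n\<le>N. energy d n \<le> 10 * 4 ^ i * 4 ^ n)"
  then obtain n where n: "n \<le> N" "\<not> energy d n \<le> 10 * real K * 4 ^ n" by (auto simp: K_def)
  have V: "1 < 1152 * real K ^ 2 * stack_length S"
    using energy_le_of_small_stacks[OF d K S _ n(1)] n(2) by linarith
  let ?q = "1 - real K * stack_length S"
  \<comment> \<open>The selected stacks are longer than \<open>1 / (1152 K\<^sup>2)\<close>, so a number \<open>1152 K\<close> of rounds gains a factor \<open>exp (- 1)\<close>; twice as many gain a factor above 4.\<close>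
  define j where "j = 2304 * i * 4 ^ i"
  have q: "0 \<le> ?q" using stack_weight_le_1[OF d S] by simp
  have "real K * 1 < real K * (1152 * real K * (real K * stack_length S))"
    using V K by (intro mult_strict_left_mono) (auto simp: power2_eq_square algebra_simps)
  then have "1 / (1152 * real K) \<le> real K * stack_length S"
    using K by (simp add: field_simps)
  then have "?q \<le> 1 + - (1 / (1152 * real K))" by simp
  also have "\<dots> \<le> exp (- (1 / (1152 * real K)))" by (rule exp_ge_add_one_self)
  finally have "?q ^ j \<le> exp (- (1 / (1152 * real K))) ^ j" using q by (intro power_mono)
  also have "\<dots> = exp (- 2) ^ i"
  proof -
    have "real j * - (1 / (1152 * real K)) = real i * (- 2)"
      using K by (simp add: j_def K_def)
    then show ?thesis by (simp only: exp_of_nat_mult[symmetric])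
  qed
  also have "\<dots> \<le> (1 / 4) ^ i"
  proof (rule power_mono)
    have "(2::real) \<le> exp 1" using exp_ge_add_one_self[of 1] by simp
    then have "(4::real) \<le> exp 1 * exp 1" using mult_mono[of 2 "exp 1" 2 "exp (1::real)"] by simp
    then have "(4::real) \<le> exp 2" by (simp flip: exp_add)
    then show "exp (- 2) \<le> 1 / (4::real)" by (simp add: exp_minus field_simps)
  qed auto
  finally have "?q ^ j \<le> 1 / 4 ^ i" by (simp add: power_divide)
  moreover have "shadow_len d (j * N) \<le> 9 / real K + 4 * ?q ^ j"
    using shadow_len_iterate[OF d S, of j] K by simp
  moreover have "shadow_len d M \<le> shadow_len d (j * N)"
    using M by (intro shadow_len_mono d) (simp add: j_def)
  ultimately show "shadow_len d M \<le> 13 / 4 ^ i" by (simp add: K_def)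
qed

section \<open>Fourier transform of the corner distribution\<close>

text \<open>The square of this product is \<open>2 ^ - n\<close> times the Riesz product
\<open>\<Prod>k<n. 1 + cos (2 * 4 ^ k * z)\<close>.\<close>

definition riesz :: "nat \<Rightarrow> real \<Rightarrow> real" where
  "riesz n z = (\<Prod>k<n. cos (4 ^ k * z))"

text \<open>The value of \<open>y - t x\<close> at a corner of the square \<open>[-1,
1]\<^sup>2\<close>. The factor \<open>1 / 3\<close> makes it at most 1 in absolute value for slopes
\<open>\<bar>t\<bar> \<le> 2\<close>.\<close>

definition corner :: "real \<Rightarrow> digit \<Rightarrow> real" where
  "corner t x = ((if snd x then 1 else - 1) - t * (if fst x then 1 else - 1)) / 3"

text \<open>The Fourier transform of the uniform distribution on the points \<open>pos (corner t)
w\<close> with \<open>length w = n\<close>, see \<open>sum_words_cos\<close>. It is a product of two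
Riesz-type products, one in \<open>y\<close> and one in \<open>t y\<close>, because the four corners
form a product set.\<close>

definition transform :: "nat \<Rightarrow> real \<Rightarrow> real \<Rightarrow> real" where
  "transform n t y = riesz n (y / 3) * riesz n (t * y / 3)"

lemma abs_corner_le: "\<bar>t\<bar> \<le> 2 \<Longrightarrow> \<bar>corner t x\<bar> \<le> 1"
  unfolding corner_def by (auto simp: abs_le_iff)

lemma sum_words_Suc:
  "(\<Sum>w\<in>words (Suc n). f w) = (\<Sum>w\<in>words n. \<Sum>x\<in>UNIV. f (x # w))"
proof -
  have e: "words (Suc n) = (\<lambda>(w, x). x # w) ` (words n \<times> UNIV)"
    by (auto simp: length_Suc_conv)
  have "inj_on (\<lambda>(w, x). x # w) (words n \<times> UNIV)" by (auto simp: inj_on_def)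
  then have "(\<Sum>w\<in>words (Suc n). f w) = (\<Sum>(w, x)\<in>words n \<times> UNIV. f (x # w))"
    unfolding e by (subst sum.reindex) (auto simp: split_beta)
  then show ?thesis by (simp add: sum.cartesian_product)
qed

lemma sum_corner_cos:
  "(\<Sum>x\<in>UNIV. cos (a * corner t x + \<phi>)) = 4 * cos (a / 3) * cos (t * a / 3) * cos \<phi>"
proof -
  have U: "(UNIV :: digit set) = {(True, True), (True, False), (False, True), (False, False)}"
    by auto
  define u v where "u = a / 3" and "v = t * a / 3"
  have c: "a * corner t (True, True) = u - v" "a * corner t (True, False) = - u - v"
    "a * corner t (False, True) = u + v" "a * corner t (False, False) = - u + v"
    by (auto simp: corner_def u_def v_def field_simps)
  have "(\<Sum>x\<in>UNIV. cos (a * corner t x + \<phi>)) =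
      cos (u - v + \<phi>) + cos (- u - v + \<phi>) + cos (u + v + \<phi>) + cos (- u + v + \<phi>)"
    unfolding U by (simp add: c)
  also have "\<dots> = 4 * cos u * cos v * cos \<phi>"
    unfolding cos_add sin_add cos_diff sin_diff by (simp add: algebra_simps)
  finally show ?thesis by (simp add: u_def v_def)
qed

text \<open>The phase \<open>\<phi>\<close> replaces complex exponentials: the distribution is
symmetric, so its transform is real, and the phase is what the induction and
\<open>transform_square\<close> need.\<close>

lemma sum_words_cos:
  "(\<Sum>w\<in>words n. cos (pos (corner t) w * y + \<phi>)) = 4 ^ n * transform n t y * cos \<phi>"
proof (induction n arbitrary: \<phi>)
  case 0
  have "words 0 = {[] :: digit list}" by auto
  then show ?case by (simp add: transform_def riesz_def)
next
  case (Suc n)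
  have "(\<Sum>w\<in>words (Suc n). cos (pos (corner t) w * y + \<phi>)) =
      (\<Sum>w\<in>words n. \<Sum>x\<in>UNIV. cos ((4 ^ n * y) * corner t x + (pos (corner t) w * y + \<phi>)))"
    unfolding sum_words_Suc by (intro sum.cong refl) (auto simp: algebra_simps)
  also have "\<dots> = 4 * cos (4 ^ n * y / 3) * cos (t * (4 ^ n * y) / 3) *
      (\<Sum>w\<in>words n. cos (pos (corner t) w * y + \<phi>))"
    unfolding sum_corner_cos sum_distrib_left ..
  also have "\<dots> = 4 ^ Suc n * transform (Suc n) t y * cos \<phi>"
    unfolding Suc.IH transform_def riesz_def by (simp add: mult_ac)
  finally show ?case .
qed

lemma transform_square:
  "transform n t y ^ 2 =
    (1 / 16 ^ n) * (\<Sum>w\<in>words n. \<Sum>w'\<in>words n. cos ((pos (corner t) w - pos (corner t) w') * y))"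
proof -
  have "(\<Sum>w'\<in>words n. \<Sum>w\<in>words n. cos ((pos (corner t) w - pos (corner t) w') * y)) =
     (\<Sum>w'\<in>words n. \<Sum>w\<in>words n. cos (pos (corner t) w * y + - (pos (corner t) w' * y)))"
    by (simp add: algebra_simps)
  also have "\<dots> = 4 ^ n * transform n t y * (\<Sum>w'\<in>words n. cos (pos (corner t) w' * y))"
    unfolding sum_words_cos sum_distrib_left by simp
  also have "\<dots> = 16 ^ n * transform n t y ^ 2"
    using sum_words_cos[of t y 0 n] by (simp add: power2_eq_square flip: power_mult_distrib)
  finally have e: "(\<Sum>w'\<in>words n. \<Sum>w\<in>words n. cos ((pos (corner t) w - pos (corner t) w') * y)) =
    16 ^ n * transform n t y ^ 2" .
  show ?thesis by (subst sum.swap) (simp add: e)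
qed

text \<open>The integral of the Fejer weight \<open>1 - y / Y\<close> against \<open>cos (s
y)\<close> over \<open>[0, Y]\<close>. It is nonnegative and decays quadratically in
\<open>s\<close>, so it serves for bounds in both directions.\<close>

definition fejer :: "real \<Rightarrow> real \<Rightarrow> real" where
  "fejer Y s = (if s = 0 then Y / 2 else (1 - cos (s * Y)) / (s\<^sup>2 * Y))"

lemma fejer_integral:
  assumes "0 < Y"
  shows "((\<lambda>y. (1 - y / Y) * cos (s * y)) has_integral fejer Y s) {0..Y}"
proof (cases "s = 0")
  case True
  have "((\<lambda>y. 1 - y / Y) has_integral (Y - Y\<^sup>2 / (2 * Y)) - (0 - 0\<^sup>2 / (2 * Y))) {0..Y}"
    using assms by (intro fundamental_theorem_of_calculus)
      (auto intro!: derivative_eq_intros simp: has_real_derivative_iff_has_vector_derivative[symmetric] field_simps)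
  then show ?thesis using True assms by (simp add: fejer_def power2_eq_square)
next
  case False
  let ?F = "\<lambda>y. (1 - y / Y) * sin (s * y) / s - cos (s * y) / (s\<^sup>2 * Y)"
  have "((\<lambda>y. (1 - y / Y) * cos (s * y)) has_integral ?F Y - ?F 0) {0..Y}"
    using assms False by (intro fundamental_theorem_of_calculus)
      (auto intro!: derivative_eq_intros simp: has_real_derivative_iff_has_vector_derivative[symmetric] field_simps power2_eq_square)
  then show ?thesis using False assms by (simp add: fejer_def diff_divide_distrib)
qed

lemma fejer_nonneg: "0 < Y \<Longrightarrow> 0 \<le> fejer Y s"
  by (simp add: fejer_def)

lemma transform_fejer_integral:
  assumes "0 < Y"
  shows "((\<lambda>y. (1 - y / Y) * transform n t y ^ 2) has_integral
    (1 / 16 ^ n) * (\<Sum>w\<in>words n. \<Sum>w'\<in>words n. fejer Y (pos (corner t) w - pos (corner t) w'))) {0..Y}"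
proof -
  have e: "(1 - y / Y) * transform n t y ^ 2 = (1 / 16 ^ n) *
     (\<Sum>w\<in>words n. \<Sum>w'\<in>words n. (1 - y / Y) * cos ((pos (corner t) w - pos (corner t) w') * y))" for y
    unfolding transform_square by (simp add: sum_distrib_left mult_ac)
  show ?thesis unfolding e
    by (intro has_integral_mult_right has_integral_sum finite_words fejer_integral assms)
qed

lemma continuous_on_riesz:
  fixes f :: "'a::t2_space \<Rightarrow> real"
  shows "continuous_on A f \<Longrightarrow> continuous_on A (\<lambda>x. riesz n (f x))"
  unfolding riesz_def by (intro continuous_intros)

lemma continuous_on_transform: "continuous_on A (transform n t)"
  unfolding transform_def by (intro continuous_intros continuous_on_riesz) auto

text \<open>All terms of the double sum in \<open>transform_fejer_integral\<close> are nonnegative,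
and the diagonal alone gives the bound.\<close>

lemma transform_lower:
  assumes "0 < Y"
  shows "Y / (2 * 4 ^ n) \<le> integral {0..Y} (\<lambda>y. transform n t y ^ 2)"
proof -
  let ?s = "\<lambda>w. pos (corner t) w"
  have "4 ^ n * (Y / 2) = (\<Sum>w\<in>words n. Y / 2)" using card_words[of n] by simp
  also have "\<dots> \<le> (\<Sum>w\<in>words n. \<Sum>w'\<in>words n. fejer Y (?s w - ?s w'))"
  proof (rule sum_mono)
    fix w :: "digit list" assume "w \<in> words n"
    then have "fejer Y (?s w - ?s w) \<le> (\<Sum>w'\<in>words n. fejer Y (?s w - ?s w'))"
      by (intro member_le_sum fejer_nonneg assms finite_words)
    then show "Y / 2 \<le> (\<Sum>w'\<in>words n. fejer Y (?s w - ?s w'))" by (simp add: fejer_def)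
  qed
  finally have "(1 / 16 ^ n) * (4 ^ n * (Y / 2)) \<le>
      (1 / 16 ^ n) * (\<Sum>w\<in>words n. \<Sum>w'\<in>words n. fejer Y (?s w - ?s w'))"
    by (intro mult_left_mono) auto
  moreover have "(16::real) ^ n = 4 ^ n * 4 ^ n" by (simp flip: power_mult_distrib)
  ultimately have "Y / (2 * 4 ^ n) \<le> integral {0..Y} (\<lambda>y. (1 - y / Y) * transform n t y ^ 2)"
    using integral_unique[OF transform_fejer_integral[OF assms]] by simp
  also have "\<dots> \<le> integral {0..Y} (\<lambda>y. transform n t y ^ 2)"
  proof (rule integral_le)
    show "(\<lambda>y. (1 - y / Y) * transform n t y ^ 2) integrable_on {0..Y}"
      using transform_fejer_integral[OF assms] by blast
    show "(\<lambda>y. transform n t y ^ 2) integrable_on {0..Y}"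
      by (intro integrable_continuous_real continuous_intros continuous_on_transform)
    show "(1 - y / Y) * transform n t y ^ 2 \<le> transform n t y ^ 2" if "y \<in> {0..Y}" for y
      using that assms by (intro mult_left_le_one_le) auto
  qed
  finally show ?thesis .
qed

text \<open>A summable majorant of \<open>fejer 2\<close> in terms of the integer parts of the two
points.\<close>

definition tail_weight :: "int \<Rightarrow> real" where
  "tail_weight e = (if e = 0 then 1 else 4 / (of_int e)\<^sup>2)"

lemma tail_weight_nonneg: "0 \<le> tail_weight e" by (simp add: tail_weight_def)

text \<open>The subtracted term makes the bound inductive, by \<open>1 / (x + 1)\<^sup>2 \<le> 1 / x
- 1 / (x + 1)\<close>.\<close>

lemma sum_tail_weight_symmetric:
  "(\<Sum>e\<in>{- int (Suc M)..int (Suc M)}. tail_weight e) \<le> 17 - 8 / real (Suc M)"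
proof (induction M)
  case 0
  have "{- int (Suc 0)..int (Suc 0)} = {-1, 0, 1}" by auto
  then show ?case by (simp add: tail_weight_def)
next
  case (Suc M)
  have "{- int (Suc (Suc M))..int (Suc (Suc M))} =
      insert (int (Suc (Suc M))) (insert (- int (Suc (Suc M))) {- int (Suc M)..int (Suc M)})"
    by auto
  then have "(\<Sum>e\<in>{- int (Suc (Suc M))..int (Suc (Suc M))}. tail_weight e) =
     (\<Sum>e\<in>{- int (Suc M)..int (Suc M)}. tail_weight e) + 8 / (real (Suc (Suc M)))\<^sup>2"
    using power2_minus[of "2 + real M"] by (simp add: tail_weight_def)
  also have "\<dots> \<le> 17 - 8 / real (Suc M) + 8 / (real (Suc (Suc M)))\<^sup>2"
    using Suc by simp
  also have "\<dots> \<le> 17 - 8 / real (Suc (Suc M))"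
  proof -
    define x where "x = real (Suc M)"
    have x: "0 < x" "real (Suc (Suc M)) = x + 1" by (auto simp: x_def)
    have "8 / (x + 1)\<^sup>2 \<le> 8 / (x * (x + 1))"
      using x(1) by (intro divide_left_mono) (auto simp: power2_eq_square)
    also have "\<dots> = 8 / x - 8 / (x + 1)" using x(1) by (simp add: field_simps)
    finally show ?thesis unfolding x(2) x_def[symmetric] by linarith
  qed
  finally show ?case .
qed

lemma sum_tail_weight_le:
  assumes "finite A"
  shows "(\<Sum>e\<in>A. tail_weight e) \<le> 17"
proof -
  define M where "M = (\<Sum>e\<in>A. nat \<bar>e\<bar>)"
  have "A \<subseteq> {- int (Suc M)..int (Suc M)}"
  proof
    fix e assume "e \<in> A"
    then have "nat \<bar>e\<bar> \<le> M" unfolding M_def using assms by (intro member_le_sum) auto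
    then show "e \<in> {- int (Suc M)..int (Suc M)}" by auto
  qed
  then have "(\<Sum>e\<in>A. tail_weight e) \<le> (\<Sum>e\<in>{- int (Suc M)..int (Suc M)}. tail_weight e)"
    by (intro sum_mono2 tail_weight_nonneg) auto
  also have "\<dots> \<le> 17 - 8 / real (Suc M)" by (rule sum_tail_weight_symmetric)
  also have "\<dots> \<le> 17" by simp
  finally show ?thesis .
qed

lemma fejer_2_le: "fejer 2 (x - x') \<le> tail_weight (\<lfloor>x'\<rfloor> - \<lfloor>x\<rfloor>)"
proof -
  define s where "s = x - x'"
  define e where "e = \<lfloor>x'\<rfloor> - \<lfloor>x\<rfloor>"
  have se: "\<bar>real_of_int e\<bar> \<le> \<bar>s\<bar> + 1"
    unfolding e_def s_def of_int_diff by linarith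
  have sin: "fejer 2 s = (sin s / s)\<^sup>2" if "s \<noteq> 0"
    using that cos_double_sin[of s] by (simp add: fejer_def power_divide mult.commute)
  have le1: "fejer 2 s \<le> 1"
  proof (cases "s = 0")
    case False
    have "\<bar>sin s / s\<bar> \<le> 1" using abs_sin_x_le_abs_x[of s] False by (simp add: divide_le_eq_1 abs_divide)
    then have "(sin s / s)\<^sup>2 \<le> 1" by (simp add: abs_square_le_1)
    then show ?thesis using sin[OF False] by simp
  qed (simp add: fejer_def)
  have "fejer 2 s \<le> tail_weight e"
  proof (cases "\<bar>e\<bar> \<le> 1")
    case True
    then have "e = 0 \<or> e = 1 \<or> e = -1" by auto
    then show ?thesis using le1 by (auto simp: tail_weight_def)
  next
    case False
    then have e2: "2 \<le> \<bar>real_of_int e\<bar>" by linarith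
    then have se2: "\<bar>real_of_int e\<bar> / 2 \<le> \<bar>s\<bar>" and s0: "s \<noteq> 0" using se by auto
    have "fejer 2 s = (sin s)\<^sup>2 / s\<^sup>2" using sin[OF s0] by (simp add: power_divide)
    also have "\<dots> \<le> 1 / s\<^sup>2" by (intro divide_right_mono) (auto simp: abs_square_le_1)
    also have "\<dots> \<le> 1 / (\<bar>real_of_int e\<bar> / 2)\<^sup>2"
    proof (intro divide_left_mono)
      show "(\<bar>real_of_int e\<bar> / 2)\<^sup>2 \<le> s\<^sup>2" using power_mono[OF se2, of 2] by simp
    qed (use s0 e2 in auto)
    also have "\<dots> = tail_weight e" using e2 by (auto simp: tail_weight_def power_divide)
    finally show ?thesis .
  qed
  then show ?thesis by (simp add: s_def e_def)
qed

text \<open>Group the words by integer part; then this is the Schur test for the convolution with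
\<open>tail_weight\<close>, whose total mass is at most 17.\<close>

lemma sum_pairs_le_energy:
  assumes d: "\<And>x. \<bar>d x\<bar> \<le> 1"
  shows "(\<Sum>w\<in>words n. \<Sum>w'\<in>words n. tail_weight (\<lfloor>pos d w'\<rfloor> - \<lfloor>pos d w\<rfloor>)) \<le> 17 * energy d n"
proof -
  define c where "c = (\<lambda>w. \<lfloor>pos d w\<rfloor>)"
  define R where "R = c ` words n"
  define g where "g = (\<lambda>i. real (card {w \<in> words n. c w = i}))"
  have finR: "finite R" by (simp add: R_def)
  have grp: "(\<Sum>w\<in>words n. h (c w)) = (\<Sum>i\<in>R. g i * h i)" for h :: "int \<Rightarrow> real"
  proof -
    have "(\<Sum>w\<in>words n. h (c w)) = (\<Sum>i\<in>R. \<Sum>w\<in>{w \<in> words n. c w = i}. h (c w))"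
      unfolding R_def by (rule sum.image_gen) simp
    also have "\<dots> = (\<Sum>i\<in>R. g i * h i)" by (intro sum.cong refl) (simp add: g_def)
    finally show ?thesis .
  qed
  have "(\<Sum>w\<in>words n. \<Sum>w'\<in>words n. tail_weight (c w' - c w)) =
      (\<Sum>i\<in>R. g i * (\<Sum>j\<in>R. g j * tail_weight (j - i)))"
    by (subst grp[of "\<lambda>j. tail_weight (j - c _)"]) (rule grp)
  also have "\<dots> = (\<Sum>i\<in>R. \<Sum>j\<in>R. g i * g j * tail_weight (j - i))"
    by (simp add: sum_distrib_left mult_ac)
  also have "\<dots> \<le> (\<Sum>i\<in>R. \<Sum>j\<in>R. (g i ^ 2 / 2) * tail_weight (j - i) + (g j ^ 2 / 2) * tail_weight (j - i))"
  proof (intro sum_mono)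
    fix i j
    have "g i * g j \<le> g i ^ 2 / 2 + g j ^ 2 / 2" using sum_squares_bound[of "g i" "g j"] by simp
    from mult_right_mono[OF this tail_weight_nonneg[of "j - i"]]
    show "g i * g j * tail_weight (j - i) \<le> (g i ^ 2 / 2) * tail_weight (j - i) + (g j ^ 2 / 2) * tail_weight (j - i)"
      by (simp only: distrib_right)
  qed
  also have "\<dots> = (\<Sum>i\<in>R. g i ^ 2 / 2 * (\<Sum>j\<in>R. tail_weight (j - i))) +
      (\<Sum>j\<in>R. g j ^ 2 / 2 * (\<Sum>i\<in>R. tail_weight (j - i)))"
  proof -
    have "(\<Sum>i\<in>R. \<Sum>j\<in>R. g j ^ 2 / 2 * tail_weight (j - i)) = (\<Sum>j\<in>R. \<Sum>i\<in>R. g j ^ 2 / 2 * tail_weight (j - i))"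
      by (rule sum.swap)
    then show ?thesis by (simp only: sum.distrib sum_distrib_left)
  qed
  also have "\<dots> \<le> (\<Sum>i\<in>R. g i ^ 2 / 2 * 17) + (\<Sum>j\<in>R. g j ^ 2 / 2 * 17)"
  proof (intro add_mono sum_mono mult_left_mono)
    fix i
    have "(\<Sum>j\<in>R. tail_weight (j - i)) = (\<Sum>e\<in>(\<lambda>j. j - i) ` R. tail_weight e)"
      by (subst sum.reindex) (auto simp: inj_on_def)
    also have "\<dots> \<le> 17" using finR by (intro sum_tail_weight_le) auto
    finally show "(\<Sum>j\<in>R. tail_weight (j - i)) \<le> 17" .
  next
    fix j
    have "(\<Sum>i\<in>R. tail_weight (j - i)) = (\<Sum>e\<in>(\<lambda>i. j - i) ` R. tail_weight e)"
      by (subst sum.reindex) (auto simp: inj_on_def)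
    also have "\<dots> \<le> 17" using finR by (intro sum_tail_weight_le) auto
    finally show "(\<Sum>i\<in>R. tail_weight (j - i)) \<le> 17" .
  qed auto
  also have "\<dots> = 17 * (\<Sum>i\<in>R. g i ^ 2)" by (simp add: sum_distrib_left)
  also have "(\<Sum>i\<in>R. g i ^ 2) \<le> (\<Sum>i\<in>R. real (stack d n i) ^ 2)"
  proof (intro sum_mono power_mono)
    fix i
    have "{w \<in> words n. c w = i} \<subseteq> cell_words d n i"
    proof
      fix w assume w: "w \<in> {w \<in> words n. c w = i}"
      then have "\<lfloor>pos d w\<rfloor> = i" by (simp add: c_def)
      then have "\<bar>pos d w - of_int i\<bar> \<le> 2" by linarith
      then show "w \<in> cell_words d n i" using w by (simp add: cell_words_def)
    qed
    then show "g i \<le> real (stack d n i)" unfolding g_def stack_def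
      by (intro of_nat_mono card_mono) auto
  qed (simp add: g_def)
  also have "\<dots> \<le> energy d n" by (intro sum_stack_sq_le_energy d finR)
  finally show ?thesis by (simp add: c_def)
qed

lemma transform_upper:
  assumes t: "\<bar>t\<bar> \<le> 2"
  shows "integral {0..1} (\<lambda>y. transform n t y ^ 2) \<le> 34 / 16 ^ n * energy (corner t) n"
proof -
  let ?s = "\<lambda>w. pos (corner t) w" and ?f = "\<lambda>y. (1 - y / 2) * transform n t y ^ 2"
  have i2: "?f integrable_on {0..2}" using transform_fejer_integral[of 2 n t] by auto
  have i1: "?f integrable_on {0..1}" by (rule integrable_subinterval_real[OF i2]) auto
  have "integral {0..1} (\<lambda>y. transform n t y ^ 2) \<le> integral {0..1} (\<lambda>y. 2 * ?f y)"
  proof (rule integral_le)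
    show "(\<lambda>y. transform n t y ^ 2) integrable_on {0..1}"
      by (intro integrable_continuous_real continuous_intros continuous_on_transform)
    show "transform n t y ^ 2 \<le> 2 * ?f y" if "y \<in> {0..1}" for y
    proof -
      have "1 * transform n t y ^ 2 \<le> (2 * (1 - y / 2)) * transform n t y ^ 2"
        using that by (intro mult_right_mono) auto
      then show ?thesis by (simp only: mult_1_left mult.assoc)
    qed
  qed (use i1 in auto)
  also have "\<dots> = 2 * integral {0..1} ?f" by simp
  also have "integral {0..1} ?f \<le> integral {0..2} ?f"
    using i1 i2 by (intro integral_subset_le) auto
  also have "integral {0..2} ?f = (1 / 16 ^ n) * (\<Sum>w\<in>words n. \<Sum>w'\<in>words n. fejer 2 (?s w - ?s w'))"
    by (rule integral_unique[OF transform_fejer_integral]) simp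
  also have "\<dots> \<le> (1 / 16 ^ n) * (\<Sum>w\<in>words n. \<Sum>w'\<in>words n. tail_weight (\<lfloor>?s w'\<rfloor> - \<lfloor>?s w\<rfloor>))"
    by (intro mult_left_mono sum_mono fejer_2_le) auto
  also have "\<dots> \<le> (1 / 16 ^ n) * (17 * energy (corner t) n)"
    by (intro mult_left_mono sum_pairs_le_energy abs_corner_le t) auto
  finally show ?thesis by simp
qed

section \<open>Riesz products\<close>

lemma riesz_0 [simp]: "riesz 0 z = 1" by (simp add: riesz_def)

lemma riesz_add: "riesz (m + n) z = riesz m z * riesz n (4 ^ m * z)"
  by (induction n) (auto simp: riesz_def power_add mult_ac)

lemma riesz_Suc: "riesz (Suc n) z = cos z * riesz n (4 * z)"
  using riesz_add[of 1 n z] by (simp add: riesz_def)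

lemma abs_riesz_le_1: "\<bar>riesz n z\<bar> \<le> 1"
  unfolding riesz_def abs_prod by (intro prod_le_1) auto

lemma riesz_square_le_1: "riesz n z ^ 2 \<le> 1"
  using abs_riesz_le_1[of n z] by (simp add: abs_square_le_1)

lemma riesz_measurable [measurable]: "riesz n \<in> borel_measurable borel"
  by (intro borel_measurable_continuous_onI continuous_on_riesz continuous_intros)

lemma riesz_square_periodic: "riesz n (z + pi) ^ 2 = riesz n z ^ 2"
proof (induction n arbitrary: z)
  case (Suc n)
  have "riesz n (4 * (z + pi)) ^ 2 = riesz n (4 * z + pi + pi + pi + pi) ^ 2"
    by (simp add: algebra_simps)
  also have "\<dots> = riesz n (4 * z) ^ 2" by (simp only: Suc.IH)
  finally show ?case by (simp add: riesz_Suc power_mult_distrib)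
qed simp

text \<open>By \<open>sin (2 x) = 2 sin x cos x\<close>, the product of \<open>cos (z / 2 ^
j)\<close> over \<open>j\<close> telescopes to a quotient of sines. The product over even
\<open>j\<close> only is larger, since the omitted factors are at most 1.\<close>

lemma abs_sin_half_le_riesz: "\<bar>sin (z / 2)\<bar> \<le> \<bar>z\<bar> / 2 * \<bar>riesz M (z / 4 ^ M)\<bar>"
proof (induction M arbitrary: z)
  case 0
  then show ?case using abs_sin_x_le_abs_x[of "z / 2"] by simp
next
  case (Suc M)
  have "sin (z / 2) = 2 * (2 * sin (z / 8) * cos (z / 8)) * cos (z / 4)"
    using sin_double[of "z / 4"] sin_double[of "z / 8"] by (simp add: field_simps)
  then have "\<bar>sin (z / 2)\<bar> = 4 * \<bar>sin (z / 8)\<bar> * \<bar>cos (z / 8)\<bar> * \<bar>cos (z / 4)\<bar>"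
    by (simp add: abs_mult)
  also have "\<dots> \<le> 4 * \<bar>sin (z / 8)\<bar> * 1 * \<bar>cos (z / 4)\<bar>"
    by (intro mult_right_mono mult_left_mono) auto
  also have "\<dots> \<le> 4 * (\<bar>z / 4\<bar> / 2 * \<bar>riesz M (z / 4 / 4 ^ M)\<bar>) * 1 * \<bar>cos (z / 4)\<bar>"
    using Suc.IH[of "z / 4"] by (intro mult_right_mono mult_left_mono) auto
  also have "\<dots> = \<bar>z\<bar> / 2 * \<bar>riesz (Suc M) (z / 4 ^ Suc M)\<bar>"
    by (simp add: riesz_def abs_mult)
  finally show ?case .
qed

text \<open>The factors of \<open>transform N t\<close> that are not in \<open>transform n t\<close>
have low frequency. On the block \<open>y \<le> 4 ^ m\<close> their product is at least \<open>16 ^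
- m\<close> times a product of two sines, however large \<open>N\<close> is.\<close>

lemma transform_factor_lower:
  assumes y: "0 \<le> y" "y \<le> 4 ^ m" and t: "\<bar>t\<bar> \<le> 2" and N: "n \<le> N"
  shows "\<bar>transform n t y\<bar> * \<bar>sin (y / 6) * sin (t * y / 6)\<bar>
    \<le> 16 ^ m * \<bar>transform N t (y / 4 ^ (N - n))\<bar>"
proof -
  define M where "M = N - n"
  have split: "riesz N (z / 4 ^ M) = riesz M (z / 4 ^ M) * riesz n z" for z
    using riesz_add[of M n "z / 4 ^ M"] N by (simp add: M_def)
  have fac: "\<bar>sin (z / 2)\<bar> \<le> 4 ^ m * \<bar>riesz M (z / 4 ^ M)\<bar>" if "\<bar>z\<bar> / 2 \<le> 4 ^ m" for z
    using abs_sin_half_le_riesz[of z M] mult_right_mono[OF that abs_ge_zero[of "riesz M (z / 4 ^ M)"]]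
    by linarith
  have ty: "\<bar>t * y\<bar> \<le> 2 * 4 ^ m" unfolding abs_mult using t y by (intro mult_mono) auto
  have a: "\<bar>sin (y / 6)\<bar> \<le> 4 ^ m * \<bar>riesz M (y / 3 / 4 ^ M)\<bar>" using fac[of "y / 3"] y by simp
  have b: "\<bar>sin (t * y / 6)\<bar> \<le> 4 ^ m * \<bar>riesz M (t * y / 3 / 4 ^ M)\<bar>"
  proof -
    have "\<bar>t * y / 3\<bar> / 2 = \<bar>t * y\<bar> / 6" by simp
    then have "\<bar>t * y / 3\<bar> / 2 \<le> 4 ^ m" using ty by linarith
    from fac[OF this] show ?thesis by simp
  qed
  have "transform N t (y / 4 ^ M) = riesz M (y / 3 / 4 ^ M) * riesz M (t * y / 3 / 4 ^ M) * transform n t y"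
    using split[of "y / 3"] split[of "t * y / 3"] by (simp add: transform_def mult.commute[of "4 ^ M" 3])
  then have "16 ^ m * \<bar>transform N t (y / 4 ^ M)\<bar> = \<bar>transform n t y\<bar> *
     ((4 ^ m * \<bar>riesz M (y / 3 / 4 ^ M)\<bar>) * (4 ^ m * \<bar>riesz M (t * y / 3 / 4 ^ M)\<bar>))"
  proof -
    have "(16::real) ^ m = 4 ^ m * 4 ^ m" by (simp flip: power_mult_distrib)
    moreover assume "transform N t (y / 4 ^ M) = riesz M (y / 3 / 4 ^ M) * riesz M (t * y / 3 / 4 ^ M) * transform n t y"
    ultimately show ?thesis by (simp only: abs_mult mult_ac)
  qed
  moreover have "\<bar>sin (y / 6) * sin (t * y / 6)\<bar> \<le> (4 ^ m * \<bar>riesz M (y / 3 / 4 ^ M)\<bar>) * (4 ^ m * \<bar>riesz M (t * y / 3 / 4 ^ M)\<bar>)"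
    unfolding abs_mult[of "sin _"] by (intro mult_mono a b) auto
  ultimately show ?thesis unfolding M_def[symmetric] by (simp add: mult_left_mono)
qed

lemma nn_integral_shift:
  fixes f :: "real \<Rightarrow> ennreal"
  assumes [measurable]: "f \<in> borel_measurable borel"
  shows "(\<integral>\<^sup>+x. f (x + c) \<partial>lborel) = (\<integral>\<^sup>+x. f x \<partial>lborel)"
  using nn_integral_real_affine[of f 1 c] by (simp add: add.commute)

lemma periodic_int_mult:
  fixes f :: "real \<Rightarrow> 'b"
  assumes "\<And>x. f (x + P) = f x"
  shows "f (x + of_int q * P) = f x"
proof -
  have nat: "f (x + real k * P) = f x" for k :: nat and x
  proof (induction k)
    case (Suc k)
    have e: "x + real (Suc k) * P = x + real k * P + P" by (simp add: algebra_simps)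
    show ?case unfolding e assms by (rule Suc)
  qed simp
  show ?thesis
  proof (cases "0 \<le> q")
    case True
    then show ?thesis using nat[of x "nat q"] by simp
  next
    case False
    then show ?thesis using nat[of "x + of_int q * P" "nat (- q)"] by (simp add: algebra_simps)
  qed
qed

text \<open>Shift \<open>a\<close> into the first period, cut the window at the end of that period
and move the second piece back.\<close>

lemma nn_integral_period_window:
  fixes f :: "real \<Rightarrow> ennreal"
  assumes f [measurable]: "f \<in> borel_measurable borel" and per: "\<And>x. f (x + P) = f x" and P: "0 < P"
  shows "(\<integral>\<^sup>+x. f x * indicator {a..<a + P} x \<partial>lborel) = (\<integral>\<^sup>+x. f x * indicator {0..<P} x \<partial>lborel)"
proof -
  define q c where "q = \<lfloor>a / P\<rfloor>" and "c = a - of_int q * P"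
  have c: "0 \<le> c" "c < P"
    using floor_divide_lower[OF P, of a] floor_divide_upper[OF P, of a]
    by (auto simp: c_def q_def algebra_simps)
  have "(\<integral>\<^sup>+x. f x * indicator {a..<a + P} x \<partial>lborel) =
      (\<integral>\<^sup>+x. f (x + of_int q * P) * indicator {a..<a + P} (x + of_int q * P) \<partial>lborel)"
    by (rule nn_integral_shift[symmetric]) measurable
  also have "\<dots> = (\<integral>\<^sup>+x. f x * indicator {c..<P} x + f x * indicator {P..<c + P} x \<partial>lborel)"
    unfolding periodic_int_mult[of f, OF per] using c
    by (intro nn_integral_cong) (auto simp: indicator_def c_def)
  also have "\<dots> = (\<integral>\<^sup>+x. f x * indicator {c..<P} x \<partial>lborel) + (\<integral>\<^sup>+x. f x * indicator {P..<c + P} x \<partial>lborel)"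
    by (intro nn_integral_add) measurable
  also have "(\<integral>\<^sup>+x. f x * indicator {P..<c + P} x \<partial>lborel) =
      (\<integral>\<^sup>+x. f (x + P) * indicator {P..<c + P} (x + P) \<partial>lborel)"
    by (rule nn_integral_shift[symmetric]) measurable
  also have "\<dots> = (\<integral>\<^sup>+x. f x * indicator {0..<c} x \<partial>lborel)"
    unfolding per by (intro nn_integral_cong) (auto simp: indicator_def)
  also have "(\<integral>\<^sup>+x. f x * indicator {c..<P} x \<partial>lborel) + \<dots> =
      (\<integral>\<^sup>+x. f x * indicator {c..<P} x + f x * indicator {0..<c} x \<partial>lborel)"
    by (intro nn_integral_add[symmetric]) measurable
  also have "\<dots> = (\<integral>\<^sup>+x. f x * indicator {0..<P} x \<partial>lborel)"
    using c by (intro nn_integral_cong) (auto simp: indicator_def)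
  finally show ?thesis .
qed

lemma nn_integral_periods:
  fixes f :: "real \<Rightarrow> ennreal"
  assumes f [measurable]: "f \<in> borel_measurable borel" and per: "\<And>x. f (x + P) = f x" and P: "0 < P"
  shows "(\<integral>\<^sup>+x. f x * indicator {a..<a + real M * P} x \<partial>lborel) =
    of_nat M * (\<integral>\<^sup>+x. f x * indicator {0..<P} x \<partial>lborel)"
proof (induction M)
  case (Suc M)
  have "(\<integral>\<^sup>+x. f x * indicator {a..<a + real (Suc M) * P} x \<partial>lborel) =
     (\<integral>\<^sup>+x. f x * indicator {a..<a + real M * P} x +
        f x * indicator {a + real M * P..<a + real M * P + P} x \<partial>lborel)"
  proof (intro nn_integral_cong)
    fix x
    define L where "L = real M * P"
    have L: "0 \<le> L" "real (Suc M) * P = L + P" using P by (simp_all add: L_def algebra_simps)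
    show "f x * indicator {a..<a + real (Suc M) * P} x =
      f x * indicator {a..<a + real M * P} x + f x * indicator {a + real M * P..<a + real M * P + P} x"
      unfolding L(2) L_def[symmetric] using P L(1) by (auto simp: indicator_def)
  qed
  also have "\<dots> = (\<integral>\<^sup>+x. f x * indicator {a..<a + real M * P} x \<partial>lborel) +
     (\<integral>\<^sup>+x. f x * indicator {a + real M * P..<a + real M * P + P} x \<partial>lborel)"
    by (intro nn_integral_add) measurable
  finally show ?case
    unfolding Suc.IH nn_integral_period_window[OF f per P] by (simp add: distrib_right add.commute)
qed simp

text \<open>Shifting by \<open>pi / 2\<close> exchanges the squares of cosine and sine in the first
factor and fixes the others. The values at \<open>x\<close> and at \<open>x + pi / 2\<close>
therefore add up to the shorter product at \<open>4 x\<close>, and the integral is halved in each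
step.\<close>

lemma nn_integral_riesz_square:
  "(\<integral>\<^sup>+x. ennreal (riesz n x ^ 2) * indicator {0..<pi} x \<partial>lborel) = ennreal (pi / 2 ^ n)"
proof (induction n)
  case 0
  have "(\<integral>\<^sup>+x. ennreal (riesz 0 x ^ 2) * indicator {0..<pi} x \<partial>lborel) = (\<integral>\<^sup>+x. indicator {0..<pi} x \<partial>lborel)"
    by (intro nn_integral_cong) simp
  then show ?case by simp
next
  case (Suc n)
  define f where "f = (\<lambda>x. ennreal (riesz (Suc n) x ^ 2))"
  define g where "g = (\<lambda>x. ennreal (riesz n x ^ 2))"
  have [measurable]: "f \<in> borel_measurable borel" "g \<in> borel_measurable borel"
    unfolding f_def g_def by measurable
  have perf: "f (x + pi) = f x" and perg: "g (x + pi) = g x" for x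
    by (auto simp: f_def g_def riesz_square_periodic)
  let ?J = "\<integral>\<^sup>+x. f x * indicator {0..<pi} x \<partial>lborel"
  have pair: "f x + f (x + pi / 2) = g (4 * x)" for x
  proof -
    have "riesz n (4 * (x + pi / 2)) ^ 2 = riesz n (4 * x + pi + pi) ^ 2" by (simp add: algebra_simps)
    also have "\<dots> = riesz n (4 * x) ^ 2" by (simp only: riesz_square_periodic)
    finally have "riesz (Suc n) (x + pi / 2) ^ 2 = (sin x)\<^sup>2 * riesz n (4 * x) ^ 2"
      by (simp add: riesz_Suc power_mult_distrib cos_add)
    then have "riesz (Suc n) x ^ 2 + riesz (Suc n) (x + pi / 2) ^ 2 = ((sin x)\<^sup>2 + (cos x)\<^sup>2) * riesz n (4 * x) ^ 2"
      unfolding riesz_Suc[of n x] power_mult_distrib distrib_right by linarith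
    then have "riesz (Suc n) x ^ 2 + riesz (Suc n) (x + pi / 2) ^ 2 = riesz n (4 * x) ^ 2" by simp
    then show ?thesis by (simp add: f_def g_def del: riesz_0 flip: ennreal_plus)
  qed
  have "?J = (\<integral>\<^sup>+x. f x * indicator {pi / 2..<pi / 2 + pi} x \<partial>lborel)"
    by (rule nn_integral_period_window[symmetric]) (auto simp: perf)
  also have "\<dots> = (\<integral>\<^sup>+x. f (x + pi / 2) * indicator {pi / 2..<pi / 2 + pi} (x + pi / 2) \<partial>lborel)"
    by (rule nn_integral_shift[symmetric]) measurable
  also have "\<dots> = (\<integral>\<^sup>+x. f (x + pi / 2) * indicator {0..<pi} x \<partial>lborel)"
    by (intro nn_integral_cong) (auto simp: indicator_def)
  finally have J2: "(\<integral>\<^sup>+x. f (x + pi / 2) * indicator {0..<pi} x \<partial>lborel) = ?J" ..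
  have "?J + ?J = (\<integral>\<^sup>+x. f x * indicator {0..<pi} x + f (x + pi / 2) * indicator {0..<pi} x \<partial>lborel)"
    by (subst (2) J2[symmetric], rule nn_integral_add[symmetric]) measurable
  also have "\<dots> = (\<integral>\<^sup>+x. g (0 + 4 * x) * indicator {0..<0 + real 4 * pi} (0 + 4 * x) \<partial>lborel)"
    by (intro nn_integral_cong) (auto simp: indicator_def pair)
  finally have 1: "4 * (?J + ?J) = (\<integral>\<^sup>+x. g x * indicator {0..<0 + real 4 * pi} x \<partial>lborel)"
    using nn_integral_real_affine[of "\<lambda>x. g x * indicator {0..<0 + real 4 * pi} x" 4 0]
    by (simp add: ennreal_numeral)
  also have "\<dots> = of_nat 4 * (\<integral>\<^sup>+x. g x * indicator {0..<pi} x \<partial>lborel)"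
    by (rule nn_integral_periods) (auto simp: perg)
  also have "\<dots> = ennreal (4 * (pi / 2 ^ n))"
    unfolding g_def Suc.IH by (subst ennreal_mult) auto
  finally have 1: "4 * (?J + ?J) = ennreal (4 * (pi / 2 ^ n))" .
  have "?J = ennreal (pi / 2 ^ Suc n)"
  proof (cases ?J)
    case (real r)
    then have "ennreal (4 * (r + r)) = ennreal (4 * (pi / 2 ^ n))"
      using 1 by (simp add: ennreal_mult flip: ennreal_plus)
    then have "4 * (r + r) = 4 * (pi / 2 ^ n)" using real by (subst (asm) ennreal_inj) auto
    then have "r = pi / 2 ^ Suc n" by (simp add: field_simps)
    then show ?thesis using real by simp
  next
    case top
    then show ?thesis using 1 by simp
  qed
  then show ?case by (simp add: f_def)
qed

section \<open>Small values of the low-frequency factors\<close>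

text \<open>With \<open>y = w / 4\<close> this follows from \<open>sin (2 y) = 2 sin y cos
y\<close>, \<open>y cos y \<le> sin y\<close> and \<open>cos\<^sup>2 y \<ge> 1 / 2\<close>.\<close>

lemma abs_sin_half_ge:
  fixes w :: real
  assumes "\<bar>w\<bar> \<le> pi"
  shows "\<bar>w\<bar> / 4 \<le> \<bar>sin (w / 2)\<bar>"
proof -
  have main: "x / 4 \<le> sin (x / 2)" if x: "0 \<le> x" "x \<le> pi" for x :: real
  proof -
    define y where "y = x / 4"
    have y: "0 \<le> y" "y \<le> pi / 4" "x / 2 = 2 * y" using x by (auto simp: y_def)
    have "0 * cos 0 - sin 0 \<ge> y * cos y - sin y"
    proof (rule DERIV_nonpos_imp_nonincreasing[OF y(1)])
      fix z assume z: "0 \<le> z" "z \<le> y"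
      have "((\<lambda>z. z * cos z - sin z) has_real_derivative - (z * sin z)) (at z)"
        by (auto intro!: derivative_eq_intros)
      moreover have "0 \<le> z * sin z" using z y by (intro mult_nonneg_nonneg sin_ge_zero) auto
      ultimately show "\<exists>d. ((\<lambda>z. z * cos z - sin z) has_real_derivative d) (at z) \<and> d \<le> 0"
        by (intro exI[of _ "- (z * sin z)"]) auto
    qed
    then have "y * cos y \<le> sin y" by simp
    moreover have c: "cos (pi / 4) \<le> cos y" using y by (intro cos_monotone_0_pi_le) auto
    then have c0: "0 \<le> cos y" unfolding cos_45 by (rule order_trans[rotated]) simp
    ultimately have "y * cos y * cos y \<le> sin y * cos y" by (intro mult_right_mono)
    moreover have "(1 / 2) \<le> cos y * cos y"
      using mult_mono[OF c c c0] unfolding cos_45 by simp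
    then have "y * (1 / 2) \<le> y * (cos y * cos y)" using y by (intro mult_left_mono)
    ultimately have "y \<le> 2 * sin y * cos y" by (simp add: mult.assoc)
    then show ?thesis unfolding y(3) sin_double by (simp add: y_def)
  qed
  show ?thesis
  proof (cases "0 \<le> w")
    case True
    then show ?thesis using main[of w] assms by auto
  next
    case False
    then show ?thesis using main[of "- w"] assms by auto
  qed
qed

text \<open>The squared product, restricted to a neighbourhood of width about \<open>4 ^ - a\<close>
of the zeros of \<open>sin (w / 2)\<close>.\<close>

definition narrow :: "nat \<Rightarrow> nat \<Rightarrow> real \<Rightarrow> ennreal" where
  "narrow n a w = ennreal (riesz n w ^ 2) * indicator {..(1 / 4) ^ a} \<bar>sin (w / 2)\<bar>"

lemma narrow_measurable [measurable]: "narrow n a \<in> borel_measurable borel"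
  unfolding narrow_def by measurable

lemma narrow_periodic: "narrow n a (w + 2 * pi) = narrow n a w"
proof -
  have "riesz n (w + 2 * pi) ^ 2 = riesz n (w + pi + pi) ^ 2" by (simp add: algebra_simps)
  then have "riesz n (w + 2 * pi) ^ 2 = riesz n w ^ 2" by (simp only: riesz_square_periodic)
  moreover have "\<bar>sin ((w + 2 * pi) / 2)\<bar> = \<bar>sin (w / 2)\<bar>" by (simp add: add_divide_distrib)
  ultimately show ?thesis by (simp only: narrow_def)
qed

lemma nn_integral_riesz_square_symmetric:
  "(\<integral>\<^sup>+x. ennreal (riesz n x ^ 2) * indicator {- pi..<pi} x \<partial>lborel) = ennreal (2 * pi / 2 ^ n)"
proof -
  have "(\<integral>\<^sup>+x. ennreal (riesz n x ^ 2) * indicator {- pi..<- pi + real 2 * pi} x \<partial>lborel) =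
     of_nat 2 * (\<integral>\<^sup>+x. ennreal (riesz n x ^ 2) * indicator {0..<pi} x \<partial>lborel)"
    by (rule nn_integral_periods) (auto simp: riesz_square_periodic)
  also have "\<dots> = ennreal (2 * (pi / 2 ^ n))"
    unfolding nn_integral_riesz_square by (subst ennreal_mult) auto
  finally show ?thesis by simp
qed

text \<open>Near the zeros of the sine the first factors of the Riesz product are close to 1 and do
not help. After dropping as many of them as the width allows, rescaling gives a full period of a
shorter product. The neighbourhood of width \<open>4 ^ - a\<close> carries the proportion \<open>2 ^
- a\<close> of the total mass, up to a constant factor: the limiting measure has dimension \<open>1
/ 2\<close>.\<close>

lemma narrow_mass:
  "(\<integral>\<^sup>+x. narrow n a x * indicator {0..<2 * pi} x \<partial>lborel) \<le> ennreal (4 * pi / 2 ^ n / 2 ^ a)"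
proof -
  have "(\<integral>\<^sup>+x. narrow n a x * indicator {0..<2 * pi} x \<partial>lborel) =
      (\<integral>\<^sup>+x. narrow n a x * indicator {- pi..<- pi + 2 * pi} x \<partial>lborel)"
    by (rule nn_integral_period_window[symmetric]) (auto simp: narrow_periodic)
  also have "\<dots> \<le> ennreal (4 * pi / 2 ^ n / 2 ^ a)"
  proof (cases a)
    case 0
    have "(\<integral>\<^sup>+x. narrow n a x * indicator {- pi..<- pi + 2 * pi} x \<partial>lborel) \<le>
       (\<integral>\<^sup>+x. ennreal (riesz n x ^ 2) * indicator {- pi..<pi} x \<partial>lborel)"
      by (intro nn_integral_mono) (auto simp: narrow_def indicator_def)
    also have "\<dots> \<le> ennreal (4 * pi / 2 ^ n / 2 ^ a)"
      unfolding nn_integral_riesz_square_symmetric 0 by (intro ennreal_leI) (simp add: divide_right_mono)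
    finally show ?thesis .
  next
    case (Suc c)
    have near: "\<bar>4 ^ c * w\<bar> \<le> 1" if "w \<in> {- pi..<- pi + 2 * pi}" "\<bar>sin (w / 2)\<bar> \<le> (1 / 4) ^ a" for w
    proof -
      have "\<bar>w\<bar> / 4 \<le> (1 / 4) ^ a" using abs_sin_half_ge[of w] that by (auto simp: abs_le_iff)
      then have "\<bar>w\<bar> \<le> 1 / 4 ^ c" by (simp add: Suc power_divide)
      then show ?thesis by (simp add: abs_mult field_simps)
    qed
    show ?thesis
    proof (cases "c \<le> n")
      case True
      define g where "g = (\<lambda>v. ennreal (riesz (n - c) v ^ 2) * indicator {- pi..<pi} v)"
      have [measurable]: "g \<in> borel_measurable borel" unfolding g_def by measurable
      have "(\<integral>\<^sup>+x. narrow n a x * indicator {- pi..<- pi + 2 * pi} x \<partial>lborel) \<le> (\<integral>\<^sup>+x. g (0 + 4 ^ c * x) \<partial>lborel)"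
      proof (intro nn_integral_mono)
        fix x
        show "narrow n a x * indicator {- pi..<- pi + 2 * pi} x \<le> g (0 + 4 ^ c * x)"
        proof (cases "x \<in> {- pi..<- pi + 2 * pi} \<and> \<bar>sin (x / 2)\<bar> \<le> (1 / 4) ^ a")
          case inside: True
          then have "\<bar>4 ^ c * x\<bar> \<le> 1" using near by blast
          then have mem: "4 ^ c * x \<in> {- pi..<pi}" using pi_gt3 by (auto simp: abs_le_iff)
          have "riesz n x ^ 2 = riesz c x ^ 2 * riesz (n - c) (4 ^ c * x) ^ 2"
            using riesz_add[of c "n - c" x] True by (simp add: power_mult_distrib)
          also have "\<dots> \<le> 1 * riesz (n - c) (4 ^ c * x) ^ 2"
            by (intro mult_right_mono riesz_square_le_1) auto
          finally show ?thesis using inside mem by (simp add: narrow_def g_def ennreal_leI)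
        qed (auto simp: narrow_def indicator_def)
      qed
      moreover have "(\<integral>\<^sup>+x. g x \<partial>lborel) = ennreal (4 ^ c) * (\<integral>\<^sup>+x. g (0 + 4 ^ c * x) \<partial>lborel)"
        using nn_integral_real_affine[of g "4 ^ c" 0] by simp
      moreover have "(\<integral>\<^sup>+x. g x \<partial>lborel) = ennreal (4 ^ c) * ennreal (4 * pi / 2 ^ n / 2 ^ a)"
      proof -
        have "(2::real) ^ n = 2 ^ (n - c) * 2 ^ c" using True by (simp flip: power_add)
        moreover have "(4::real) ^ c = 2 ^ c * 2 ^ c" by (simp flip: power_mult_distrib)
        ultimately have "2 * pi / 2 ^ (n - c) = 4 ^ c * (4 * pi / 2 ^ n / 2 ^ a)"
          by (simp add: Suc field_simps)
        then show ?thesis unfolding g_def nn_integral_riesz_square_symmetric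
          by (simp add: ennreal_mult[symmetric])
      qed
      ultimately have "ennreal (4 ^ c) * (\<integral>\<^sup>+x. g (0 + 4 ^ c * x) \<partial>lborel) = ennreal (4 ^ c) * ennreal (4 * pi / 2 ^ n / 2 ^ a)"
        by simp
      then have "(\<integral>\<^sup>+x. g (0 + 4 ^ c * x) \<partial>lborel) = ennreal (4 * pi / 2 ^ n / 2 ^ a)"
        by (subst (asm) ennreal_mult_cancel_left) auto
      then show ?thesis
        using \<open>(\<integral>\<^sup>+x. narrow n a x * indicator {- pi..<- pi + 2 * pi} x \<partial>lborel) \<le> (\<integral>\<^sup>+x. g (0 + 4 ^ c * x) \<partial>lborel)\<close>
        by simp
    next
      case False
      have "(\<integral>\<^sup>+x. narrow n a x * indicator {- pi..<- pi + 2 * pi} x \<partial>lborel) \<le>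
        (\<integral>\<^sup>+x. indicator {- (1 / 4 ^ c)..1 / 4 ^ c} (x::real) \<partial>lborel)"
      proof (intro nn_integral_mono)
        fix x
        show "narrow n a x * indicator {- pi..<- pi + 2 * pi} x \<le> indicator {- (1 / 4 ^ c)..1 / 4 ^ c} x"
        proof (cases "x \<in> {- pi..<- pi + 2 * pi} \<and> \<bar>sin (x / 2)\<bar> \<le> (1 / 4) ^ a")
          case True
          then have "\<bar>4 ^ c * x\<bar> \<le> 1" using near by blast
          then have "\<bar>x\<bar> \<le> 1 / 4 ^ c" by (simp add: abs_mult field_simps)
          then have "x \<in> {- (1 / 4 ^ c)..1 / 4 ^ c}" by (auto simp: abs_le_iff)
          then show ?thesis using True by (simp add: narrow_def riesz_square_le_1)
        qed (auto simp: narrow_def indicator_def)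
      qed
      also have "\<dots> = ennreal (1 / 4 ^ c - - (1 / 4 ^ c))" by simp
      also have "\<dots> \<le> ennreal (4 * pi / 2 ^ n / 2 ^ a)"
      proof (rule ennreal_leI)
        have "(2::real) ^ n * 2 ^ c \<le> 2 ^ c * 2 ^ c" using False by simp
        also have "\<dots> = (4::real) ^ c" by (simp flip: power_mult_distrib)
        finally have "1 / (4::real) ^ c \<le> 1 / (2 ^ n * 2 ^ c)" by (intro divide_left_mono) auto
        also have "\<dots> \<le> pi / (2 ^ n * 2 ^ c)" using pi_gt3 by (intro divide_right_mono) auto
        finally have "2 * (1 / 4 ^ c) \<le> 2 * (pi / (2 ^ n * 2 ^ c))" by (intro mult_left_mono) auto
        moreover have "4 * pi / 2 ^ n / 2 ^ a = 2 * (pi / (2 ^ n * 2 ^ c))" by (simp add: Suc)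
        ultimately show "1 / 4 ^ c - - (1 / 4 ^ c) \<le> 4 * pi / 2 ^ n / 2 ^ a" by linarith
      qed
      finally show ?thesis .
    qed
  qed
  finally show ?thesis .
qed

lemma narrow_mass_window:
  "(\<integral>\<^sup>+x. narrow n a x * indicator {x0..<x0 + real M * (2 * pi)} x \<partial>lborel) \<le>
    ennreal (real M * (4 * pi / 2 ^ n / 2 ^ a))"
proof -
  have "(\<integral>\<^sup>+x. narrow n a x * indicator {x0..<x0 + real M * (2 * pi)} x \<partial>lborel) =
      of_nat M * (\<integral>\<^sup>+x. narrow n a x * indicator {0..<2 * pi} x \<partial>lborel)"
    by (rule nn_integral_periods) (auto simp: narrow_periodic)
  also have "\<dots> \<le> of_nat M * ennreal (4 * pi / 2 ^ n / 2 ^ a)"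
    by (intro mult_left_mono narrow_mass) auto
  also have "\<dots> = ennreal (real M * (4 * pi / 2 ^ n / 2 ^ a))"
    by (subst ennreal_mult) (auto simp: ennreal_of_nat_eq_real_of_nat)
  finally show ?thesis .
qed

text \<open>Substitute \<open>v = t y / 3\<close>. The window for \<open>v\<close> has length of
order \<open>y\<close>, which cancels the Jacobian \<open>3 / y\<close>.\<close>

lemma narrow_mass_slopes:
  assumes y: "1 \<le> y"
  shows "(\<integral>\<^sup>+t. narrow n c (t * y / 3) * indicator {- 2..2} t \<partial>lborel) \<le> ennreal (9 * (4 * pi / 2 ^ n / 2 ^ c))"
proof -
  define h where "h = 4 * pi / 2 ^ n / 2 ^ c"
  have h: "0 \<le> h" by (simp add: h_def)
  let ?f = "\<lambda>v. narrow n c v * indicator {- (2 * y / 3)..2 * y / 3} v"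
  define M where "M = Suc (nat \<lceil>y\<rceil>)"
  have M: "real M \<le> 3 * y" "y + 1 \<le> real M"
  proof -
    have "real (nat \<lceil>y\<rceil>) = of_int \<lceil>y\<rceil>" using y by simp
    then show "real M \<le> 3 * y" "y + 1 \<le> real M"
      using y ceiling_correct[of y] by (auto simp: M_def)
  qed
  have My: "(y + 1) * 3 \<le> real M * pi" using M(2) pi_gt3 y by (intro mult_mono) auto
  have "ennreal (y / 3) * (\<integral>\<^sup>+t. narrow n c (t * y / 3) * indicator {- 2..2} t \<partial>lborel) =
      ennreal \<bar>y / 3\<bar> * (\<integral>\<^sup>+t. ?f (0 + y / 3 * t) \<partial>lborel)"
  proof -
    have "(\<integral>\<^sup>+t. narrow n c (t * y / 3) * indicator {- 2..2} t \<partial>lborel) = (\<integral>\<^sup>+t. ?f (0 + y / 3 * t) \<partial>lborel)"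
    proof (intro nn_integral_cong)
      fix t
      have "(y / 3 * t \<in> {- (2 * y / 3)..2 * y / 3}) = (t \<in> {- 2..2})"
      proof -
        have y3: "0 < y / 3" and e: "{- (2 * y / 3)..2 * y / 3} = {y / 3 * (- 2)..y / 3 * 2}" using y by simp_all
        show ?thesis unfolding e atLeastAtMost_iff mult_le_cancel_left_pos[OF y3] ..
      qed
      then show "narrow n c (t * y / 3) * indicator {- 2..2} t = ?f (0 + y / 3 * t)"
        by (simp add: indicator_def mult.commute)
    qed
    then show ?thesis using y by simp
  qed
  also have "\<dots> = (\<integral>\<^sup>+v. ?f v \<partial>lborel)"
    using y by (intro nn_integral_real_affine[symmetric]) auto
  also have "\<dots> \<le> (\<integral>\<^sup>+v. narrow n c v * indicator {- (2 * y / 3)..<- (2 * y / 3) + real M * (2 * pi)} v \<partial>lborel)"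
    using My y by (intro nn_integral_mono) (auto simp: indicator_def)
  also have "\<dots> \<le> ennreal (real M * h)" unfolding h_def by (rule narrow_mass_window)
  also have "\<dots> \<le> ennreal (3 * y * h)" using M h by (intro ennreal_leI mult_right_mono)
  also have "\<dots> = ennreal (y / 3) * ennreal (9 * h)"
    using y h by (simp add: ennreal_mult[symmetric])
  finally show ?thesis
    using y by (subst (asm) ennreal_mult_le_mult_iff) (auto simp: h_def)
qed

lemma narrow_mass_block:
  "(\<integral>\<^sup>+y. narrow n a (y / 3) * indicator {1<..4 ^ m} y \<partial>lborel) \<le> ennreal (3 * 4 ^ m * (4 * pi / 2 ^ n / 2 ^ a))"
proof -
  define h where "h = 4 * pi / 2 ^ n / 2 ^ a"
  have "(\<integral>\<^sup>+y. narrow n a (y / 3) * indicator {1<..4 ^ m} y \<partial>lborel) =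
     ennreal \<bar>3\<bar> * (\<integral>\<^sup>+w. narrow n a ((0 + 3 * w) / 3) * indicator {1<..4 ^ m} (0 + 3 * w) \<partial>lborel)"
    by (rule nn_integral_real_affine) auto
  also have "\<dots> \<le> ennreal \<bar>3\<bar> * (\<integral>\<^sup>+w. narrow n a w * indicator {0..<0 + real (4 ^ m) * (2 * pi)} w \<partial>lborel)"
  proof (intro mult_left_mono nn_integral_mono)
    fix w :: real
    have "w < 4 ^ m * (2 * pi)" if "1 < 3 * w" "3 * w \<le> 4 ^ m"
    proof -
      have "4 ^ m * 1 \<le> (4::real) ^ m * (2 * pi)" using pi_gt3 by (intro mult_left_mono) auto
      then show ?thesis using that by linarith
    qed
    then show "narrow n a ((0 + 3 * w) / 3) * indicator {1<..4 ^ m} (0 + 3 * w) \<le>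
        narrow n a w * indicator {0..<0 + real (4 ^ m) * (2 * pi)} w"
      by (auto simp: indicator_def)
  qed auto
  also have "\<dots> \<le> ennreal \<bar>3\<bar> * ennreal (real (4 ^ m) * h)"
    unfolding h_def by (intro mult_left_mono narrow_mass_window) auto
  also have "\<dots> = ennreal (3 * 4 ^ m * h)" by (subst ennreal_mult[symmetric]) (auto simp: h_def)
  finally show ?thesis by (simp add: h_def)
qed

text \<open>If the product of two numbers in \<open>[0, 1]\<close> is small then, for one of
\<open>b + 1\<close> splittings of the exponent, both factors are small. For \<open>a = b\<close>
the truncated exponent \<open>b - a - 1\<close> is 0, a trivial bound.\<close>

lemma dyadic_split:
  fixes u v :: real
  assumes "0 \<le> u" "u \<le> 1" "0 \<le> v" "v \<le> 1" "u * v \<le> (1 / 4) ^ b"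
  shows "\<exists>a\<le>b. u \<le> (1 / 4) ^ a \<and> v \<le> (1 / 4) ^ (b - a - 1)"
proof (cases "u \<le> (1 / 4) ^ b")
  case True
  then show ?thesis using assms by (intro exI[of _ b]) auto
next
  case False
  define a where "a = (LEAST a. \<not> u \<le> (1 / 4) ^ a)"
  have a: "\<not> u \<le> (1 / 4) ^ a" "a \<le> b"
    unfolding a_def by (rule LeastI[of _ b], rule False) (rule Least_le, rule False)
  then obtain a' where a': "a = Suc a'" using assms by (cases a) auto
  have "u \<le> (1 / 4) ^ a'" using not_less_Least[of a' "\<lambda>a. \<not> u \<le> (1 / 4) ^ a"] a' a_def by auto
  moreover have "v \<le> (1 / 4) ^ (b - a' - 1)"
  proof -
    have "(1 / 4) ^ a * v \<le> u * v" using a assms by (intro mult_right_mono) auto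
    also have "\<dots> \<le> (1 / 4) ^ b" by (rule assms)
    also have "\<dots> = (1 / 4) ^ a * (1 / 4) ^ (b - a)" using a by (simp flip: power_add)
    finally have "v \<le> (1 / 4) ^ (b - a)" by (rule mult_left_le_imp_le) simp
    then show ?thesis by (simp add: a')
  qed
  ultimately show ?thesis using a a' by (intro exI[of _ a']) auto
qed

text \<open>The high-frequency mass of the block of frequencies between \<open>4 ^ n\<close> and
\<open>4 ^ (n + m)\<close> that sits where the low-frequency bound of
\<open>transform_factor_lower\<close> is at most \<open>4 ^ - b\<close> of its maximum. The
frequency variable \<open>y\<close> is scaled by \<open>4 ^ - n\<close>, which explains the
prefactor.\<close>

definition small_mass :: "nat \<Rightarrow> nat \<Rightarrow> nat \<Rightarrow> real \<Rightarrow> ennreal" where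
  "small_mass n m b t = ennreal (4 ^ n) *
    (\<integral>\<^sup>+y. ennreal (transform n t y ^ 2) * indicator {1<..4 ^ m} y *
       indicator {..(1 / 4) ^ b} \<bar>sin (y / 6) * sin (t * y / 6)\<bar> \<partial>lborel)"

lemma small_mass_measurable [measurable]: "small_mass n m b \<in> borel_measurable borel"
  unfolding small_mass_def transform_def by measurable

lemma small_mass_pointwise:
  "ennreal (transform n t y ^ 2) * indicator {1<..4 ^ m} y *
       indicator {..(1 / 4) ^ b} \<bar>sin (y / 6) * sin (t * y / 6)\<bar>
   \<le> (\<Sum>a\<le>b. narrow n a (y / 3) * indicator {1<..4 ^ m} y * narrow n (b - a - 1) (t * y / 3))"
proof (cases "y \<in> {1<..4 ^ m} \<and> \<bar>sin (y / 6) * sin (t * y / 6)\<bar> \<le> (1 / 4) ^ b")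
  case True
  have "\<exists>a\<le>b. \<bar>sin (y / 6)\<bar> \<le> (1 / 4) ^ a \<and> \<bar>sin (t * y / 6)\<bar> \<le> (1 / 4) ^ (b - a - 1)"
    using True by (intro dyadic_split) (auto simp: abs_mult)
  then obtain a where a: "a \<le> b" "\<bar>sin (y / 6)\<bar> \<le> (1 / 4) ^ a" "\<bar>sin (t * y / 6)\<bar> \<le> (1 / 4) ^ (b - a - 1)"
    by blast
  have "ennreal (transform n t y ^ 2) = ennreal (riesz n (y / 3) ^ 2) * ennreal (riesz n (t * y / 3) ^ 2)"
    by (simp add: transform_def power_mult_distrib ennreal_mult)
  then have "ennreal (transform n t y ^ 2) * indicator {1<..4 ^ m} y *
       indicator {..(1 / 4) ^ b} \<bar>sin (y / 6) * sin (t * y / 6)\<bar> =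
     narrow n a (y / 3) * indicator {1<..4 ^ m} y * narrow n (b - a - 1) (t * y / 3)"
    using True a by (simp add: narrow_def)
  also have "\<dots> \<le> (\<Sum>a\<le>b. narrow n a (y / 3) * indicator {1<..4 ^ m} y * narrow n (b - a - 1) (t * y / 3))"
    using a by (intro member_le_sum) auto
  finally show ?thesis .
qed (auto simp: indicator_def)

text \<open>By \<open>dyadic_split\<close> the restriction to small values of the product of sines
splits into \<open>b + 1\<close> restrictions to products of neighbourhoods of zeros, whose widths
multiply to about \<open>4 ^ - b\<close>. For each of them the double integral over \<open>t\<close>
and \<open>y\<close> factors after the substitution of \<open>narrow_mass_slopes\<close>. A total
mass of order \<open>4 ^ m\<close> is reduced by the factor \<open>(b + 1) / 2 ^ b\<close>, the
square root of the width up to a logarithm.\<close>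

lemma small_mass_average:
  "(\<integral>\<^sup>+t. small_mass n m b t * indicator {- 2..2} t \<partial>lborel) \<le>
    ennreal (13824 * 4 ^ m * (real b + 1) / 2 ^ b)"
proof -
  define h where "h = (\<lambda>a. 4 * pi / 2 ^ n / 2 ^ a)"
  have h: "0 \<le> h a" for a by (simp add: h_def)
  let ?S = "\<lambda>t y. (\<Sum>a\<le>b. narrow n a (y / 3) * indicator {1<..4 ^ m} y * narrow n (b - a - 1) (t * y / 3))"
  let ?F = "\<lambda>t y. ennreal (transform n t y ^ 2) * indicator {1<..4 ^ m} y *
       indicator {..(1 / 4) ^ b} \<bar>sin (y / 6) * sin (t * y / 6)\<bar>"
  have "(\<integral>\<^sup>+t. small_mass n m b t * indicator {- 2..2} t \<partial>lborel) \<le>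
      (\<integral>\<^sup>+t. ennreal (4 ^ n) * (\<integral>\<^sup>+y. ?S t y * indicator {- 2..2} t \<partial>lborel) \<partial>lborel)"
  proof (intro nn_integral_mono)
    fix t
    have "(\<integral>\<^sup>+y. ?F t y \<partial>lborel) * indicator {- 2..2} t \<le> (\<integral>\<^sup>+y. ?S t y \<partial>lborel) * indicator {- 2..2} t"
      by (intro mult_right_mono nn_integral_mono small_mass_pointwise) auto
    also have "\<dots> = (\<integral>\<^sup>+y. ?S t y * indicator {- 2..2} t \<partial>lborel)"
      by (intro nn_integral_multc[symmetric]) measurable
    finally have "ennreal (4 ^ n) * ((\<integral>\<^sup>+y. ?F t y \<partial>lborel) * indicator {- 2..2} t) \<le>
        ennreal (4 ^ n) * (\<integral>\<^sup>+y. ?S t y * indicator {- 2..2} t \<partial>lborel)"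
      by (intro mult_left_mono) auto
    then show "small_mass n m b t * indicator {- 2..2} t \<le>
        ennreal (4 ^ n) * (\<integral>\<^sup>+y. ?S t y * indicator {- 2..2} t \<partial>lborel)"
      by (simp only: small_mass_def mult.assoc)
  qed
  also have "\<dots> = ennreal (4 ^ n) * (\<integral>\<^sup>+t. (\<integral>\<^sup>+y. ?S t y * indicator {- 2..2} t \<partial>lborel) \<partial>lborel)"
    by (intro nn_integral_cmult) measurable
  also have "(\<integral>\<^sup>+t. (\<integral>\<^sup>+y. ?S t y * indicator {- 2..2} t \<partial>lborel) \<partial>lborel) =
      (\<integral>\<^sup>+y. (\<integral>\<^sup>+t. ?S t y * indicator {- 2..2} t \<partial>lborel) \<partial>lborel)"
    by (rule lborel_pair.Fubini'[symmetric]) measurable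
  also have "\<dots> \<le> (\<integral>\<^sup>+y. (\<Sum>a\<le>b. ennreal (9 * h (b - a - 1)) * (narrow n a (y / 3) * indicator {1<..4 ^ m} y)) \<partial>lborel)"
  proof (intro nn_integral_mono)
    fix y :: real
    have "(\<integral>\<^sup>+t. ?S t y * indicator {- 2..2} t \<partial>lborel) =
        (\<integral>\<^sup>+t. (\<Sum>a\<le>b. narrow n a (y / 3) * indicator {1<..4 ^ m} y * (narrow n (b - a - 1) (t * y / 3) * indicator {- 2..2} t)) \<partial>lborel)"
      by (simp only: sum_distrib_right mult.assoc)
    also have "\<dots> = (\<Sum>a\<le>b. \<integral>\<^sup>+t. narrow n a (y / 3) * indicator {1<..4 ^ m} y * (narrow n (b - a - 1) (t * y / 3) * indicator {- 2..2} t) \<partial>lborel)"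
      by (intro nn_integral_sum) measurable
    also have "\<dots> = (\<Sum>a\<le>b. narrow n a (y / 3) * indicator {1<..4 ^ m} y * (\<integral>\<^sup>+t. narrow n (b - a - 1) (t * y / 3) * indicator {- 2..2} t \<partial>lborel))"
      by (intro sum.cong refl nn_integral_cmult) measurable
    also have "\<dots> \<le> (\<Sum>a\<le>b. ennreal (9 * h (b - a - 1)) * (narrow n a (y / 3) * indicator {1<..4 ^ m} y))"
    proof (intro sum_mono)
      fix a
      show "narrow n a (y / 3) * indicator {1<..4 ^ m} y * (\<integral>\<^sup>+t. narrow n (b - a - 1) (t * y / 3) * indicator {- 2..2} t \<partial>lborel)
        \<le> ennreal (9 * h (b - a - 1)) * (narrow n a (y / 3) * indicator {1<..4 ^ m} y)"
      proof (cases "y \<in> {1<..4 ^ m}")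
        case True
        then have "(\<integral>\<^sup>+t. narrow n (b - a - 1) (t * y / 3) * indicator {- 2..2} t \<partial>lborel) \<le> ennreal (9 * h (b - a - 1))"
          unfolding h_def by (intro narrow_mass_slopes) auto
        then show ?thesis by (subst mult.commute) (rule mult_right_mono, auto)
      qed simp
    qed
    finally show "(\<integral>\<^sup>+t. ?S t y * indicator {- 2..2} t \<partial>lborel) \<le>
      (\<Sum>a\<le>b. ennreal (9 * h (b - a - 1)) * (narrow n a (y / 3) * indicator {1<..4 ^ m} y))" .
  qed
  also have "\<dots> = (\<Sum>a\<le>b. ennreal (9 * h (b - a - 1)) * (\<integral>\<^sup>+y. narrow n a (y / 3) * indicator {1<..4 ^ m} y \<partial>lborel))"
    by (subst nn_integral_sum, measurable) (intro sum.cong refl nn_integral_cmult, measurable)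
  also have "\<dots> \<le> (\<Sum>a\<le>b. ennreal (9 * h (b - a - 1)) * ennreal (3 * 4 ^ m * h a))"
    unfolding h_def by (intro sum_mono mult_left_mono narrow_mass_block) auto
  also have "\<dots> = (\<Sum>a\<le>b. ennreal (27 * 4 ^ m * (h a * h (b - a - 1))))"
    using h by (intro sum.cong refl) (simp add: ennreal_mult[symmetric] mult_ac)
  also have "\<dots> \<le> (\<Sum>a\<le>b. ennreal (27 * 4 ^ m * (512 / 4 ^ n / 2 ^ b)))"
  proof (intro sum_mono ennreal_leI mult_left_mono)
    fix a assume a: "a \<in> {..b}"
    have "(2::real) ^ b \<le> 2 ^ Suc (a + (b - a - 1))" using a by (intro power_increasing) auto
    then have e: "(2::real) ^ b \<le> 2 * (2 ^ a * 2 ^ (b - a - 1))" by (simp add: power_add)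
    have p: "pi * pi \<le> 4 * 4" using pi_less_4 by (intro mult_mono) auto
    have "h a * h (b - a - 1) = (16 * (pi * pi)) / 4 ^ n / (2 ^ a * 2 ^ (b - a - 1))"
    proof -
      have "(4::real) ^ n = 2 ^ n * 2 ^ n" by (simp flip: power_mult_distrib)
      then show ?thesis by (simp add: h_def)
    qed
    also have "\<dots> \<le> 256 / 4 ^ n / (2 ^ a * 2 ^ (b - a - 1))"
      using p by (intro divide_right_mono) auto
    also have "\<dots> \<le> 256 / 4 ^ n / (2 ^ b / 2)"
      using e by (intro divide_left_mono) auto
    also have "\<dots> = 512 / 4 ^ n / 2 ^ b" by simp
    finally show "h a * h (b - a - 1) \<le> 512 / 4 ^ n / 2 ^ b" .
  qed auto
  also have "\<dots> = ennreal ((real b + 1) * (27 * 4 ^ m * (512 / 4 ^ n / 2 ^ b)))"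
    by (subst ennreal_mult) (auto simp: ennreal_of_nat_eq_real_of_nat add.commute)
  finally have "(\<integral>\<^sup>+t. small_mass n m b t * indicator {- 2..2} t \<partial>lborel) \<le>
     ennreal (4 ^ n) * ennreal ((real b + 1) * (27 * 4 ^ m * (512 / 4 ^ n / 2 ^ b)))"
    by (simp add: mult_left_mono)
  also have "\<dots> = ennreal (13824 * 4 ^ m * (real b + 1) / 2 ^ b)"
    by (subst ennreal_mult[symmetric]) (auto intro!: arg_cong[where f=ennreal] simp: field_simps)
  finally show ?thesis .
qed

section \<open>The mean shadow of a four-corner set\<close>

lemma transform_measurable [measurable]: "transform n t \<in> borel_measurable borel"
  unfolding transform_def by measurable

lemma nn_integral_transform:
  "(\<integral>\<^sup>+y. ennreal (transform n t y ^ 2) * indicator {0..Y} y \<partial>lborel) =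
    ennreal (integral {0..Y} (\<lambda>y. transform n t y ^ 2))"
proof -
  let ?g = "\<lambda>y. if y \<in> {0..Y} then transform n t y ^ 2 else 0"
  have "(\<lambda>y. transform n t y ^ 2) integrable_on {0..Y}"
    by (intro integrable_continuous_real continuous_intros continuous_on_transform)
  then have "((\<lambda>y. transform n t y ^ 2) has_integral integral {0..Y} (\<lambda>y. transform n t y ^ 2)) {0..Y}"
    by (rule integrable_integral)
  then have "(?g has_integral integral {0..Y} (\<lambda>y. transform n t y ^ 2)) UNIV"
    by (simp only: has_integral_restrict_UNIV)
  then have "(\<integral>\<^sup>+y. ennreal (?g y) \<partial>lborel) = ennreal (integral {0..Y} (\<lambda>y. transform n t y ^ 2))"
    by (intro nn_integral_has_integral_lborel) auto
  moreover have "(\<integral>\<^sup>+y. ennreal (?g y) \<partial>lborel) = (\<integral>\<^sup>+y. ennreal (transform n t y ^ 2) * indicator {0..Y} y \<partial>lborel)"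
    by (intro nn_integral_cong) (auto simp: indicator_def)
  ultimately show ?thesis by simp
qed

text \<open>For \<open>1 < y\<close> either the product of the two sines is small, or
\<open>transform n t y\<close> is bounded by the full transform.\<close>

lemma block_pointwise:
  assumes t: "\<bar>t\<bar> \<le> 2" and N: "n \<le> N"
  shows "ennreal (transform n t y ^ 2) * indicator {0..4 ^ m} y \<le>
    ennreal (transform n t y ^ 2) * indicator {0..1} y +
    ennreal (transform n t y ^ 2) * indicator {1<..4 ^ m} y * indicator {..(1 / 4) ^ b} \<bar>sin (y / 6) * sin (t * y / 6)\<bar> +
    ennreal (256 ^ m * 16 ^ b) * (ennreal (transform N t (y / 4 ^ (N - n)) ^ 2) * indicator {1<..4 ^ m} y)"
proof (cases "y \<in> {1<..4 ^ m} \<and> (1 / 4) ^ b < \<bar>sin (y / 6) * sin (t * y / 6)\<bar>")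
  case True
  let ?s = "\<bar>sin (y / 6) * sin (t * y / 6)\<bar>" and ?T = "transform N t (y / 4 ^ (N - n))"
  have "\<bar>transform n t y\<bar> * (1 / 4) ^ b \<le> \<bar>transform n t y\<bar> * ?s"
    using True by (intro mult_left_mono) auto
  also have "\<dots> \<le> 16 ^ m * \<bar>?T\<bar>"
    using True by (intro transform_factor_lower t N) auto
  finally have "\<bar>transform n t y\<bar> \<le> 16 ^ m * 4 ^ b * \<bar>?T\<bar>" by (simp add: power_divide field_simps)
  then have "\<bar>transform n t y\<bar> ^ 2 \<le> (16 ^ m * 4 ^ b * \<bar>?T\<bar>) ^ 2" by (intro power_mono) auto
  also have "(16 ^ m * 4 ^ b * \<bar>?T\<bar>) ^ 2 = 256 ^ m * 16 ^ b * ?T ^ 2"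
  proof -
    have "((16::real) ^ m) ^ 2 = 256 ^ m" "((4::real) ^ b) ^ 2 = 16 ^ b"
      by (simp_all add: power2_eq_square flip: power_mult_distrib)
    then show ?thesis by (simp add: power_mult_distrib)
  qed
  finally have "ennreal (transform n t y ^ 2) \<le> ennreal (256 ^ m * 16 ^ b * ?T ^ 2)"
    by (intro ennreal_leI) simp
  then have "ennreal (transform n t y ^ 2) \<le> ennreal (256 ^ m * 16 ^ b) * ennreal (?T ^ 2)"
    by (subst ennreal_mult[symmetric]) auto
  then show ?thesis using True by simp
next
  case False
  then show ?thesis by (auto simp: indicator_def)
qed

text \<open>The mass of the high-frequency part over \<open>[0, 4 ^ m]\<close> is bounded below by
\<open>transform_lower\<close>. It comes from \<open>[0, 1]\<close>, where the energy bounds it,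
from the frequencies counted by \<open>small_mass\<close>, or from the full transform on the
block.\<close>

lemma block_inequality:
  assumes t: "\<bar>t\<bar> \<le> 2" and N: "n \<le> N" and E: "energy (corner t) n \<le> 10 * 4 ^ i * 4 ^ n"
  shows "ennreal (4 ^ m / 2) \<le> ennreal (340 * 4 ^ i) + small_mass n m b t + ennreal (256 ^ m * 16 ^ b) *
    (ennreal (4 ^ N) * (\<integral>\<^sup>+u. ennreal (transform N t u ^ 2) * indicator {1<..4 ^ m} (4 ^ (N - n) * u) \<partial>lborel))"
proof -
  define M where "M = N - n"
  let ?D = "\<lambda>y. ennreal (transform n t y ^ 2)"
  let ?P = "\<lambda>y. ?D y * indicator {1<..4 ^ m} y * indicator {..(1 / 4) ^ b} \<bar>sin (y / 6) * sin (t * y / 6)\<bar>"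
  let ?Q = "\<lambda>y. ennreal (transform N t (y / 4 ^ M) ^ 2) * indicator {1<..4 ^ m} y"
  have "ennreal (4 ^ m / 2) = ennreal (4 ^ n) * ennreal (4 ^ m / (2 * 4 ^ n))"
    by (simp add: ennreal_mult[symmetric])
  also have "\<dots> \<le> ennreal (4 ^ n) * (\<integral>\<^sup>+y. ?D y * indicator {0..4 ^ m} y \<partial>lborel)"
    unfolding nn_integral_transform by (intro mult_left_mono ennreal_leI transform_lower) auto
  also have "\<dots> \<le> ennreal (4 ^ n) * (\<integral>\<^sup>+y. ?D y * indicator {0..1} y + ?P y + ennreal (256 ^ m * 16 ^ b) * ?Q y \<partial>lborel)"
    unfolding M_def by (intro mult_left_mono nn_integral_mono block_pointwise t N) auto
  also have "\<dots> = ennreal (4 ^ n) * ((\<integral>\<^sup>+y. ?D y * indicator {0..1} y \<partial>lborel) + (\<integral>\<^sup>+y. ?P y \<partial>lborel) +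
      ennreal (256 ^ m * 16 ^ b) * (\<integral>\<^sup>+y. ?Q y \<partial>lborel))"
    by (simp add: nn_integral_add nn_integral_cmult)
  also have "\<dots> = ennreal (4 ^ n) * (\<integral>\<^sup>+y. ?D y * indicator {0..1} y \<partial>lborel) + small_mass n m b t +
      ennreal (256 ^ m * 16 ^ b) * (ennreal (4 ^ n) * (\<integral>\<^sup>+y. ?Q y \<partial>lborel))"
    unfolding small_mass_def by (simp only: distrib_left mult_ac)
  also have "(\<integral>\<^sup>+y. ?Q y \<partial>lborel) = ennreal (4 ^ M) * (\<integral>\<^sup>+u. ?Q (0 + 4 ^ M * u) \<partial>lborel)"
    using nn_integral_real_affine[of ?Q "4 ^ M" 0] by simp
  also have "ennreal (4 ^ n) * (ennreal (4 ^ M) * (\<integral>\<^sup>+u. ?Q (0 + 4 ^ M * u) \<partial>lborel)) =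
      ennreal (4 ^ N) * (\<integral>\<^sup>+u. ennreal (transform N t u ^ 2) * indicator {1<..4 ^ m} (4 ^ M * u) \<partial>lborel)"
  proof -
    have "ennreal (4 ^ n) * ennreal (4 ^ M) = ennreal (4 ^ N)"
      using N by (subst ennreal_mult[symmetric]) (auto simp: M_def simp flip: power_add)
    then show ?thesis by (simp add: mult.assoc[symmetric])
  qed
  also have "ennreal (4 ^ n) * (\<integral>\<^sup>+y. ?D y * indicator {0..1} y \<partial>lborel) \<le> ennreal (340 * 4 ^ i)"
  proof -
    have "integral {0..1} (\<lambda>y. transform n t y ^ 2) \<le> 34 / 16 ^ n * energy (corner t) n"
      by (rule transform_upper[OF t])
    also have "\<dots> \<le> 34 / 16 ^ n * (10 * 4 ^ i * 4 ^ n)" using E by (intro mult_left_mono) auto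
    finally have "4 ^ n * integral {0..1} (\<lambda>y. transform n t y ^ 2) \<le> 4 ^ n * (34 / 16 ^ n * (10 * 4 ^ i * 4 ^ n))"
      by (intro mult_left_mono) auto
    also have "\<dots> = 340 * 4 ^ i"
    proof -
      have "(16::real) ^ n = 4 ^ n * 4 ^ n" by (simp flip: power_mult_distrib)
      then show ?thesis by simp
    qed
    finally show ?thesis unfolding nn_integral_transform
      by (subst ennreal_mult'[symmetric]) (auto intro: ennreal_leI)
  qed
  finally show ?thesis unfolding M_def by (simp add: add_right_mono add.assoc)
qed

text \<open>The blocks with \<open>n = m r\<close> for \<open>r < R\<close> are disjoint, so the
full transform contributes to all of them together no more than its total mass, which the energy at
level \<open>m R\<close> bounds. For \<open>R\<close> as large as here this is negligible, and so is
the contribution of \<open>[0, 1]\<close> because \<open>4 ^ m\<close> exceeds \<open>4 ^ i\<close>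
by the factor \<open>4 ^ 6\<close>. What remains must be accounted for by
\<open>small_mass\<close>.\<close>

lemma small_mass_sum_ge:
  assumes t: "\<bar>t\<bar> \<le> 2" and m: "m = i + 6" and R: "R = 256 ^ m * 16 ^ b"
    and E: "\<And>n. n \<le> m * R \<Longrightarrow> energy (corner t) n \<le> 10 * 4 ^ i * 4 ^ n"
  shows "ennreal (real R * 4 ^ m / 4) \<le> (\<Sum>r<R. small_mass (m * r) m b t)"
proof -
  define N where "N = m * R"
  define A where "A = (\<lambda>r. {u::real. 4 ^ (N - m * r) * u \<in> {1<..4 ^ m}})"
  have below: "m * r + m \<le> N" if "r < R" for r
  proof -
    have "m * Suc r \<le> m * R" using that by (intro mult_left_mono) auto
    then show ?thesis by (simp add: N_def)
  qed
  have "u \<notin> A s" if "r < s" "s < R" "u \<in> A r" for r s u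
  proof
    assume u: "u \<in> A s"
    have "m * r + m \<le> m * s" using mult_le_mono2[of "Suc r" s m] that by simp
    then have "N - m * r = m + (N - m * s) + (m * s - (m * r + m))" using below[of s] that by linarith
    then have "(4::real) ^ (N - m * r) = 4 ^ m * 4 ^ (N - m * s) * 4 ^ (m * s - (m * r + m))"
      by (simp only: power_add)
    then have "4 ^ (N - m * r) * u = 4 ^ (m * s - (m * r + m)) * (4 ^ m * (4 ^ (N - m * s) * u))"
      by (simp only: mult_ac)
    moreover have "4 ^ m * 1 < (4::real) ^ m * (4 ^ (N - m * s) * u)"
      using u by (intro mult_strict_left_mono) (auto simp: A_def)
    moreover have "1 * (4 ^ m * (4 ^ (N - m * s) * u)) \<le> 4 ^ (m * s - (m * r + m)) * (4 ^ m * (4 ^ (N - m * s) * u))"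
      using u by (intro mult_right_mono) (auto simp: A_def)
    moreover have "4 ^ (N - m * r) * u \<le> 4 ^ m" using that by (simp add: A_def)
    ultimately show False by linarith
  qed
  then have disj: "disjoint_family_on A {..<R}"
    unfolding disjoint_family_on_def by (metis disjoint_iff lessThan_iff nat_neq_iff)
  have A01: "A r \<subseteq> {0..1}" if "r < R" for r
  proof
    fix u assume u: "u \<in> A r"
    then have "0 < 4 ^ (N - m * r) * u" by (simp add: A_def)
    then have "0 < u" by (simp add: zero_less_mult_iff)
    moreover have "u \<le> 1"
    proof (rule ccontr)
      assume "\<not> u \<le> 1"
      have "(4::real) ^ m \<le> 4 ^ (N - m * r)" using below[OF that] by (intro power_increasing) auto
      also have "\<dots> < 4 ^ (N - m * r) * u" using \<open>\<not> u \<le> 1\<close> by simp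
      finally show False using u by (simp add: A_def)
    qed
    ultimately show "u \<in> {0..1}" by simp
  qed
  have sumA: "(\<Sum>r<R. indicator {1<..4 ^ m} (4 ^ (N - m * r) * u)) \<le> (indicator {0..1} u :: ennreal)" for u :: real
  proof -
    have "(\<Sum>r<R. indicator {1<..4 ^ m} (4 ^ (N - m * r) * u)) = (\<Sum>r<R. indicator (A r) u :: ennreal)"
      by (intro sum.cong refl) (auto simp: A_def indicator_def)
    also have "\<dots> = indicator (\<Union>r<R. A r) u" by (rule indicator_UN_disjoint[symmetric, OF _ disj]) simp
    also have "\<dots> \<le> indicator {0..1} u"
    proof (rule indicator_leI)
      have "(\<Union>r<R. A r) \<subseteq> {0..1}" by (rule UN_least) (rule A01, simp)
      then show "u \<in> (\<Union>r<R. A r) \<Longrightarrow> u \<in> {0..1}" by (rule subsetD)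
    qed
    finally show ?thesis .
  qed
  let ?X = "\<lambda>r. \<integral>\<^sup>+u. ennreal (transform N t u ^ 2) * indicator {1<..4 ^ m} (4 ^ (N - m * r) * u) \<partial>lborel"
  have X: "ennreal (4 ^ N) * (\<Sum>r<R. ?X r) \<le> ennreal (340 * 4 ^ i)"
  proof -
    have "(\<Sum>r<R. ?X r) = (\<integral>\<^sup>+u. (\<Sum>r<R. ennreal (transform N t u ^ 2) * indicator {1<..4 ^ m} (4 ^ (N - m * r) * u)) \<partial>lborel)"
      by (intro nn_integral_sum[symmetric]) measurable
    also have "\<dots> \<le> (\<integral>\<^sup>+u. ennreal (transform N t u ^ 2) * indicator {0..1} u \<partial>lborel)"
      unfolding sum_distrib_left[symmetric] by (intro nn_integral_mono mult_left_mono sumA) auto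
    finally have "ennreal (4 ^ N) * (\<Sum>r<R. ?X r) \<le> ennreal (4 ^ N) * ennreal (integral {0..1} (\<lambda>y. transform N t y ^ 2))"
      unfolding nn_integral_transform by (intro mult_left_mono) auto
    also have "\<dots> \<le> ennreal (4 ^ N) * ennreal (34 / 16 ^ N * (10 * 4 ^ i * 4 ^ N))"
    proof (intro mult_left_mono ennreal_leI order_trans[OF transform_upper[OF t]])
      show "energy (corner t) N \<le> 10 * 4 ^ i * 4 ^ N" by (rule E) (simp add: N_def)
    qed auto
    also have "\<dots> = ennreal (340 * 4 ^ i)"
    proof -
      have "(16::real) ^ N = 4 ^ N * 4 ^ N" by (simp flip: power_mult_distrib)
      then show ?thesis by (simp add: ennreal_mult[symmetric])
    qed
    finally show ?thesis .
  qed
  define Z where "Z = (\<Sum>r<R. small_mass (m * r) m b t)"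
  have "of_nat R * ennreal (4 ^ m / 2) = (\<Sum>r<R. ennreal (4 ^ m / 2))" by simp
  also have "\<dots> \<le> (\<Sum>r<R. ennreal (340 * 4 ^ i) + small_mass (m * r) m b t +
      ennreal (256 ^ m * 16 ^ b) * (ennreal (4 ^ N) * ?X r))"
  proof (rule sum_mono)
    fix r assume "r \<in> {..<R}"
    then have "m * r \<le> N" using below[of r] by simp
    then show "ennreal (4 ^ m / 2) \<le> ennreal (340 * 4 ^ i) + small_mass (m * r) m b t +
      ennreal (256 ^ m * 16 ^ b) * (ennreal (4 ^ N) * ?X r)"
      by (intro block_inequality t E) (auto simp: N_def)
  qed
  also have "\<dots> = of_nat R * ennreal (340 * 4 ^ i) + Z + ennreal (256 ^ m * 16 ^ b) * (ennreal (4 ^ N) * (\<Sum>r<R. ?X r))"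
    unfolding Z_def by (simp add: sum.distrib sum_distrib_left)
  also have "\<dots> \<le> of_nat R * ennreal (340 * 4 ^ i) + Z + ennreal (256 ^ m * 16 ^ b) * ennreal (340 * 4 ^ i)"
    by (intro add_left_mono mult_left_mono X) auto
  also have "ennreal (256 ^ m * 16 ^ b) = of_nat R"
    by (simp add: R ennreal_of_nat_eq_real_of_nat flip: ennreal_power ennreal_numeral)
  finally have main: "of_nat R * ennreal (4 ^ m / 2) \<le> of_nat R * ennreal (340 * 4 ^ i) + Z + of_nat R * ennreal (340 * 4 ^ i)" .
  show ?thesis
  proof (cases Z)
    case (real z)
    have "ennreal (real R * (4 ^ m / 2)) \<le> ennreal (real R * (340 * 4 ^ i) + z + real R * (340 * 4 ^ i))"
      using main real by (simp add: ennreal_of_nat_eq_real_of_nat ennreal_mult[symmetric] flip: ennreal_plus)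
    then have "real R * (4 ^ m / 2) \<le> real R * (340 * 4 ^ i) + z + real R * (340 * 4 ^ i)"
      using real by (subst (asm) ennreal_le_iff) auto
    moreover have "real R * (680 * 4 ^ i) \<le> real R * (4 ^ m / 4)"
      by (intro mult_left_mono) (auto simp: m power_add)
    ultimately have "real R * 4 ^ m / 4 \<le> z" by simp
    then show ?thesis using real unfolding Z_def[symmetric] by (simp add: ennreal_leI)
  next
    case top
    then show ?thesis unfolding Z_def[symmetric] by simp
  qed
qed

text \<open>Apply the dichotomy for the levels \<open>K = 4 ^ i\<close> with \<open>1 \<le> i \<le>
I\<close>. Let \<open>i\<close> be the first level at which the inequality of
\<open>small_mass_sum_ge\<close> holds. The previous level, or the total length 4 if \<open>i =
1\<close>, bounds the shadow by \<open>52 / 4 ^ i\<close>, and the \<open>i\<close>-th summand is at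
least that large. The threshold \<open>4 ^ - b\<close> with \<open>b = 2 (I - i)\<close> makes the
slopes that are exceptional at level \<open>i\<close> as rare as the bound \<open>4 ^ - i\<close> on
their shadows permits, and then the number \<open>R\<close> of blocks is the same for all
\<open>i\<close>.\<close>

lemma shadow_len_pointwise:
  assumes t: "\<bar>t\<bar> \<le> 2" and I: "1 \<le> I" and M: "2304 * 7 * 4 ^ 24 * I ^ 2 * 4 ^ (5 * I) \<le> M"
  shows "ennreal (shadow_len (corner t) M) \<le> ennreal (13 / 4 ^ I) +
    (\<Sum>i=1..I. ennreal (52 / 4 ^ i * (4 / (4 ^ (4 * I + 24) * 4 ^ (i + 6)))) *
       (\<Sum>r<4 ^ (4 * I + 24). small_mass ((i + 6) * r) (i + 6) (2 * (I - i)) t))"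
proof -
  define R :: nat where "R = 4 ^ (4 * I + 24)"
  define Z where "Z = (\<lambda>i. \<Sum>r<R. small_mass ((i + 6) * r) (i + 6) (2 * (I - i)) t)"
  define B where "B = (\<lambda>i. ennreal (real R * 4 ^ (i + 6) / 4) \<le> Z i)"
  \<comment> \<open>\<open>B i\<close> is the conclusion of \<open>small_mass_sum_ge\<close>; where it fails, so does the bound on the energy.\<close>
  have alt: "shadow_len (corner t) M \<le> 13 / 4 ^ i" if i: "1 \<le> i" "i \<le> I" "\<not> B i" for i
  proof -
    have Ri: "R = 256 ^ (i + 6) * 16 ^ (2 * (I - i))"
    proof -
      have "(256::nat) ^ (i + 6) * 16 ^ (2 * (I - i)) = 4 ^ (4 * (i + 6)) * 4 ^ (2 * (2 * (I - i)))"
        by (simp only: power_mult) simp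
      also have "\<dots> = 4 ^ (4 * I + 24)"
        unfolding power_add[symmetric] using i(1,2) by (intro arg_cong[where f="\<lambda>k. 4 ^ k"]) arith
      finally show ?thesis by (simp add: R_def)
    qed
    have "i * 4 ^ i * ((i + 6) * R) \<le> I * 4 ^ I * ((7 * I) * R)"
      using i by (intro mult_mono power_increasing) auto
    also have "\<dots> = 7 * 4 ^ 24 * I ^ 2 * 4 ^ (5 * I)"
    proof -
      have "4 ^ I * R = 4 ^ 24 * 4 ^ (5 * I)"
        unfolding R_def power_add[symmetric] by (rule arg_cong[where f="\<lambda>k. 4 ^ k"]) simp
      then have "7 * I ^ 2 * (4 ^ I * R) = 7 * I ^ 2 * (4 ^ 24 * 4 ^ (5 * I))" by (simp only:)
      then show ?thesis by (simp only: power2_eq_square mult_ac)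
    qed
    finally have "2304 * i * 4 ^ i * ((i + 6) * R) \<le> M" using M by simp
    then have "shadow_len (corner t) M \<le> 13 / 4 ^ i \<or>
        (\<forall>n\<le>(i + 6) * R. energy (corner t) n \<le> 10 * 4 ^ i * 4 ^ n)"
      by (intro shadow_len_small_or_energy_small abs_corner_le t i(1))
    moreover have "B i" if "\<forall>n\<le>(i + 6) * R. energy (corner t) n \<le> 10 * 4 ^ i * 4 ^ n"
      unfolding B_def Z_def using that by (intro small_mass_sum_ge t Ri) auto
    ultimately show ?thesis using that(3) by blast
  qed
  let ?c = "\<lambda>i. ennreal (52 / 4 ^ i * (4 / (real R * 4 ^ (i + 6))))"
  have "ennreal (shadow_len (corner t) M) \<le> ennreal (13 / 4 ^ I) + (\<Sum>i=1..I. ?c i * Z i)"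
  proof (cases "B I")
    case False
    then have "shadow_len (corner t) M \<le> 13 / 4 ^ I" using alt[of I] I by simp
    then have "ennreal (shadow_len (corner t) M) \<le> ennreal (13 / 4 ^ I)" by (rule ennreal_leI)
    then show ?thesis by (rule add_increasing2[OF zero_le])
  next
    case True
    define i where "i = (LEAST i. 1 \<le> i \<and> B i)"
    have i: "1 \<le> i" "B i" using LeastI[of "\<lambda>i. 1 \<le> i \<and> B i" I] True I by (auto simp: i_def)
    have iI: "i \<le> I" unfolding i_def using True I by (intro Least_le) auto
    have "shadow_len (corner t) M \<le> 52 / 4 ^ i"
    proof (cases "i = 1")
      case True
      have "shadow_len (corner t) M \<le> shadow_len (corner t) 0" by (intro shadow_len_mono abs_corner_le t) auto
      then show ?thesis using True by (simp add: shadow_len_0)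
    next
      case False
      then obtain j where j: "i = Suc j" "1 \<le> j" using i by (cases i) auto
      have "\<not> (1 \<le> j \<and> B j)" unfolding i_def[symmetric] using not_less_Least[of j "\<lambda>i. 1 \<le> i \<and> B i"] j i_def by auto
      then have "\<not> B j" using j by blast
      then have "shadow_len (corner t) M \<le> 13 / 4 ^ j" using alt[of j] j iI by simp
      then show ?thesis by (simp add: j)
    qed
    then have "ennreal (shadow_len (corner t) M) \<le> ennreal (52 / 4 ^ i)" by (rule ennreal_leI)
    also have "\<dots> = ?c i * ennreal (real R * 4 ^ (i + 6) / 4)"
    proof -
      have "0 < real R" by (simp add: R_def)
      then have "52 / 4 ^ i = 52 / 4 ^ i * (4 / (real R * 4 ^ (i + 6))) * (real R * 4 ^ (i + 6) / 4)"
        by simp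
      then have "ennreal (52 / 4 ^ i) = ennreal (52 / 4 ^ i * (4 / (real R * 4 ^ (i + 6))) * (real R * 4 ^ (i + 6) / 4))"
        by (rule arg_cong)
      also have "\<dots> = ?c i * ennreal (real R * 4 ^ (i + 6) / 4)" by (rule ennreal_mult) auto
      finally show ?thesis .
    qed
    also have "\<dots> \<le> ?c i * Z i" using i(2) unfolding B_def by (intro mult_left_mono) auto
    also have "\<dots> \<le> (\<Sum>i=1..I. ?c i * Z i)" using i(1) iI by (intro member_le_sum) auto
    finally show ?thesis by (rule add_increasing[OF zero_le])
  qed
  then show ?thesis by (simp add: R_def Z_def)
qed

definition mean_shadow :: "nat \<Rightarrow> ennreal" where
  "mean_shadow l = (\<integral>\<^sup>+t. ennreal (shadow_len (corner t) l) * indicator {- 2..2} t \<partial>lborel)"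

text \<open>Each of the \<open>I\<close> levels contributes \<open>O(I / 4 ^ I)\<close> by
\<open>small_mass_average\<close>, since \<open>4 ^ i * 2 ^ b = 4 ^ I\<close>.\<close>

lemma shadow_len_average:
  assumes I: "1 \<le> I" and M: "2304 * 7 * 4 ^ 24 * I ^ 2 * 4 ^ (5 * I) \<le> M"
  shows "mean_shadow M \<le> ennreal (10 ^ 7 * real I ^ 2 / 4 ^ I)"
proof -
  define R :: nat where "R = 4 ^ (4 * I + 24)"
  have R0: "0 < real R" by (simp add: R_def)
  let ?c = "\<lambda>i. ennreal (52 / 4 ^ i * (4 / (real R * 4 ^ (i + 6))))"
  let ?Z = "\<lambda>i t. \<Sum>r<R. small_mass ((i + 6) * r) (i + 6) (2 * (I - i)) t"
  have "mean_shadow M \<le>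
     (\<integral>\<^sup>+t. ennreal (13 / 4 ^ I) * indicator {- 2..2} t + (\<Sum>i=1..I. ?c i * (\<Sum>r<R. small_mass ((i + 6) * r) (i + 6) (2 * (I - i)) t * indicator {- 2..2} t)) \<partial>lborel)"
    unfolding mean_shadow_def
  proof (intro nn_integral_mono)
    fix t :: real
    show "ennreal (shadow_len (corner t) M) * indicator {- 2..2} t \<le>
      ennreal (13 / 4 ^ I) * indicator {- 2..2} t + (\<Sum>i=1..I. ?c i * (\<Sum>r<R. small_mass ((i + 6) * r) (i + 6) (2 * (I - i)) t * indicator {- 2..2} t))"
    proof (cases "t \<in> {- 2..2}")
      case True
      then have "\<bar>t\<bar> \<le> 2" by auto
      from shadow_len_pointwise[OF this I M] show ?thesis using True by (simp add: R_def)
    qed simp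
  qed
  also have "\<dots> = (\<integral>\<^sup>+t. ennreal (13 / 4 ^ I) * indicator {- 2..2::real} t \<partial>lborel) +
     (\<Sum>i=1..I. ?c i * (\<Sum>r<R. \<integral>\<^sup>+t. small_mass ((i + 6) * r) (i + 6) (2 * (I - i)) t * indicator {- 2..2} t \<partial>lborel))"
  proof -
    let ?s = "\<lambda>i r t. small_mass ((i + 6) * r) (i + 6) (2 * (I - i)) t * indicator {- 2..2} t"
    have "(\<integral>\<^sup>+t. (\<Sum>i=1..I. ?c i * (\<Sum>r<R. ?s i r t)) \<partial>lborel) = (\<Sum>i=1..I. \<integral>\<^sup>+t. ?c i * (\<Sum>r<R. ?s i r t) \<partial>lborel)"
      by (rule nn_integral_sum) measurable
    also have "\<dots> = (\<Sum>i=1..I. ?c i * (\<integral>\<^sup>+t. (\<Sum>r<R. ?s i r t) \<partial>lborel))"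
      by (rule sum.cong[OF refl], rule nn_integral_cmult) measurable
    also have "\<dots> = (\<Sum>i=1..I. ?c i * (\<Sum>r<R. \<integral>\<^sup>+t. ?s i r t \<partial>lborel))"
    proof (rule sum.cong[OF refl])
      fix i
      have "(\<integral>\<^sup>+t. (\<Sum>r<R. ?s i r t) \<partial>lborel) = (\<Sum>r<R. \<integral>\<^sup>+t. ?s i r t \<partial>lborel)"
        by (rule nn_integral_sum) measurable
      then show "?c i * (\<integral>\<^sup>+t. (\<Sum>r<R. ?s i r t) \<partial>lborel) = ?c i * (\<Sum>r<R. \<integral>\<^sup>+t. ?s i r t \<partial>lborel)"
        by (simp only:)
    qed
    finally have e: "(\<integral>\<^sup>+t. (\<Sum>i=1..I. ?c i * (\<Sum>r<R. ?s i r t)) \<partial>lborel) = (\<Sum>i=1..I. ?c i * (\<Sum>r<R. \<integral>\<^sup>+t. ?s i r t \<partial>lborel))" .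
    show ?thesis unfolding e[symmetric] by (rule nn_integral_add) measurable
  qed
  also have "(\<integral>\<^sup>+t. ennreal (13 / 4 ^ I) * indicator {- 2..2::real} t \<partial>lborel) = ennreal (52 / 4 ^ I)"
    by (subst nn_integral_cmult_indicator) (auto simp: ennreal_mult[symmetric] simp flip: ennreal_numeral)
  also have "(\<Sum>i=1..I. ?c i * (\<Sum>r<R. \<integral>\<^sup>+t. small_mass ((i + 6) * r) (i + 6) (2 * (I - i)) t * indicator {- 2..2} t \<partial>lborel)) \<le>
     (\<Sum>i=1..I. ennreal (2875392 * (3 * real I) / 4 ^ I))"
  proof (rule sum_mono)
    fix i assume i: "i \<in> {1..I}"
    define b where "b = 2 * (I - i)"
    have "?c i * (\<Sum>r<R. \<integral>\<^sup>+t. small_mass ((i + 6) * r) (i + 6) b t * indicator {- 2..2} t \<partial>lborel) \<le>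
        ?c i * (\<Sum>r<R. ennreal (13824 * 4 ^ (i + 6) * (real b + 1) / 2 ^ b))"
      by (intro mult_left_mono sum_mono small_mass_average) auto
    also have "\<dots> = ennreal (52 / 4 ^ i * (4 / (real R * 4 ^ (i + 6))) * (real R * (13824 * 4 ^ (i + 6) * (real b + 1) / 2 ^ b)))"
      by (simp add: ennreal_of_nat_eq_real_of_nat ennreal_mult[symmetric] del: power_add)
    also have "52 / 4 ^ i * (4 / (real R * 4 ^ (i + 6))) * (real R * (13824 * 4 ^ (i + 6) * (real b + 1) / 2 ^ b)) =
       2875392 * (real b + 1) / (4 ^ i * 2 ^ b)" using R0 by simp
    also have "(4::real) ^ i * 2 ^ b = 4 ^ I"
    proof -
      have "(2::real) ^ b = 4 ^ (I - i)" unfolding b_def power_mult by simp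
      then show ?thesis using i by (simp flip: power_add)
    qed
    also have "ennreal (2875392 * (real b + 1) / 4 ^ I) \<le> ennreal (2875392 * (3 * real I) / 4 ^ I)"
      using i by (intro ennreal_leI divide_right_mono mult_left_mono) (auto simp: b_def of_nat_diff)
    finally show "?c i * (\<Sum>r<R. \<integral>\<^sup>+t. small_mass ((i + 6) * r) (i + 6) (2 * (I - i)) t * indicator {- 2..2} t \<partial>lborel) \<le>
       ennreal (2875392 * (3 * real I) / 4 ^ I)" by (simp add: b_def)
  qed
  also have "ennreal (52 / 4 ^ I) + (\<Sum>i=1..I. ennreal (2875392 * (3 * real I) / 4 ^ I)) =
      ennreal (52 / 4 ^ I + real I * (2875392 * (3 * real I) / 4 ^ I))"
    by (simp add: ennreal_of_nat_eq_real_of_nat ennreal_mult[symmetric] flip: ennreal_plus)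
  also have "\<dots> \<le> ennreal (10 ^ 7 * real I ^ 2 / 4 ^ I)"
  proof (rule ennreal_leI)
    have "1 \<le> real I ^ 2" using I by simp
    then have "(52 + 8626176 * real I ^ 2) / 4 ^ I \<le> (10 ^ 7 * real I ^ 2) / 4 ^ I"
      by (intro divide_right_mono) auto
    then show "52 / 4 ^ I + real I * (2875392 * (3 * real I) / 4 ^ I) \<le> 10 ^ 7 * real I ^ 2 / 4 ^ I"
      by (simp add: power2_eq_square add_divide_distrib)
  qed
  finally show ?thesis by (simp add: add_left_mono)
qed

section \<open>Strips around a curved arc\<close>

text \<open>With these digits \<open>pos\<close> gives the coordinates of the lower left corner of a
square of the four-corner set.\<close>

definition step_x :: "digit \<Rightarrow> real" where "step_x x = (if fst x then 3 else 0)"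
definition step_y :: "digit \<Rightarrow> real" where "step_y x = (if snd x then 3 else 0)"

lemma pos_map_upt:
  "pos d (map f [1..<Suc n]) / 4 ^ n = (\<Sum>j=1..n. d (f j) / 4 ^ j)"
proof (induction n)
  case (Suc n)
  have "pos d (map f [1..<Suc (Suc n)]) = 4 * pos d (map f [1..<Suc n]) + d (f (Suc n))"
    by (simp add: pos_append)
  then have "pos d (map f [1..<Suc (Suc n)]) / 4 ^ Suc n = pos d (map f [1..<Suc n]) / 4 ^ n + d (f (Suc n)) / 4 ^ Suc n"
    by (simp add: add_divide_distrib)
  then show ?case unfolding Suc.IH by simp
qed simp

lemma four_corner_gen_word:
  assumes "p \<in> four_corner_gen n"
  shows "\<exists>w x y. length w = n \<and> 0 \<le> x \<and> x \<le> 1 \<and> 0 \<le> y \<and> y \<le> 1 \<and>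
    p = ((pos step_x w + x) / 4 ^ n, (pos step_y w + y) / 4 ^ n)"
proof -
  have "fst p \<in> cantor_gen n" "snd p \<in> cantor_gen n" using assms by (auto simp: four_corner_gen_def)
  then obtain a b where a: "a \<in> {1..n} \<rightarrow> {0, 3::real}" "fst p \<in> {(\<Sum>j=1..n. a j / 4 ^ j)..(\<Sum>j=1..n. a j / 4 ^ j) + 1 / 4 ^ n}"
    and b: "b \<in> {1..n} \<rightarrow> {0, 3::real}" "snd p \<in> {(\<Sum>j=1..n. b j / 4 ^ j)..(\<Sum>j=1..n. b j / 4 ^ j) + 1 / 4 ^ n}"
    unfolding cantor_gen_def by blast
  define f where "f = (\<lambda>j. (a j = 3, b j = 3))"
  define w where "w = map f [1..<Suc n]"
  have "pos step_x w / 4 ^ n = (\<Sum>j=1..n. a j / 4 ^ j)"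
    unfolding w_def pos_map_upt using a(1) by (intro sum.cong refl) (auto simp: step_x_def f_def Pi_iff)
  moreover have "pos step_y w / 4 ^ n = (\<Sum>j=1..n. b j / 4 ^ j)"
    unfolding w_def pos_map_upt using b(1) by (intro sum.cong refl) (auto simp: step_y_def f_def Pi_iff)
  ultimately have ab: "pos step_x w / 4 ^ n \<le> fst p" "fst p \<le> pos step_x w / 4 ^ n + 1 / 4 ^ n"
     "pos step_y w / 4 ^ n \<le> snd p" "snd p \<le> pos step_y w / 4 ^ n + 1 / 4 ^ n"
    using a(2) b(2) by auto
  define x y where "x = fst p * 4 ^ n - pos step_x w" and "y = snd p * 4 ^ n - pos step_y w"
  have "0 \<le> x" "x \<le> 1" "0 \<le> y" "y \<le> 1"
    using ab by (simp_all add: x_def y_def field_simps)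
  moreover have "p = ((pos step_x w + x) / 4 ^ n, (pos step_y w + y) / 4 ^ n)"
    by (simp add: x_def y_def)
  moreover have "length w = n" by (simp add: w_def)
  ultimately show ?thesis by blast
qed

text \<open>A digit 0 or 3 is \<open>3 / 2\<close> plus or minus \<open>3 / 2\<close>; the constant
parts sum to a geometric series.\<close>

lemma pos_shear:
  "pos step_y w - t * pos step_x w = 9 / 2 * pos (corner t) w + (1 - t) * (4 ^ length w - 1) / 2"
proof (induction w)
  case (Cons x w)
  have "step_y x - t * step_x x = 9 / 2 * corner t x + (1 - t) * (3 / 2)"
    by (auto simp: step_x_def step_y_def corner_def field_simps)
  then have e: "4 ^ length w * (step_y x - t * step_x x) = 4 ^ length w * (9 / 2 * corner t x + (1 - t) * (3 / 2))"
    by simp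
  have "pos step_y (x # w) - t * pos step_x (x # w) =
      4 ^ length w * (step_y x - t * step_x x) + (pos step_y w - t * pos step_x w)"
    by (simp add: algebra_simps)
  also have "\<dots> = 9 / 2 * pos (corner t) (x # w) + (1 - t) * (4 ^ length (x # w) - 1) / 2"
    unfolding e Cons.IH by (simp add: field_simps)
  finally show ?case .
qed simp

lemma pos_corner_lipschitz:
  "\<bar>pos (corner t) w - pos (corner t') w\<bar> \<le> \<bar>t - t'\<bar> * 4 ^ length w / 9"
proof (induction w)
  case (Cons x w)
  have e: "corner t x - corner t' x = (if fst x then - 1 else 1) * ((t - t') / 3)"
    by (auto simp: corner_def field_simps)
  have "\<bar>corner t x - corner t' x\<bar> = \<bar>t - t'\<bar> / 3" unfolding e by (simp add: abs_mult)
  then have 1: "\<bar>4 ^ length w * (corner t x - corner t' x)\<bar> = 4 ^ length w * (\<bar>t - t'\<bar> / 3)"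
    by (simp add: abs_mult)
  have "pos (corner t) (x # w) - pos (corner t') (x # w) =
     4 ^ length w * (corner t x - corner t' x) + (pos (corner t) w - pos (corner t') w)"
    by (simp add: algebra_simps)
  then have "\<bar>pos (corner t) (x # w) - pos (corner t') (x # w)\<bar> \<le>
     4 ^ length w * (\<bar>t - t'\<bar> / 3) + \<bar>t - t'\<bar> * 4 ^ length w / 9"
    using 1 Cons by linarith
  also have "\<dots> = \<bar>t - t'\<bar> * 4 ^ length (x # w) / 9" by simp
  finally show ?case .
qed simp

text \<open>Here \<open>q0\<close> is a point of the curve with tangent slope \<open>\<tau>\<close>,
and \<open>q\<close> is a nearby point of the curve. After splitting off the square \<open>u\<close>
of level \<open>m\<close> that contains \<open>p\<close>, the point \<open>p - q\<close> is
determined in the direction across the tangent, at scale \<open>4 ^ - m\<close>, by the position of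
\<open>p\<close> inside \<open>u\<close>. All errors are within the radius of the shadow: the size
of the smallest squares, the deviation of the curve from its tangent and the change of the slope
from \<open>\<tau>\<close> to \<open>t\<close>.\<close>

lemma strip_membership:
  assumes lm: "l \<le> m" and tau: "\<bar>\<tau>\<bar> \<le> 4 / 3" and t: "\<bar>t - \<tau>\<bar> \<le> 1 / 4 ^ m"
    and p: "p \<in> four_corner_gen (m + l)"
    and q: "\<bar>fst q - fst q0\<bar> \<le> 1 / 4 ^ m" "\<bar>(snd q - snd q0) - \<tau> * (fst q - fst q0)\<bar> \<le> 3 / 16 ^ m"
  shows "\<exists>u\<in>words m. \<bar>fst (p - q) - (pos step_x u / 4 ^ m - fst q0)\<bar> \<le> 2 / 4 ^ m \<and>
    (2 / 9 * 4 ^ m) * (snd (p - q) - \<tau> * fst (p - q)) -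
      ((2 / 9 * 4 ^ m) * ((pos step_y u / 4 ^ m - snd q0) - \<tau> * (pos step_x u / 4 ^ m - fst q0)) +
        (1 - \<tau>) * (4 ^ l - 1) / (9 * 4 ^ l)) \<in> shadow (corner t) l"
proof -
  obtain w x y where w: "length w = m + l" and xy: "0 \<le> x" "x \<le> 1" "0 \<le> y" "y \<le> 1"
    and pw: "p = ((pos step_x w + x) / 4 ^ (m + l), (pos step_y w + y) / 4 ^ (m + l))"
    using four_corner_gen_word[OF p] by blast
  define u v where "u = take m w" and "v = drop m w"
  have uv: "w = u @ v" "length u = m" "length v = l" using w by (auto simp: u_def v_def)
  define \<xi> \<zeta> where "\<xi> = (pos step_x v + x) / 4 ^ l" and "\<zeta> = (pos step_y v + y) / 4 ^ l"
  have fp: "fst p = pos step_x u / 4 ^ m + \<xi> / 4 ^ m" "snd p = pos step_y u / 4 ^ m + \<zeta> / 4 ^ m"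
    by (simp_all add: pw \<xi>_def uv pos_append add_divide_distrib power_add \<zeta>_def mult.commute)
  have bound: "0 \<le> pos step_x v \<and> pos step_x v \<le> 4 ^ length v - 1"
    by (induction v) (auto simp: step_x_def)
  have xi: "\<bar>\<xi>\<bar> \<le> 1"
    using bound xy uv by (auto simp: \<xi>_def divide_le_eq abs_le_iff)
  have near: "\<bar>fst (p - q) - (pos step_x u / 4 ^ m - fst q0)\<bar> \<le> 2 / 4 ^ m"
  proof -
    have "\<bar>\<xi> / 4 ^ m\<bar> \<le> 1 / 4 ^ m" using xi by (simp add: abs_divide divide_right_mono)
    moreover have "fst (p - q) - (pos step_x u / 4 ^ m - fst q0) = \<xi> / 4 ^ m - (fst q - fst q0)"
      by (simp add: fp)
    moreover have "1 / 4 ^ m + 1 / 4 ^ m = 2 / (4::real) ^ m" by simp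
    ultimately show ?thesis using q(1) by linarith
  qed
  let ?Z = "(2 / 9 * 4 ^ m) * (snd (p - q) - \<tau> * fst (p - q)) -
      ((2 / 9 * 4 ^ m) * ((pos step_y u / 4 ^ m - snd q0) - \<tau> * (pos step_x u / 4 ^ m - fst q0)) +
        (1 - \<tau>) * (4 ^ l - 1) / (9 * 4 ^ l))"
  define \<delta> where "\<delta> = (snd q - snd q0) - \<tau> * (fst q - fst q0)"
  have "?Z = 2 / 9 * (\<zeta> - \<tau> * \<xi>) - (2 / 9 * 4 ^ m) * \<delta> - (1 - \<tau>) * (4 ^ l - 1) / (9 * 4 ^ l)"
  proof -
    have "snd (p - q) - \<tau> * fst (p - q) - ((pos step_y u / 4 ^ m - snd q0) - \<tau> * (pos step_x u / 4 ^ m - fst q0)) =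
      (\<zeta> - \<tau> * \<xi>) / 4 ^ m - \<delta>"
      by (simp add: fp \<delta>_def algebra_simps diff_divide_distrib)
    then have "(2 / 9 * 4 ^ m) * (snd (p - q) - \<tau> * fst (p - q) - ((pos step_y u / 4 ^ m - snd q0) - \<tau> * (pos step_x u / 4 ^ m - fst q0))) =
      (2 / 9 * 4 ^ m) * ((\<zeta> - \<tau> * \<xi>) / 4 ^ m - \<delta>)" by (simp only:)
    also have "\<dots> = 2 / 9 * (\<zeta> - \<tau> * \<xi>) - (2 / 9 * 4 ^ m) * \<delta>"
    proof -
      have "(2 / 9 * c) * (A / c - \<delta>) = 2 / 9 * A - (2 / 9 * c) * \<delta>" if "c \<noteq> 0" for A c :: real
        using that by (simp add: field_simps)
      then show ?thesis by simp
    qed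
    finally show ?thesis by (simp add: right_diff_distrib)
  qed
  moreover have "2 / 9 * (\<zeta> - \<tau> * \<xi>) = pos (corner \<tau>) v / 4 ^ l + (1 - \<tau>) * (4 ^ l - 1) / (9 * 4 ^ l) + 2 / 9 * (y - \<tau> * x) / 4 ^ l"
  proof -
    have "(\<zeta> - \<tau> * \<xi>) = ((pos step_y v - \<tau> * pos step_x v) + (y - \<tau> * x)) / 4 ^ l"
      by (simp add: \<zeta>_def \<xi>_def field_simps)
    also have "\<dots> = (9 / 2 * pos (corner \<tau>) v + (1 - \<tau>) * (4 ^ l - 1) / 2 + (y - \<tau> * x)) / 4 ^ l"
      unfolding pos_shear uv(3) ..
    finally have e: "\<zeta> - \<tau> * \<xi> = (9 / 2 * pos (corner \<tau>) v + (1 - \<tau>) * (4 ^ l - 1) / 2 + (y - \<tau> * x)) / 4 ^ l" .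
    have *: "2 / 9 * ((9 / 2 * P + Q / 2 + R) / c) = P / c + Q / (9 * c) + 2 / 9 * R / c" if "c \<noteq> 0" for P Q R c :: real
      using that by (simp add: field_simps)
    show ?thesis unfolding e by (rule *) simp
  qed
  ultimately have Z: "?Z = pos (corner \<tau>) v / 4 ^ l + 2 / 9 * (y - \<tau> * x) / 4 ^ l - (2 / 9 * 4 ^ m) * \<delta>"
    by linarith
  \<comment> \<open>The errors from the smallest squares, the curvature and the slope; their sum is less than the radius \<open>2 / 4 ^ l\<close>.\<close>
  have a1: "\<bar>2 / 9 * (y - \<tau> * x) / 4 ^ l\<bar> \<le> (14 / 27) / 4 ^ l"
  proof -
    have "\<bar>\<tau> * x\<bar> \<le> 4 / 3 * 1" unfolding abs_mult using tau xy by (intro mult_mono) auto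
    then have "\<bar>y - \<tau> * x\<bar> \<le> 7 / 3" using xy by linarith
    then have "\<bar>2 / 9 * (y - \<tau> * x)\<bar> \<le> 14 / 27" unfolding abs_mult by simp
    then show ?thesis by (simp only: abs_divide power_abs abs_numeral) (rule divide_right_mono, auto)
  qed
  have a2: "\<bar>(2 / 9 * 4 ^ m) * \<delta>\<bar> \<le> (2 / 3) / 4 ^ l"
  proof -
    have "\<bar>(2 / 9 * 4 ^ m) * \<delta>\<bar> = 2 / 9 * 4 ^ m * \<bar>\<delta>\<bar>" by (simp add: abs_mult)
    also have "\<dots> \<le> 2 / 9 * 4 ^ m * (3 / 16 ^ m)" using q(2) unfolding \<delta>_def by (intro mult_left_mono) auto
    also have "\<dots> = (2 / 3) / 4 ^ m"
    proof -
      have "(16::real) ^ m = 4 ^ m * 4 ^ m" by (simp flip: power_mult_distrib)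
      then show ?thesis by simp
    qed
    also have "\<dots> \<le> (2 / 3) / 4 ^ l" using lm by (intro divide_left_mono power_increasing) auto
    finally show ?thesis .
  qed
  have a3: "\<bar>pos (corner t) v / 4 ^ l - pos (corner \<tau>) v / 4 ^ l\<bar> \<le> (1 / 9) / 4 ^ l"
  proof -
    have "\<bar>pos (corner t) v - pos (corner \<tau>) v\<bar> \<le> \<bar>t - \<tau>\<bar> * 4 ^ l / 9"
      using pos_corner_lipschitz[of t v \<tau>] uv by simp
    then have "\<bar>pos (corner t) v - pos (corner \<tau>) v\<bar> / 4 ^ l \<le> (\<bar>t - \<tau>\<bar> * 4 ^ l / 9) / 4 ^ l"
      by (rule divide_right_mono) simp
    also have "\<dots> = \<bar>t - \<tau>\<bar> / 9" by simp
    also have "\<dots> \<le> (1 / 4 ^ l) / 9"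
    proof -
      have "1 / (4::real) ^ m \<le> 1 / 4 ^ l" using lm by (intro divide_left_mono power_increasing) auto
      then show ?thesis using t by simp
    qed
    finally show ?thesis by (simp add: abs_divide flip: diff_divide_distrib)
  qed
  have "\<bar>pos (corner t) v / 4 ^ l - ?Z\<bar> \<le> (1 / 9) / 4 ^ l + (14 / 27) / 4 ^ l + (2 / 3) / 4 ^ l"
    unfolding Z using a1 a2 a3 by linarith
  also have "\<dots> = (35 / 27) / 4 ^ l" by simp
  also have "\<dots> \<le> 2 / 4 ^ l" by (rule divide_right_mono) auto
  finally have "?Z \<in> shadow (corner t) l"
    unfolding shadow_def using uv by (intro UN_I[of v]) (auto simp: dist_real_def)
  with near show ?thesis using uv by (intro bexI[of _ u]) auto
qed

definition strip :: "real \<Rightarrow> real \<Rightarrow> real \<Rightarrow> real \<Rightarrow> real \<Rightarrow> real set \<Rightarrow> (real \<times> real) set" where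
  "strip a r c \<tau> e A = {z. \<bar>fst z - a\<bar> \<le> r \<and> c * (snd z - \<tau> * fst z) - e \<in> A}"

lemma closed_strip: "closed A \<Longrightarrow> closed (strip a r c \<tau> e A)"
  unfolding strip_def
  by (intro closed_Collect_conj closed_Collect_le continuous_intros
      closed_vimage[of A "\<lambda>z. c * (snd z - \<tau> * fst z) - e", unfolded vimage_def])

lemma emeasure_strip:
  assumes A: "compact A" and c: "0 < c" and r: "0 \<le> r"
  shows "emeasure lborel (strip a r c \<tau> e A) = ennreal (2 * r * measure lebesgue A / c)"
proof -
  have A': "A \<in> sets borel" using A by (simp add: borel_compact)
  have S: "strip a r c \<tau> e A \<in> sets (lborel \<Otimes>\<^sub>M lborel)"
    unfolding lborel_prod using closed_strip[OF compact_imp_closed[OF A], of a r c \<tau> e] by simp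
  have fin: "emeasure lborel A = ennreal (measure lebesgue A)"
  proof -
    have "emeasure lebesgue A = ennreal (measure lebesgue A)"
      using lmeasurable_compact[OF A] by (simp add: emeasure_eq_measure2 fmeasurableD2 emeasure_eq_ennreal_measure)
    moreover have "emeasure lebesgue A = emeasure lborel A" using A' by (simp add: emeasure_completion)
    ultimately show ?thesis by simp
  qed
  have slice: "emeasure lborel (Pair x -` strip a r c \<tau> e A) = ennreal (measure lebesgue A / c) * indicator {a - r..a + r} x" for x
  proof (cases "x \<in> {a - r..a + r}")
    case True
    then have e: "Pair x -` strip a r c \<tau> e A = {y. (- c * \<tau> * x - e) + c * y \<in> A}"
      by (auto simp: strip_def algebra_simps abs_le_iff)
    have m: "{y. (- c * \<tau> * x - e) + c * y \<in> A} \<in> sets lborel"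
      using A' by measurable
    have "emeasure lborel A = (\<integral>\<^sup>+y. indicator A y \<partial>lborel)" using A' by simp
    also have "\<dots> = \<bar>c\<bar> * (\<integral>\<^sup>+y. indicator A ((- c * \<tau> * x - e) + c * y) \<partial>lborel)"
      using A' c by (intro nn_integral_real_affine) auto
    also have "(\<integral>\<^sup>+y. indicator A ((- c * \<tau> * x - e) + c * y) \<partial>lborel) =
        (\<integral>\<^sup>+y. indicator {y. (- c * \<tau> * x - e) + c * y \<in> A} y \<partial>lborel)"
      by (intro nn_integral_cong) (auto simp: indicator_def)
    also have "\<dots> = emeasure lborel {y. (- c * \<tau> * x - e) + c * y \<in> A}"
      using m by (rule nn_integral_indicator)
    finally have "ennreal c * emeasure lborel {y. (- c * \<tau> * x - e) + c * y \<in> A} = ennreal c * ennreal (measure lebesgue A / c)"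
      using c fin by (simp add: ennreal_mult[symmetric])
    then have "emeasure lborel {y. (- c * \<tau> * x - e) + c * y \<in> A} = ennreal (measure lebesgue A / c)"
      using c by (subst (asm) ennreal_mult_cancel_left) auto
    then show ?thesis unfolding e using True by simp
  next
    case False
    then have "Pair x -` strip a r c \<tau> e A = {}" by (auto simp: strip_def abs_le_iff)
    then show ?thesis using False by simp
  qed
  have "emeasure lborel (strip a r c \<tau> e A) = emeasure (lborel \<Otimes>\<^sub>M lborel) (strip a r c \<tau> e A)"
    by (simp add: lborel_prod)
  also have "\<dots> = (\<integral>\<^sup>+x. emeasure lborel (Pair x -` strip a r c \<tau> e A) \<partial>lborel)"
    by (rule lborel.emeasure_pair_measure_alt[OF S])
  also have "\<dots> = (\<integral>\<^sup>+x. ennreal (measure lebesgue A / c) * indicator {a - r..a + r} x \<partial>lborel)"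
    unfolding slice ..
  also have "\<dots> = ennreal (measure lebesgue A / c) * ennreal (2 * r)"
    using r by (subst nn_integral_cmult_indicator) auto
  also have "\<dots> = ennreal (2 * r * measure lebesgue A / c)"
    using c r by (subst ennreal_mult[symmetric]) auto
  finally show ?thesis .
qed

text \<open>Unit vectors with positive first coordinate are the radial projections of the points
\<open>(1, slope)\<close> to the unit circle, and this projection is a contraction outside the unit
disc. In the proof \<open>p\<close> and \<open>q\<close> are the cosine and the sine of the angle
between \<open>u\<close> and \<open>v\<close>.\<close>

lemma norm_diff_le_slope_diff:
  fixes u v :: "real \<times> real"
  assumes u: "norm u = 1" "0 < fst u" and v: "norm v = 1" "0 < fst v"
  shows "norm (u - v) \<le> \<bar>snd u / fst u - snd v / fst v\<bar>"
proof -
  obtain c d c' d' where uv: "u = (c, d)" "v = (c', d')" by (metis prod.exhaust)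
  have n: "c\<^sup>2 + d\<^sup>2 = 1" "c'\<^sup>2 + d'\<^sup>2 = 1"
    using u v by (simp_all add: uv norm_prod_def)
  have pos: "0 < c" "0 < c'" using u v by (simp_all add: uv)
  define p q where "p = c * c' + d * d'" and "q = d * c' - d' * c"
  have pq: "p\<^sup>2 + q\<^sup>2 = 1"
  proof -
    have "p\<^sup>2 + q\<^sup>2 = (c\<^sup>2 + d\<^sup>2) * (c'\<^sup>2 + d'\<^sup>2)" unfolding p_def q_def by algebra
    then show ?thesis by (simp add: n)
  qed
  \<comment> \<open>The left side is the cosine of the sum of the two angles.\<close>
  have "c * c' - d * d' \<le> 1"
    using sum_squares_bound[of c c'] sum_squares_bound[of d "- d'"] n by simp
  then have "2 * (c * c') \<le> 1 + p" unfolding p_def by linarith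
  then have ccp: "c * c' \<le> (1 + p) / 2" by simp
  have p1: "p \<le> 1" using sum_squares_bound[of c c'] sum_squares_bound[of d d'] n by (simp add: p_def)
  have cc0: "0 < c * c'" using pos by simp
  have nsq: "(norm (u - v))\<^sup>2 = 2 - 2 * p"
  proof -
    have "(norm (u - v))\<^sup>2 = (c - c')\<^sup>2 + (d - d')\<^sup>2" by (simp add: uv norm_prod_def)
    also have "\<dots> = (c\<^sup>2 + d\<^sup>2) + (c'\<^sup>2 + d'\<^sup>2) - 2 * p" unfolding p_def by algebra
    finally show ?thesis by (simp add: n)
  qed
  have "(2 - 2 * p) * (c * c')\<^sup>2 \<le> (2 - 2 * p) * ((1 + p) / 2)\<^sup>2"
    using ccp cc0 p1 by (intro mult_left_mono power_mono) auto
  also have "\<dots> = (1 - p) * (1 + p) * ((1 + p) / 2)" by (simp add: power2_eq_square field_simps)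
  also have "\<dots> \<le> (1 - p) * (1 + p) * 1"
    using p1 ccp cc0 by (intro mult_left_mono mult_nonneg_nonneg) auto
  also have "\<dots> = q\<^sup>2" using pq by (simp add: power2_eq_square algebra_simps)
  finally have "(norm (u - v) * (c * c'))\<^sup>2 \<le> q\<^sup>2" unfolding power_mult_distrib nsq .
  then have "norm (u - v) * (c * c') \<le> \<bar>q\<bar>" using cc0 by (metis abs_le_square_iff abs_of_nonneg mult_nonneg_nonneg norm_ge_zero less_imp_le)
  then have "norm (u - v) \<le> \<bar>q\<bar> / (c * c')" using cc0 by (simp add: pos_le_divide_eq)
  also have "\<dots> = \<bar>q / (c * c')\<bar>" using cc0 by simp
  also have "q / (c * c') = snd u / fst u - snd v / fst v"
    using pos by (simp add: uv q_def field_simps)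
  finally show ?thesis .
qed

text \<open>The shadow of slope \<open>t\<close> is the section at \<open>t\<close> of a closed
subset of the plane.\<close>

lemma shadow_len_measurable [measurable]: "(\<lambda>t. shadow_len (corner t) l) \<in> borel_measurable borel"
proof -
  have cont: "continuous_on UNIV (\<lambda>z. pos (corner (fst z)) w)" for w :: "digit list"
  proof (induction w)
    case (Cons x w)
    then show ?case unfolding pos.simps corner_def by (intro continuous_intros) auto
  qed simp
  define Q where "Q = (\<Union>w\<in>words l. {z::real \<times> real. \<bar>pos (corner (fst z)) w / 4 ^ l - snd z\<bar> \<le> 2 / 4 ^ l})"
  have "closed Q" unfolding Q_def
    by (intro closed_UN finite_words ballI closed_Collect_le continuous_intros cont) auto
  then have "Q \<in> sets (lborel \<Otimes>\<^sub>M lborel)" unfolding lborel_prod by simp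
  then have "(\<lambda>t. emeasure lborel (Pair t -` Q)) \<in> borel_measurable lborel"
    by (rule lborel.measurable_emeasure_Pair)
  moreover have "shadow_len (corner t) l = enn2real (emeasure lborel (Pair t -` Q))" for t
  proof -
    have e: "Pair t -` Q = shadow (corner t) l" by (auto simp: Q_def shadow_def dist_real_def)
    have "shadow (corner t) l \<in> sets borel" by (intro borel_compact compact_shadow)
    then show ?thesis unfolding e shadow_len_def measure_def by (simp add: emeasure_completion)
  qed
  ultimately show ?thesis by simp
qed

lemma unit_speed_bounds:
  fixes \<gamma> T :: "real \<Rightarrow> real \<times> real"
  assumes J: "convex J" and der: "\<And>s. s \<in> J \<Longrightarrow> (\<gamma> has_vector_derivative T s) (at s within J)"
    and unit: "\<And>s. s \<in> J \<Longrightarrow> norm (T s) = 1"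
    and lip: "\<And>s s'. s \<in> J \<Longrightarrow> s' \<in> J \<Longrightarrow> norm (T s - T s') \<le> L * \<bar>s - s'\<bar>"
    and s: "s \<in> J" "s0 \<in> J" and L: "0 \<le> L"
  shows "norm (\<gamma> s - \<gamma> s0) \<le> \<bar>s - s0\<bar>"
    and "norm (\<gamma> s - \<gamma> s0 - (s - s0) *\<^sub>R T s0) \<le> L * \<bar>s - s0\<bar>\<^sup>2"
proof -
  have on: "onorm (\<lambda>h::real. h *\<^sub>R v) \<le> norm v" for v :: "real \<times> real"
    by (rule onorm_le) (simp add: mult.commute)
  have "norm (\<gamma> s - \<gamma> s0) \<le> 1 * norm (s - s0)"
  proof (rule differentiable_bound[OF J _ _ s])
    show "(\<gamma> has_derivative (\<lambda>h. h *\<^sub>R T x)) (at x within J)" if "x \<in> J" for x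
      using der[OF that] by (simp add: has_vector_derivative_def)
    show "onorm (\<lambda>h. h *\<^sub>R T x) \<le> 1" if "x \<in> J" for x
      using on[of "T x"] unit[OF that] by simp
  qed
  then show "norm (\<gamma> s - \<gamma> s0) \<le> \<bar>s - s0\<bar>" by simp
  define S where "S = J \<inter> cball s0 \<bar>s - s0\<bar>"
  let ?f = "\<lambda>x. \<gamma> x - x *\<^sub>R T s0"
  have "norm (?f s - ?f s0) \<le> (L * \<bar>s - s0\<bar>) * norm (s - s0)"
  proof (rule differentiable_bound[where S=S])
    show "convex S" unfolding S_def by (intro convex_Int J convex_cball)
    show "(?f has_derivative (\<lambda>h. h *\<^sub>R (T x - T s0))) (at x within S)" if "x \<in> S" for x
    proof -
      have "(\<gamma> has_vector_derivative T x) (at x within S)"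
        by (rule has_vector_derivative_within_subset[OF der]) (use that in \<open>auto simp: S_def\<close>)
      then have "(?f has_vector_derivative (T x - T s0)) (at x within S)"
        by (auto intro!: derivative_eq_intros)
      then show ?thesis by (simp add: has_vector_derivative_def)
    qed
    show "onorm (\<lambda>h. h *\<^sub>R (T x - T s0)) \<le> L * \<bar>s - s0\<bar>" if "x \<in> S" for x
    proof -
      have "norm (T x - T s0) \<le> L * \<bar>x - s0\<bar>" using that s by (intro lip) (auto simp: S_def)
      also have "\<dots> \<le> L * \<bar>s - s0\<bar>"
        using that L by (intro mult_left_mono) (auto simp: S_def dist_real_def)
      finally show ?thesis using on[of "T x - T s0"] by simp
    qed
    show "s \<in> S" "s0 \<in> S" using s by (auto simp: S_def dist_real_def)
  qed
  moreover have "?f s - ?f s0 = \<gamma> s - \<gamma> s0 - (s - s0) *\<^sub>R T s0" by (simp add: algebra_simps)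
  ultimately show "norm (\<gamma> s - \<gamma> s0 - (s - s0) *\<^sub>R T s0) \<le> L * \<bar>s - s0\<bar>\<^sup>2"
    by (simp add: power2_eq_square)
qed

lemma card_le_of_diameter:
  fixes X :: "int set"
  assumes "finite X" and "\<And>k k'. k \<in> X \<Longrightarrow> k' \<in> X \<Longrightarrow> \<bar>k - k'\<bar> \<le> int D"
  shows "card X \<le> D + 1"
proof (cases "X = {}")
  case False
  have "X \<subseteq> {Min X..Min X + int D}"
  proof
    fix k assume k: "k \<in> X"
    have "Min X \<le> k" using assms(1) k by simp
    moreover have "\<bar>k - Min X\<bar> \<le> int D" by (rule assms(2)[OF k Min_in[OF assms(1) False]])
    ultimately show "k \<in> {Min X..Min X + int D}" by auto
  qed
  then have "card X \<le> card {Min X..Min X + int D}" by (intro card_mono) auto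
  then show ?thesis by simp
qed simp

text \<open>The factor 2 between the length of the interval and \<open>\<eta>\<close> makes the
inequality strict enough for a contradiction with the positive lower bound
\<open>f0\<close>.\<close>

lemma average_attained:
  fixes f :: "real \<Rightarrow> real"
  assumes eta: "0 < \<eta>" and f0: "0 < f0" "\<And>t. f0 \<le> f t"
  shows "\<exists>t\<in>{c - \<eta>..c + \<eta>}. ennreal (\<eta> * f t) \<le> (\<integral>\<^sup>+t. ennreal (f t) * indicator {c - \<eta>..c + \<eta>} t \<partial>lborel)"
proof (rule ccontr)
  let ?W = "{c - \<eta>..c + \<eta>}"
  let ?A = "\<integral>\<^sup>+t. ennreal (f t) * indicator ?W t \<partial>lborel"
  have low: "ennreal (2 * \<eta> * v) \<le> ?A" if "\<And>t. t \<in> ?W \<Longrightarrow> v \<le> f t" "0 \<le> v" for v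
  proof -
    have "ennreal (2 * \<eta> * v) = (\<integral>\<^sup>+t. ennreal v * indicator ?W t \<partial>lborel)"
      using eta that(2) by (subst nn_integral_cmult_indicator) (auto simp: ennreal_mult[symmetric] mult_ac)
    also have "\<dots> \<le> ?A" using that(1) by (intro nn_integral_mono) (auto simp: indicator_def intro: ennreal_leI)
    finally show ?thesis .
  qed
  assume "\<not> ?thesis"
  then have less: "?A < ennreal (\<eta> * f t)" if "t \<in> ?W" for t using that by (auto simp: not_le)
  have "c \<in> ?W" using eta by simp
  then have "?A < top" by (rule order_less_trans[OF less ennreal_less_top])
  then obtain x where x: "?A = ennreal x" "0 \<le> x" by (cases ?A) auto
  have "x / \<eta> \<le> f t" if "t \<in> ?W" for t
  proof -
    have "ennreal x < ennreal (\<eta> * f t)" using less[OF that] x by simp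
    then have "x < \<eta> * f t" using x(2) by (simp add: ennreal_less_iff)
    then show ?thesis using eta by (simp add: field_simps)
  qed
  from low[OF this] have "ennreal (2 * x) \<le> ennreal x" using x eta by simp
  then have "2 * x \<le> x" using x(2) by (subst (asm) ennreal_le_iff) auto
  then have "x = 0" using x(2) by simp
  moreover have "ennreal (2 * \<eta> * f0) \<le> ennreal x" using low[of f0] f0 x(1) by simp
  moreover have "0 < 2 * \<eta> * f0" using eta f0(1) by simp
  ultimately show False by (simp add: ennreal_eq_0_iff)
qed

lemma shadow_len_ge: "4 / 4 ^ l \<le> shadow_len d l"
proof -
  define w :: "digit list" where "w = replicate l (True, True)"
  have "cball (pos d w / 4 ^ l) (2 / 4 ^ l) \<subseteq> shadow d l"
    unfolding shadow_def by (rule UN_upper) (simp add: w_def)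
  then have "measure lebesgue (cball (pos d w / 4 ^ l) (2 / 4 ^ l)) \<le> shadow_len d l"
    unfolding shadow_len_def
    by (intro measure_mono_fmeasurable) (auto simp: compact_shadow lmeasurable_compact fmeasurableD)
  then show ?thesis by (subst (asm) measure_cball_real) auto
qed

definition colliding_translations :: "nat \<Rightarrow> (real \<times> real) set \<Rightarrow> (real \<times> real) set" where
  "colliding_translations n S = {p - c |p c. p \<in> four_corner_gen n \<and> c \<in> S}"

text \<open>The measure of the set of colliding translations of \<open>S\<close> is bounded by the
mean shadow. This is phrased with a measurable cover \<open>B\<close>, which passes to finite
unions.\<close>

definition shadow_dominated :: "(real \<times> real) set \<Rightarrow> bool" where
  "shadow_dominated S \<longleftrightarrow> (\<exists>C\<ge>0. \<forall>m l. l \<le> m \<longrightarrow> (\<exists>B\<in>sets lborel.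
    colliding_translations (m + l) S \<subseteq> B \<and> emeasure lborel B \<le> ennreal C * mean_shadow l))"

text \<open>Cut the arc into pieces of parameter length \<open>\<eta>\<close>, comparable to
\<open>4 ^ - m\<close>. By \<open>strip_membership\<close> each piece and each square of level
\<open>m\<close> give a strip of area of order \<open>16 ^ - m\<close> times the length of a shadow,
whose slope may be any number within \<open>\<eta>\<close> of the slope \<open>\<tau> k\<close> of
the piece. Choosing a slope whose shadow is not longer than twice the average over this window
bounds the area by an integral over the window. The lower Lipschitz bound for the tangent separates
the slopes \<open>\<tau> k\<close>, so that the windows overlap boundedly.\<close>

lemma flat_arc_cover:
  fixes \<gamma> T :: "real \<Rightarrow> real \<times> real"
  assumes J: "convex J" "J \<subseteq> {a..b}"
    and der: "\<And>s. s \<in> J \<Longrightarrow> (\<gamma> has_vector_derivative T s) (at s within J)"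
    and unit: "\<And>s. s \<in> J \<Longrightarrow> norm (T s) = 1"
    and lip: "\<And>s s'. s \<in> J \<Longrightarrow> s' \<in> J \<Longrightarrow> norm (T s - T s') \<le> L * \<bar>s - s'\<bar>"
    and colip: "\<And>s s'. s \<in> J \<Longrightarrow> s' \<in> J \<Longrightarrow> \<bar>s - s'\<bar> \<le> L * norm (T s - T s')"
    and L: "1 \<le> L"
    and \<sigma>: "\<bar>\<sigma>\<bar> = 1" "\<And>s. s \<in> J \<Longrightarrow> 3 / 5 \<le> \<sigma> * fst (T s)"
  shows "shadow_dominated (\<gamma> ` J)"
proof -
  define D where "D = nat \<lceil>L\<rceil> + 1"
  have D: "L \<le> real D" "2 \<le> real D"
  proof -
    have "L \<le> of_int \<lceil>L\<rceil>" by linarith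
    moreover from this have "real D = of_int \<lceil>L\<rceil> + 1" using L by (simp add: D_def)
    ultimately show "L \<le> real D" "2 \<le> real D" using L by linarith+
  qed
  have \<sigma>0: "\<sigma> \<noteq> 0" using \<sigma>(1) by auto
  define C where "C = 18 * real D * (2 * real D + 2)"
  have "\<exists>B\<in>sets lborel. colliding_translations (m + l) (\<gamma> ` J) \<subseteq> B \<and>
      emeasure lborel B \<le> ennreal C * mean_shadow l"
    if lm: "l \<le> m" for m l :: nat
  proof -
    \<comment> \<open>The factor \<open>D\<close> makes the deviation from the tangent at most \<open>16 ^ - m\<close>, and \<open>D \<ge> 2\<close> keeps all slopes in \<open>[-2, 2]\<close>.\<close>
    define \<eta> where "\<eta> = 1 / (real D * 4 ^ m)"
    have eta: "0 < \<eta>" "\<eta> \<le> 1 / 4 ^ m" "\<eta> \<le> 1 / 2"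
    proof -
      show "0 < \<eta>" using D by (simp add: \<eta>_def)
      show "\<eta> \<le> 1 / 4 ^ m" using D unfolding \<eta>_def by (intro divide_left_mono) auto
      have "2 * 1 \<le> real D * 4 ^ m" using D by (intro mult_mono) auto
      then show "\<eta> \<le> 1 / 2" unfolding \<eta>_def by (intro divide_left_mono) auto
    qed
    define cell where "cell = (\<lambda>s. \<lfloor>s / \<eta>\<rfloor>)"
    define X where "X = cell ` J"
    have finX: "finite X"
    proof (rule finite_subset)
      show "X \<subseteq> {cell a..cell b}"
      proof
        fix k assume "k \<in> X"
        then obtain s where s: "s \<in> J" "k = cell s" by (auto simp: X_def)
        then have "a \<le> s" "s \<le> b" using J(2) by auto
        then show "k \<in> {cell a..cell b}"
          unfolding s(2) cell_def using eta by (auto intro!: floor_mono divide_right_mono)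
      qed
    qed simp
    define sk where "sk = (\<lambda>k. SOME s. s \<in> J \<and> cell s = k)"
    have sk: "sk k \<in> J" "cell (sk k) = k" if "k \<in> X" for k
    proof -
      have "\<exists>s. s \<in> J \<and> cell s = k" using that by (auto simp: X_def)
      from someI_ex[OF this] show "sk k \<in> J" "cell (sk k) = k" by (auto simp: sk_def)
    qed
    have same_cell: "\<bar>s - s'\<bar> \<le> \<eta>" if "cell s = cell s'" for s s'
    proof -
      have "\<bar>s / \<eta> - s' / \<eta>\<bar> \<le> 1" using that unfolding cell_def by linarith
      then have "\<bar>s - s'\<bar> / \<eta> \<le> 1" using eta by (simp add: abs_divide flip: diff_divide_distrib)
      then show ?thesis using eta by (simp add: field_simps)
    qed
    define \<tau> where "\<tau> = (\<lambda>k. snd (T (sk k)) / fst (T (sk k)))"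
    have fst_ge: "3 / 5 \<le> \<bar>fst (T s)\<bar>" if "s \<in> J" for s
    proof -
      have "\<sigma> * fst (T s) \<le> \<bar>\<sigma> * fst (T s)\<bar>" by (rule abs_ge_self)
      also have "\<dots> = \<bar>fst (T s)\<bar>" using \<sigma>(1) by (simp add: abs_mult)
      finally show ?thesis using \<sigma>(2)[OF that] by linarith
    qed
    have tau: "\<bar>\<tau> k\<bar> \<le> 4 / 3" if k: "k \<in> X" for k
    proof -
      let ?c = "fst (T (sk k))" and ?d = "snd (T (sk k))"
      have "?c\<^sup>2 + ?d\<^sup>2 = 1" using unit[OF sk(1)[OF k]] by (simp add: norm_prod_def)
      moreover have c: "3 / 5 \<le> \<bar>?c\<bar>" using fst_ge sk(1)[OF k] by blast
      then have "(3 / 5)\<^sup>2 \<le> ?c\<^sup>2" using power_mono[of "3/5" "\<bar>?c\<bar>" 2] by simp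
      ultimately have "\<bar>?d\<bar>\<^sup>2 \<le> (4 / 5)\<^sup>2" by (simp add: power2_eq_square)
      then have d: "\<bar>?d\<bar> \<le> 4 / 5" by (rule power2_le_imp_le) simp
      have "\<bar>?d\<bar> / \<bar>?c\<bar> \<le> (4 / 5) / (3 / 5)" using c d by (intro frac_le) auto
      then show ?thesis by (simp add: \<tau>_def abs_divide)
    qed
    define W where "W = (\<lambda>k. {\<tau> k - \<eta>..\<tau> k + \<eta>})"
    define A where "A = (\<lambda>k. \<integral>\<^sup>+t. ennreal (shadow_len (corner t) l) * indicator (W k) t \<partial>lborel)"
    have "\<exists>t\<in>W k. ennreal (\<eta> * shadow_len (corner t) l) \<le> A k" for k
      unfolding W_def A_def by (rule average_attained[OF eta(1), of "4 / 4 ^ l"]) (auto intro: shadow_len_ge)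
    then obtain tk where tk: "\<And>k. tk k \<in> W k" "\<And>k. ennreal (\<eta> * shadow_len (corner (tk k)) l) \<le> A k"
      by metis
    define E where "E = (\<lambda>k u. (2 / 9 * 4 ^ m) * ((pos step_y u / 4 ^ m - snd (\<gamma> (sk k))) - \<tau> k * (pos step_x u / 4 ^ m - fst (\<gamma> (sk k)))) +
        (1 - \<tau> k) * (4 ^ l - 1) / (9 * 4 ^ l))"
    define St where "St = (\<lambda>k u. strip (pos step_x u / 4 ^ m - fst (\<gamma> (sk k))) (2 / 4 ^ m) (2 / 9 * 4 ^ m) (\<tau> k) (E k u) (shadow (corner (tk k)) l))"
    define B where "B = (\<Union>k\<in>X. \<Union>u\<in>words m. St k u)"
    have St: "St k u \<in> sets lborel" for k u
      unfolding St_def sets_lborel by (intro borel_closed closed_strip compact_imp_closed compact_shadow)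
    have "B \<in> sets lborel"
      unfolding B_def by (intro sets.finite_UN finX finite_words St)
    moreover have "colliding_translations (m + l) (\<gamma> ` J) \<subseteq> B"
    proof
      fix z assume "z \<in> colliding_translations (m + l) (\<gamma> ` J)"
      then obtain p s where ps: "z = p - \<gamma> s" "p \<in> four_corner_gen (m + l)" "s \<in> J"
        unfolding colliding_translations_def by blast
      define k where "k = cell s"
      have k: "k \<in> X" using ps(3) by (auto simp: k_def X_def)
      have d: "\<bar>s - sk k\<bar> \<le> \<eta>" using same_cell[of s "sk k"] sk(2)[OF k] by (simp add: k_def)
      have n1: "norm (\<gamma> s - \<gamma> (sk k)) \<le> \<eta>"
        using unit_speed_bounds(1)[OF J(1) der unit lip ps(3) sk(1)[OF k]] L d by simp
      define e where "e = \<gamma> s - \<gamma> (sk k) - (s - sk k) *\<^sub>R T (sk k)"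
      have ne: "norm e \<le> 1 / 16 ^ m"
      proof -
        have "norm e \<le> L * \<bar>s - sk k\<bar>\<^sup>2"
          unfolding e_def using unit_speed_bounds(2)[OF J(1) der unit lip ps(3) sk(1)[OF k]] L by simp
        also have "\<dots> \<le> real D * \<eta>\<^sup>2" using D d L by (intro mult_mono power_mono) auto
        also have "\<dots> = 1 / real D * (1 / 16 ^ m)"
        proof -
          have "((4::real) ^ m)\<^sup>2 = 16 ^ m" by (simp add: power2_eq_square flip: power_mult_distrib)
          then show ?thesis using D by (simp add: \<eta>_def power2_eq_square)
        qed
        also have "\<dots> \<le> 1 * (1 / 16 ^ m)" using D by (intro mult_right_mono) auto
        finally show ?thesis by simp
      qed
      have "\<bar>fst (\<gamma> s) - fst (\<gamma> (sk k))\<bar> \<le> 1 / 4 ^ m"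
      proof -
        have "\<bar>fst (\<gamma> s - \<gamma> (sk k))\<bar> \<le> norm (\<gamma> s - \<gamma> (sk k))"
          using norm_fst_le[of "fst (\<gamma> s - \<gamma> (sk k))" "snd (\<gamma> s - \<gamma> (sk k))"]
          unfolding prod.collapse by simp
        then show ?thesis using n1 eta(2) unfolding fst_diff by linarith
      qed
      moreover have "\<bar>(snd (\<gamma> s) - snd (\<gamma> (sk k))) - \<tau> k * (fst (\<gamma> s) - fst (\<gamma> (sk k)))\<bar> \<le> 3 / 16 ^ m"
      proof -
        have c0: "fst (T (sk k)) \<noteq> 0" using fst_ge[OF sk(1)[OF k]] by auto
        have g: "\<gamma> s - \<gamma> (sk k) = (s - sk k) *\<^sub>R T (sk k) + e" by (simp add: e_def)
        have g1: "fst (\<gamma> s) - fst (\<gamma> (sk k)) = (s - sk k) * fst (T (sk k)) + fst e"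
          using arg_cong[OF g, of fst] by simp
        have g2: "snd (\<gamma> s) - snd (\<gamma> (sk k)) = (s - sk k) * snd (T (sk k)) + snd e"
          using arg_cong[OF g, of snd] by simp
        have eq: "(snd (\<gamma> s) - snd (\<gamma> (sk k))) - \<tau> k * (fst (\<gamma> s) - fst (\<gamma> (sk k))) = snd e - \<tau> k * fst e"
          unfolding g1 g2 using c0 by (simp add: \<tau>_def field_simps)
        have a: "\<bar>fst e\<bar> \<le> 1 / 16 ^ m" "\<bar>snd e\<bar> \<le> 1 / 16 ^ m"
          using norm_fst_le[of "fst e" "snd e"] norm_snd_le[of "snd e" "fst e"] ne by simp_all
        have "\<bar>\<tau> k * fst e\<bar> \<le> 4 / 3 * (1 / 16 ^ m)" unfolding abs_mult using tau[OF k] a by (intro mult_mono) auto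
        then have "\<bar>snd e - \<tau> k * fst e\<bar> \<le> 1 / 16 ^ m + 4 / 3 * (1 / 16 ^ m)" using a by linarith
        also have "\<dots> = (7 / 3) / 16 ^ m" by simp
        also have "\<dots> \<le> 3 / 16 ^ m" by (rule divide_right_mono) auto
        finally show ?thesis unfolding eq .
      qed
      moreover have "\<bar>tk k - \<tau> k\<bar> \<le> 1 / 4 ^ m" using tk(1)[of k] eta(2) by (auto simp: W_def abs_le_iff)
      ultimately obtain u where "u \<in> words m" "z \<in> St k u"
        using strip_membership[OF lm tau[OF k] _ ps(2), of "tk k" "\<gamma> s" "\<gamma> (sk k)"]
        unfolding St_def strip_def E_def ps(1) by blast
      then show "z \<in> B" using k unfolding B_def by blast
    qed
    moreover have "emeasure lborel B \<le> ennreal C * mean_shadow l"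
    proof -
      have nn: "0 \<le> shadow_len (corner t) l" for t by (simp add: shadow_len_def)
      have es: "emeasure lborel (St k u) = ennreal (18 / 16 ^ m * shadow_len (corner (tk k)) l)" for k u
      proof -
        have "(16::real) ^ m = 4 ^ m * 4 ^ m" by (simp flip: power_mult_distrib)
        then have "2 * (2 / 4 ^ m) * shadow_len (corner (tk k)) l / (2 / 9 * 4 ^ m) = 18 / 16 ^ m * shadow_len (corner (tk k)) l"
          by simp
        then show ?thesis unfolding St_def
          by (subst emeasure_strip) (auto simp: compact_shadow shadow_len_def)
      qed
      have "emeasure lborel B \<le> (\<Sum>k\<in>X. emeasure lborel (\<Union>u\<in>words m. St k u))"
        unfolding B_def using St by (intro emeasure_subadditive_finite finX) (auto intro!: sets.finite_UN simp del: sets_lborel)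
      also have "\<dots> \<le> (\<Sum>k\<in>X. \<Sum>u\<in>words m. emeasure lborel (St k u))"
        using St by (intro sum_mono emeasure_subadditive_finite finite_words) auto
      also have "\<dots> = (\<Sum>k\<in>X. ennreal (18 * real D) * ennreal (\<eta> * shadow_len (corner (tk k)) l))"
      proof (intro sum.cong refl)
        fix k
        have "(16::real) ^ m = 4 ^ m * 4 ^ m" by (simp flip: power_mult_distrib)
        then have e: "4 ^ m * (18 / 16 ^ m * shadow_len (corner (tk k)) l) = 18 * real D * (\<eta> * shadow_len (corner (tk k)) l)"
          using D by (simp add: \<eta>_def)
        have "(\<Sum>u\<in>words m. emeasure lborel (St k u)) = of_nat (4 ^ m) * ennreal (18 / 16 ^ m * shadow_len (corner (tk k)) l)"
          unfolding es using card_words[of m] by simp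
        also have "\<dots> = ennreal (4 ^ m * (18 / 16 ^ m * shadow_len (corner (tk k)) l))"
          using nn[of "tk k"] by (subst ennreal_mult) (auto simp: ennreal_of_nat_eq_real_of_nat)
        also have "\<dots> = ennreal (18 * real D) * ennreal (\<eta> * shadow_len (corner (tk k)) l)"
          unfolding e using nn[of "tk k"] eta by (intro ennreal_mult) auto
        finally show "(\<Sum>u\<in>words m. emeasure lborel (St k u)) = ennreal (18 * real D) * ennreal (\<eta> * shadow_len (corner (tk k)) l)" .
      qed
      also have "\<dots> \<le> (\<Sum>k\<in>X. ennreal (18 * real D) * A k)"
        by (intro sum_mono mult_left_mono tk) auto
      also have "\<dots> = ennreal (18 * real D) * (\<Sum>k\<in>X. A k)" by (simp add: sum_distrib_left)
      also have "(\<Sum>k\<in>X. A k) = (\<integral>\<^sup>+t. (\<Sum>k\<in>X. ennreal (shadow_len (corner t) l) * indicator (W k) t) \<partial>lborel)"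
        unfolding A_def W_def by (rule nn_integral_sum[symmetric]) measurable
      also have "\<dots> \<le> (\<integral>\<^sup>+t. ennreal (2 * real D + 2) * (ennreal (shadow_len (corner t) l) * indicator {- 2..2} t) \<partial>lborel)"
      proof (intro nn_integral_mono)
        fix t
        define Y where "Y = {k \<in> X. t \<in> W k}"
        have finY: "finite Y" using finX by (simp add: Y_def)
        have diam: "\<bar>k - k'\<bar> \<le> int (2 * D + 1)" if "k \<in> Y" "k' \<in> Y" for k k'
        proof -
          have kX: "k \<in> X" "k' \<in> X" using that by (auto simp: Y_def)
          have "\<bar>\<tau> k - \<tau> k'\<bar> \<le> 2 * \<eta>" using that by (auto simp: Y_def W_def abs_le_iff)
          moreover have "norm (\<sigma> *\<^sub>R T (sk k) - \<sigma> *\<^sub>R T (sk k')) \<le> \<bar>\<tau> k - \<tau> k'\<bar>"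
          proof -
            have 1: "norm (\<sigma> *\<^sub>R T (sk j)) = 1" "0 < fst (\<sigma> *\<^sub>R T (sk j))"
              "snd (\<sigma> *\<^sub>R T (sk j)) / fst (\<sigma> *\<^sub>R T (sk j)) = \<tau> j" if "j \<in> X" for j
              using unit[OF sk(1)[OF that]] \<sigma>(1) \<sigma>(2)[OF sk(1)[OF that]] \<sigma>0 by (auto simp: \<tau>_def)
            show ?thesis using norm_diff_le_slope_diff[OF 1(1,2)[OF kX(1)] 1(1,2)[OF kX(2)]] 1(3) kX by simp
          qed
          ultimately have "norm (T (sk k) - T (sk k')) \<le> 2 * \<eta>"
            using \<sigma>(1) by (simp flip: scaleR_diff_right)
          then have "L * norm (T (sk k) - T (sk k')) \<le> L * (2 * \<eta>)" using L by (intro mult_left_mono) auto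
          also have "\<dots> \<le> real D * (2 * \<eta>)" using D eta by (intro mult_right_mono) auto
          finally have "\<bar>sk k - sk k'\<bar> \<le> real D * (2 * \<eta>)"
            using colip[OF sk(1)[OF kX(1)] sk(1)[OF kX(2)]] by linarith
          then have "\<bar>sk k - sk k'\<bar> / \<eta> \<le> 2 * real D" using eta by (simp add: field_simps)
          then have "\<bar>sk k / \<eta> - sk k' / \<eta>\<bar> \<le> 2 * real D"
            using eta by (simp add: abs_divide flip: diff_divide_distrib)
          then have "\<bar>cell (sk k) - cell (sk k')\<bar> \<le> int (2 * D + 1)"
            unfolding cell_def by linarith
          then show ?thesis using sk(2) kX by simp
        qed
        have "card Y \<le> 2 * D + 1 + 1" by (rule card_le_of_diameter[OF finY diam])
        then have cY: "real (card Y) \<le> 2 * real D + 2" by linarith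
        have "(\<Sum>k\<in>X. indicator (W k) t) = (of_nat (card Y) :: ennreal)"
        proof -
          have "(\<Sum>k\<in>X. indicator (W k) t) = (\<Sum>k\<in>X. if t \<in> W k then 1 else 0 :: ennreal)"
            by (intro sum.cong refl) (simp add: indicator_def)
          also have "\<dots> = of_nat (card (X \<inter> {k. t \<in> W k}))" using finX by (simp add: sum.If_cases)
          also have "X \<inter> {k. t \<in> W k} = Y" by (auto simp: Y_def)
          finally show ?thesis .
        qed
        also have "\<dots> \<le> ennreal (2 * real D + 2) * indicator {- 2..2} t"
        proof (cases "Y = {}")
          case False
          then obtain k where k: "k \<in> X" "t \<in> W k" by (auto simp: Y_def)
          then have "t \<in> {- 2..2}" using tau[OF k(1)] eta(3) by (auto simp: W_def abs_le_iff)
          then have "indicator {- 2..2} t = (1::ennreal)" by simp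
          then show ?thesis using ennreal_leI[OF cY]
            by (simp only: mult_1_right ennreal_of_nat_eq_real_of_nat)
        qed simp
        finally have "ennreal (shadow_len (corner t) l) * (\<Sum>k\<in>X. indicator (W k) t) \<le>
            ennreal (shadow_len (corner t) l) * (ennreal (2 * real D + 2) * indicator {- 2..2} t)"
          by (intro mult_left_mono) auto
        then show "(\<Sum>k\<in>X. ennreal (shadow_len (corner t) l) * indicator (W k) t) \<le>
          ennreal (2 * real D + 2) * (ennreal (shadow_len (corner t) l) * indicator {- 2..2} t)"
          by (simp only: sum_distrib_left mult_ac)
      qed
      also have "\<dots> = ennreal (2 * real D + 2) * mean_shadow l"
        unfolding mean_shadow_def by (rule nn_integral_cmult) measurable
      finally have "emeasure lborel B \<le> ennreal (18 * real D) * (ennreal (2 * real D + 2) * mean_shadow l)"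
        by (simp add: mult_left_mono)
      also have "\<dots> = ennreal C * mean_shadow l"
        unfolding C_def by (subst mult.assoc[symmetric], subst ennreal_mult[symmetric]) auto
      finally show ?thesis .
    qed
    ultimately show ?thesis by blast
  qed
  moreover have "0 \<le> C" by (simp add: C_def)
  ultimately show ?thesis unfolding shadow_dominated_def by blast
qed

section \<open>Favard curve length\<close>

lemma shadow_dominated_empty: "shadow_dominated {}"
  unfolding shadow_dominated_def colliding_translations_def by (intro exI[of _ 0]) auto

lemma shadow_dominated_Un:
  assumes "shadow_dominated S" "shadow_dominated S'"
  shows "shadow_dominated (S \<union> S')"
proof -
  obtain C where C: "0 \<le> C" "\<And>m l. l \<le> m \<Longrightarrow> \<exists>B\<in>sets lborel.
    colliding_translations (m + l) S \<subseteq> B \<and> emeasure lborel B \<le> ennreal C * mean_shadow l"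
    using assms(1) unfolding shadow_dominated_def by blast
  obtain C' where C': "0 \<le> C'" "\<And>m l. l \<le> m \<Longrightarrow> \<exists>B\<in>sets lborel.
    colliding_translations (m + l) S' \<subseteq> B \<and> emeasure lborel B \<le> ennreal C' * mean_shadow l"
    using assms(2) unfolding shadow_dominated_def by blast
  have "\<exists>B\<in>sets lborel. colliding_translations (m + l) (S \<union> S') \<subseteq> B \<and>
      emeasure lborel B \<le> ennreal (C + C') * mean_shadow l" if lm: "l \<le> m" for m l
  proof -
    obtain B where B: "B \<in> sets lborel" "colliding_translations (m + l) S \<subseteq> B"
      "emeasure lborel B \<le> ennreal C * mean_shadow l" using C(2)[OF lm] by blast
    obtain B' where B': "B' \<in> sets lborel" "colliding_translations (m + l) S' \<subseteq> B'"
      "emeasure lborel B' \<le> ennreal C' * mean_shadow l" using C'(2)[OF lm] by blast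
    have "emeasure lborel (B \<union> B') \<le> emeasure lborel B + emeasure lborel B'"
      using B(1) B'(1) by (rule emeasure_subadditive)
    also have "\<dots> \<le> ennreal C * mean_shadow l + ennreal C' * mean_shadow l"
      by (rule add_mono[OF B(3) B'(3)])
    also have "\<dots> = ennreal (C + C') * mean_shadow l" using C(1) C'(1) by (simp add: distrib_right)
    finally have "emeasure lborel (B \<union> B') \<le> ennreal (C + C') * mean_shadow l" .
    moreover have "colliding_translations (m + l) (S \<union> S') \<subseteq> B \<union> B'"
      using B(2) B'(2) unfolding colliding_translations_def by blast
    moreover have "B \<union> B' \<in> sets lborel" using B(1) B'(1) by (rule sets.Un)
    ultimately show ?thesis by blast
  qed
  moreover have "0 \<le> C + C'" using C(1) C'(1) by simp
  ultimately show ?thesis unfolding shadow_dominated_def by blast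
qed

lemma shadow_dominated_Union:
  "finite P \<Longrightarrow> (\<And>S. S \<in> P \<Longrightarrow> shadow_dominated S) \<Longrightarrow> shadow_dominated (\<Union>P)"
  by (induction P rule: finite_induct) (simp_all add: shadow_dominated_empty shadow_dominated_Un)

lemma swap_four_corner_gen: "prod.swap p \<in> four_corner_gen n \<longleftrightarrow> p \<in> four_corner_gen n"
  by (cases p) (auto simp: four_corner_gen_def)

lemma swap_diff: "prod.swap (p - z) = prod.swap p - prod.swap (z :: real \<times> real)"
  by (cases p; cases z) simp

lemma emeasure_lborel_swap:
  fixes B :: "(real \<times> real) set"
  assumes "B \<in> sets lborel"
  shows "prod.swap -` B \<in> sets lborel" "emeasure lborel (prod.swap -` B) = emeasure lborel B"
proof -
  have m: "(prod.swap :: real \<times> real \<Rightarrow> _) \<in> lborel \<rightarrow>\<^sub>M lborel"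
  proof -
    have "continuous_on UNIV (\<lambda>z::real \<times> real. (snd z, fst z))" by (intro continuous_intros)
    then have "(\<lambda>z::real \<times> real. (snd z, fst z)) \<in> borel \<rightarrow>\<^sub>M borel" by (rule borel_measurable_continuous_onI)
    moreover have "(\<lambda>z::real \<times> real. (snd z, fst z)) = prod.swap" by (auto simp: prod.swap_def fun_eq_iff)
    ultimately show ?thesis by simp
  qed
  show s: "prod.swap -` B \<in> sets lborel" using measurable_sets[OF m assms] by simp
  have d: "(lborel :: (real \<times> real) measure) = distr lborel lborel prod.swap"
  proof -
    have "(\<lambda>(x, y). (y, x)) = (prod.swap :: real \<times> real \<Rightarrow> _)" by (auto simp: fun_eq_iff)
    then show ?thesis using lborel_pair.distr_pair_swap unfolding lborel_prod by metis
  qed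
  have "emeasure lborel B = emeasure (distr lborel lborel prod.swap) B" using d by metis
  also have "\<dots> = emeasure lborel (prod.swap -` B)" using emeasure_distr[OF m assms] by simp
  finally show "emeasure lborel (prod.swap -` B) = emeasure lborel B" ..
qed

text \<open>The four-corner set is symmetric under exchanging the coordinates.\<close>

lemma shadow_dominated_swap:
  assumes "shadow_dominated (prod.swap ` S)"
  shows "shadow_dominated S"
proof -
  obtain C where C: "0 \<le> C" "\<And>m l. l \<le> m \<Longrightarrow> \<exists>B\<in>sets lborel.
    colliding_translations (m + l) (prod.swap ` S) \<subseteq> B \<and> emeasure lborel B \<le> ennreal C * mean_shadow l"
    using assms unfolding shadow_dominated_def by blast
  have "\<exists>B\<in>sets lborel. colliding_translations (m + l) S \<subseteq> B \<and>
      emeasure lborel B \<le> ennreal C * mean_shadow l" if lm: "l \<le> m" for m l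
  proof -
    obtain B where B: "B \<in> sets lborel" "colliding_translations (m + l) (prod.swap ` S) \<subseteq> B"
      "emeasure lborel B \<le> ennreal C * mean_shadow l" using C(2)[OF lm] by blast
    have "colliding_translations (m + l) S \<subseteq> prod.swap -` B"
    proof
      fix x assume "x \<in> colliding_translations (m + l) S"
      then obtain p z where pz: "x = p - z" "p \<in> four_corner_gen (m + l)" "z \<in> S"
        unfolding colliding_translations_def by blast
      have "prod.swap x = prod.swap p - prod.swap z" unfolding pz(1) by (rule swap_diff)
      moreover have "prod.swap p \<in> four_corner_gen (m + l)" using pz(2) by (simp only: swap_four_corner_gen)
      ultimately have "prod.swap x \<in> B" using B(2) pz(3) unfolding colliding_translations_def by blast
      then show "x \<in> prod.swap -` B" by simp
    qed
    then show ?thesis using emeasure_lborel_swap[OF B(1)] B(3) by (intro bexI[of _ "prod.swap -` B"]) auto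
  qed
  then show ?thesis unfolding shadow_dominated_def using C(1) by blast
qed

text \<open>On a parameter interval of length \<open>1 / (10 K)\<close> the unit tangent moves by at
most \<open>1 / 10\<close>. One of its coordinates is at least \<open>7 / 10\<close> in absolute
value at one point, hence at least \<open>3 / 5\<close> with a constant sign on the whole
interval.\<close>

lemma shadow_dominated_arc:
  assumes "bilipschitz_tangent_arc S"
  shows "shadow_dominated S"
proof -
  obtain a b I \<gamma> T K where H: "a < b \<and> {a<..<b} \<subseteq> I \<and> I \<subseteq> {a..b} \<and> S = \<gamma> ` I \<and>
      (\<forall>s\<in>I. (\<gamma> has_vector_derivative T s) (at s within I)) \<and>
      continuous_on I T \<and> (\<forall>s\<in>I. norm (T s) = 1) \<and> 1 \<le> K \<and>
      (\<forall>s\<in>I. \<forall>t\<in>I. inverse K * \<bar>s - t\<bar> \<le> norm (T s - T t) \<and> norm (T s - T t) \<le> K * \<bar>s - t\<bar>)"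
    using assms unfolding bilipschitz_tangent_arc_def by (elim exE) (rule that)
  have ab: "a < b" "{a<..<b} \<subseteq> I" "I \<subseteq> {a..b}" and S: "S = \<gamma> ` I" and K: "1 \<le> K"
    using H by simp_all
  have der: "(\<gamma> has_vector_derivative T s) (at s within I)" if "s \<in> I" for s
    using H that by simp
  have unit: "norm (T s) = 1" if "s \<in> I" for s using H that by simp
  have bil: "inverse K * \<bar>s - t\<bar> \<le> norm (T s - T t) \<and> norm (T s - T t) \<le> K * \<bar>s - t\<bar>"
    if "s \<in> I" "t \<in> I" for s t
    using H that by simp
  have I: "z \<in> I" if "x \<in> I" "y \<in> I" "x \<le> z" "z \<le> y" for x y z
  proof (cases "z = x \<or> z = y")
    case False
    have "a \<le> x" "y \<le> b" using that(1,2) ab(3) by auto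
    then have "z \<in> {a<..<b}" using that False by auto
    then show ?thesis using ab(2) by blast
  qed (use that in auto)
  define h where "h = 1 / (10 * K)"
  have h: "0 < h" "K * h = 1 / 10" using K by (simp_all add: h_def)
  define cell where "cell = (\<lambda>s. \<lfloor>s / h\<rfloor>)"
  define J where "J = (\<lambda>c. {s \<in> I. cell s = c})"
  have cell_mono: "cell x \<le> cell y" if "x \<le> y" for x y
    unfolding cell_def using that h by (intro floor_mono divide_right_mono) auto
  have fin: "finite (cell ` I)"
  proof (rule finite_subset)
    show "cell ` I \<subseteq> {cell a..cell b}"
    proof
      fix k assume "k \<in> cell ` I"
      then obtain s where s: "s \<in> I" "k = cell s" by blast
      then have "a \<le> s" "s \<le> b" using ab(3) by auto
      then show "k \<in> {cell a..cell b}" unfolding s(2) by (simp add: cell_mono)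
    qed
  qed simp
  have SU: "S = \<Union> ((\<lambda>c. \<gamma> ` J c) ` (cell ` I))" unfolding S J_def by auto
  have "shadow_dominated (\<gamma> ` J c)" if c: "c \<in> cell ` I" for c
  proof -
    obtain s0 where s0: "s0 \<in> J c" using c by (auto simp: J_def)
    have JI: "J c \<subseteq> I" by (auto simp: J_def)
    have conv: "convex (J c)"
    proof -
      have "z \<in> J c" if "x \<in> J c" "y \<in> J c" "x \<le> z" "z \<le> y" for x y z
        using that I[of x y z] cell_mono[of x z] cell_mono[of z y] by (auto simp: J_def)
      then have "is_interval (J c)" unfolding is_interval_1 by blast
      then show ?thesis by (simp only: is_interval_convex_1)
    qed
    have Jab: "J c \<subseteq> {a..b}" using JI ab(3) by blast
    have near: "norm (T s - T s0) \<le> 1 / 10" if "s \<in> J c" for s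
    proof -
      have "cell s = cell s0" using that s0 by (simp add: J_def)
      then have "\<bar>s / h - s0 / h\<bar> \<le> 1" unfolding cell_def by linarith
      then have "\<bar>s - s0\<bar> / h \<le> 1" using h by (simp add: abs_divide flip: diff_divide_distrib)
      then have "\<bar>s - s0\<bar> \<le> h" using h by (simp add: field_simps)
      then have "K * \<bar>s - s0\<bar> \<le> K * h" using K by (intro mult_left_mono) auto
      moreover have "norm (T s - T s0) \<le> K * \<bar>s - s0\<bar>"
        using bil[of s s0] subsetD[OF JI that] subsetD[OF JI s0] by simp
      ultimately show ?thesis using h(2) by linarith
    qed
    have derJ: "(\<gamma> has_vector_derivative T s) (at s within J c)" if "s \<in> J c" for s
      by (rule has_vector_derivative_within_subset[OF der[OF subsetD[OF JI that]] JI])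
    have lip: "norm (T s - T s') \<le> K * \<bar>s - s'\<bar>" if "s \<in> J c" "s' \<in> J c" for s s'
      using bil[of s s'] that[THEN subsetD[OF JI]] by simp
    have colip: "\<bar>s - s'\<bar> \<le> K * norm (T s - T s')" if "s \<in> J c" "s' \<in> J c" for s s'
    proof -
      have "inverse K * \<bar>s - s'\<bar> \<le> norm (T s - T s')"
        using bil[of s s'] that[THEN subsetD[OF JI]] by simp
      then show ?thesis using K by (simp add: field_simps)
    qed
    have unitJ: "norm (T s) = 1" if "s \<in> J c" for s using unit that JI by blast
    have comp: "\<bar>fst v\<bar> \<le> norm v" "\<bar>snd v\<bar> \<le> norm v" for v :: "real \<times> real"
      using norm_fst_le[of "fst v" "snd v"] norm_snd_le[of "snd v" "fst v"] unfolding prod.collapse by simp_all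
    show ?thesis
    proof (cases "7 / 10 \<le> \<bar>fst (T s0)\<bar>")
      case True
      define \<sigma> where "\<sigma> = sgn (fst (T s0))"
      have \<sigma>: "\<bar>\<sigma>\<bar> = 1" "\<sigma> * fst (T s0) = \<bar>fst (T s0)\<bar>" using True by (auto simp: \<sigma>_def sgn_if)
      have ge: "3 / 5 \<le> \<sigma> * fst (T s)" if "s \<in> J c" for s
      proof -
        have "\<bar>\<sigma> * fst (T s) - \<sigma> * fst (T s0)\<bar> = \<bar>fst (T s - T s0)\<bar>"
          using \<sigma>(1) by (simp add: abs_mult flip: right_diff_distrib)
        also have "\<dots> \<le> 1 / 10" using comp(1)[of "T s - T s0"] near[OF that] by linarith
        finally show ?thesis using \<sigma>(2) True by linarith
      qed
      show ?thesis
        by (rule flat_arc_cover[OF conv Jab derJ unitJ lip colip K \<sigma>(1) ge])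
    next
      case False
      have "(fst (T s0))\<^sup>2 + (snd (T s0))\<^sup>2 = 1" using unitJ[OF s0] by (simp add: norm_prod_def)
      moreover have "(fst (T s0))\<^sup>2 \<le> (7 / 10)\<^sup>2" using power_mono[of "\<bar>fst (T s0)\<bar>" "7/10" 2] False by simp
      ultimately have "(7 / 10)\<^sup>2 \<le> \<bar>snd (T s0)\<bar>\<^sup>2" by (simp add: power2_eq_square)
      then have True: "7 / 10 \<le> \<bar>snd (T s0)\<bar>" by (rule power2_le_imp_le) simp
      define \<sigma> where "\<sigma> = sgn (snd (T s0))"
      have \<sigma>: "\<bar>\<sigma>\<bar> = 1" "\<sigma> * snd (T s0) = \<bar>snd (T s0)\<bar>" using True by (auto simp: \<sigma>_def sgn_if)
      have ge: "3 / 5 \<le> \<sigma> * fst (prod.swap (T s))" if "s \<in> J c" for s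
      proof -
        have "\<bar>\<sigma> * snd (T s) - \<sigma> * snd (T s0)\<bar> = \<bar>snd (T s - T s0)\<bar>"
          using \<sigma>(1) by (simp add: abs_mult flip: right_diff_distrib)
        also have "\<dots> \<le> 1 / 10" using comp(2)[of "T s - T s0"] near[OF that] by linarith
        finally show ?thesis using \<sigma>(2) True unfolding fst_swap by linarith
      qed
      have nsw: "norm (prod.swap v) = norm v" for v :: "real \<times> real"
        by (cases v) (simp add: norm_prod_def add.commute)
      have bl: "bounded_linear (prod.swap :: real \<times> real \<Rightarrow> _)"
      proof -
        have e: "(prod.swap :: real \<times> real \<Rightarrow> _) = (\<lambda>z. (snd z, fst z))" by (auto simp: fun_eq_iff)
        show ?thesis unfolding e by (intro bounded_linear_Pair bounded_linear_snd bounded_linear_fst)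
      qed
      have der': "((\<lambda>s. prod.swap (\<gamma> s)) has_vector_derivative prod.swap (T s)) (at s within J c)" if "s \<in> J c" for s
        by (rule bounded_linear.has_vector_derivative[OF bl derJ[OF that]])
      have unit': "norm (prod.swap (T s)) = 1" if "s \<in> J c" for s using unitJ[OF that] by (simp only: nsw)
      have lip': "norm (prod.swap (T s) - prod.swap (T s')) \<le> K * \<bar>s - s'\<bar>" if "s \<in> J c" "s' \<in> J c" for s s'
        using lip[OF that] by (simp only: nsw flip: swap_diff)
      have colip': "\<bar>s - s'\<bar> \<le> K * norm (prod.swap (T s) - prod.swap (T s'))" if "s \<in> J c" "s' \<in> J c" for s s'
        using colip[OF that] by (simp only: nsw flip: swap_diff)
      have "shadow_dominated ((\<lambda>s. prod.swap (\<gamma> s)) ` J c)"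
        by (rule flat_arc_cover[OF conv Jab der' unit' lip' colip' K \<sigma>(1) ge])
      then have "shadow_dominated (prod.swap ` \<gamma> ` J c)" by (simp only: image_image)
      then show ?thesis by (rule shadow_dominated_swap)
    qed
  qed
  then have "shadow_dominated (\<Union> ((\<lambda>c. \<gamma> ` J c) ` (cell ` I)))"
    using fin by (intro shadow_dominated_Union) auto
  then show ?thesis unfolding SU[symmetric] .
qed

lemma square_le_power4: "I ^ 2 \<le> (4::nat) ^ I"
proof -
  have "I ^ 2 \<le> (2 ^ I) ^ 2" using less_exp[of I] by (intro power_mono) auto
  also have "\<dots> = 4 ^ I" by (simp add: power2_eq_square flip: power_mult_distrib)
  finally show ?thesis .
qed

text \<open>Use the largest \<open>I\<close> for which \<open>shadow_len_average\<close> applies,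
after absorbing \<open>I\<^sup>2\<close> into \<open>4 ^ I\<close>.\<close>

lemma mean_shadow_decay:
  "\<exists>I. mean_shadow l \<le> ennreal (10 ^ 7 * (real I + 1) ^ 2 / 4 ^ I) \<and>
     2 * l + 1 \<le> (2 * 4 ^ 6 * (2304 * 7 * 4 ^ 24) + 1) * 4 ^ (6 * I)"
proof -
  define c where "c = (2304 * 7 * 4 ^ 24 :: nat)"
  have c: "1 \<le> c" by (simp add: c_def)
  define P where "P = (\<lambda>I::nat. I = 0 \<or> c * 4 ^ (6 * I) \<le> l)"
  define I where "I = (GREATEST I. P I)"
  have bound: "J \<le> l" if "P J" for J
  proof (cases "J = 0")
    case False
    have "J < 2 ^ J" by (rule less_exp)
    also have "\<dots> \<le> (4::nat) ^ J" by (rule power_mono) auto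
    also have "\<dots> \<le> 4 ^ (6 * J)" by (rule power_increasing) auto
    also have "\<dots> \<le> c * 4 ^ (6 * J)" using c by simp
    also have "\<dots> \<le> l" using that False by (simp add: P_def)
    finally show ?thesis by simp
  qed simp
  have "P 0" by (simp add: P_def)
  then have PI: "P I" unfolding I_def by (rule GreatestI_nat) (rule bound)
  have "\<not> P (Suc I)"
  proof
    assume "P (Suc I)"
    then have "Suc I \<le> I" unfolding I_def by (rule Greatest_le_nat) (rule bound)
    then show False by simp
  qed
  then have "l < c * 4 ^ (6 * Suc I)" by (simp add: P_def)
  also have "(4::nat) ^ (6 * Suc I) = 4 ^ 6 * 4 ^ (6 * I)" by (simp add: power_add)
  finally have "2 * l + 1 \<le> 2 * 4 ^ 6 * c * 4 ^ (6 * I) + 1" by simp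
  also have "\<dots> \<le> (2 * 4 ^ 6 * c + 1) * 4 ^ (6 * I)" by (simp add: distrib_right)
  finally have 2: "2 * l + 1 \<le> (2 * 4 ^ 6 * c + 1) * 4 ^ (6 * I)" .
  have "mean_shadow l \<le> ennreal (10 ^ 7 * (real I + 1) ^ 2 / 4 ^ I)"
  proof (cases "I = 0")
    case True
    have "mean_shadow l \<le> (\<integral>\<^sup>+t. ennreal 4 * indicator {- 2..2::real} t \<partial>lborel)"
      unfolding mean_shadow_def
    proof (intro nn_integral_mono)
      fix t :: real
      show "ennreal (shadow_len (corner t) l) * indicator {- 2..2} t \<le> ennreal 4 * indicator {- 2..2} t"
      proof (cases "t \<in> {- 2..2}")
        case True
        then have "\<bar>t\<bar> \<le> 2" by auto
        then have "shadow_len (corner t) l \<le> shadow_len (corner t) 0"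
          by (intro shadow_len_mono abs_corner_le) auto
        then have "ennreal (shadow_len (corner t) l) \<le> ennreal 4" by (intro ennreal_leI) (simp add: shadow_len_0)
        then show ?thesis by (rule mult_right_mono) simp
      qed simp
    qed
    also have "\<dots> = ennreal 4 * ennreal 4" by (subst nn_integral_cmult_indicator) auto
    also have "\<dots> = ennreal 16" by (subst ennreal_mult[symmetric]) auto
    also have "\<dots> \<le> ennreal (10 ^ 7 * (real I + 1) ^ 2 / 4 ^ I)" unfolding True by (rule ennreal_leI) simp
    finally show ?thesis .
  next
    case False
    then have I1: "1 \<le> I" by simp
    have "c * I ^ 2 * 4 ^ (5 * I) \<le> c * 4 ^ I * 4 ^ (5 * I)"
      by (intro mult_right_mono mult_left_mono square_le_power4) auto
    also have "\<dots> = c * 4 ^ (6 * I)" by (simp add: mult.assoc flip: power_add)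
    also have "\<dots> \<le> l" using PI False by (simp add: P_def)
    finally have "mean_shadow l \<le> ennreal (10 ^ 7 * real I ^ 2 / 4 ^ I)"
      unfolding c_def by (intro shadow_len_average I1)
    also have "\<dots> \<le> ennreal (10 ^ 7 * (real I + 1) ^ 2 / 4 ^ I)"
      by (intro ennreal_leI divide_right_mono mult_left_mono power_mono) auto
    finally show ?thesis .
  qed
  with 2 show ?thesis unfolding c_def by blast
qed

text \<open>The gap between \<open>6\<close> and \<open>p\<close> leaves a power \<open>4 ^ (e
I)\<close> that absorbs the polynomial factor, by \<open>(y / 2)\<^sup>2 \<le> exp
y\<close>.\<close>

lemma decay_to_power:
  fixes p c :: real
  assumes p: "6 < p" and c: "0 < c"
  shows "\<exists>Q>0. \<forall>(I::nat) n::nat. 1 \<le> n \<longrightarrow> real n \<le> c * 4 ^ (6 * I) \<longrightarrow>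
    (real I + 1) ^ 2 / 4 ^ I \<le> Q * real n powr (- 1 / p)"
proof -
  define e where "e = 1 - 6 / p"
  have e: "0 < e" using p by (simp add: e_def)
  define v where "v = e * ln 4"
  have v: "0 < v" using e by (simp add: v_def)
  define Q where "Q = (2 / v)\<^sup>2 * 4 powr e * c powr (1 / p)"
  have "0 < Q" using v c by (simp add: Q_def)
  moreover have "(real I + 1) ^ 2 / 4 ^ I \<le> Q * real n powr (- 1 / p)"
    if n: "1 \<le> n" "real n \<le> c * 4 ^ (6 * I)" for I n :: nat
  proof -
    define x where "x = real I + 1"
    have x: "0 < x" by (simp add: x_def)
    have "v * x / 2 \<le> exp (v * x / 2)" using exp_ge_add_one_self[of "v * x / 2"] by linarith
    then have "(v * x / 2)\<^sup>2 \<le> (exp (v * x / 2))\<^sup>2" using v x by (intro power_mono) auto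
    also have "(exp (v * x / 2))\<^sup>2 = 4 powr (e * x)"
      by (simp add: power2_eq_square powr_def v_def mult_ac flip: exp_add)
    finally have "x\<^sup>2 \<le> (2 / v)\<^sup>2 * 4 powr (e * x)"
      using v by (simp add: power_divide power_mult_distrib field_simps)
    then have "x\<^sup>2 / 4 ^ I \<le> (2 / v)\<^sup>2 * 4 powr (e * x) / 4 ^ I" by (rule divide_right_mono) simp
    also have "\<dots> = (2 / v)\<^sup>2 * 4 powr e * 4 powr (- (6 / p) * real I)"
    proof -
      have "4 powr (e * x) / 4 ^ I = 4 powr (e * x - real I)" by (simp add: powr_diff powr_realpow)
      also have "e * x - real I = e + - (6 / p) * real I" using p by (simp add: e_def x_def field_simps)
      finally show ?thesis by (simp only: powr_add mult.assoc times_divide_eq_right[symmetric])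
    qed
    also have "4 powr (- (6 / p) * real I) \<le> c powr (1 / p) * real n powr (- 1 / p)"
    proof -
      have "(c * 4 ^ (6 * I)) powr (- 1 / p) \<le> real n powr (- 1 / p)"
        using n p by (intro powr_mono2') auto
      moreover have "(c * 4 ^ (6 * I)) powr (- 1 / p) = c powr (- 1 / p) * 4 powr (- (6 / p) * real I)"
      proof -
        have "(4::real) ^ (6 * I) = 4 powr (6 * real I)"
          by (simp add: powr_realpow[symmetric])
        then show ?thesis using c by (simp add: powr_mult powr_powr)
      qed
      ultimately have "c powr (1 / p) * (c powr (- 1 / p) * 4 powr (- (6 / p) * real I)) \<le> c powr (1 / p) * real n powr (- 1 / p)"
        using c by (intro mult_left_mono) auto
      moreover have "c powr (1 / p) * c powr (- 1 / p) = 1" using c by (simp flip: powr_add)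
      ultimately show ?thesis by (simp only: mult.assoc[symmetric] mult_1_left)
    qed
    finally show ?thesis unfolding x_def Q_def by (simp add: mult.assoc mult_left_mono)
  qed
  ultimately show ?thesis by blast
qed

theorem theorem4:
  fixes \<C> :: "(real \<times> real) set" and p :: real
  assumes "finite_length_curve \<C>"
    and "piecewise_bilipschitz_tangent \<C>"
    and "p > 6"
  shows "\<exists>C::real. C > 0 \<and>
    (\<forall>n::nat. n \<ge> 1 \<longrightarrow>
      favard_curve_length \<C> (four_corner_gen n) \<le> ennreal (C * real n powr (- 1 / p)))"
proof -
  have "shadow_dominated \<C>"
    using assms(2) unfolding piecewise_bilipschitz_tangent_def
    by (auto intro: shadow_dominated_Union shadow_dominated_arc)
  then obtain A where A: "0 \<le> A" "\<And>m l. l \<le> m \<Longrightarrow> \<exists>B\<in>sets lborel.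
    colliding_translations (m + l) \<C> \<subseteq> B \<and> emeasure lborel B \<le> ennreal A * mean_shadow l"
    unfolding shadow_dominated_def by blast
  define c where "c = (2 * 4 ^ 6 * (2304 * 7 * 4 ^ 24) + 1 :: nat)"
  have "0 < real c" by (simp add: c_def)
  from decay_to_power[OF assms(3) this] obtain Q where Q: "0 < Q"
    "\<And>I n::nat. 1 \<le> n \<Longrightarrow> real n \<le> real c * 4 ^ (6 * I) \<Longrightarrow> (real I + 1) ^ 2 / 4 ^ I \<le> Q * real n powr (- 1 / p)"
    by blast
  define C where "C = (A + 1) * (10 ^ 7 * Q)"
  have "favard_curve_length \<C> (four_corner_gen n) \<le> ennreal (C * real n powr (- 1 / p))" if n: "1 \<le> n" for n
  proof -
    \<comment> \<open>Half of the generations make the squares so small that the curve is straight; the other half are projected.\<close>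
    define l where "l = n div 2"
    have l: "l \<le> n - l" "n - l + l = n" "n \<le> 2 * l + 1" by (auto simp: l_def)
    obtain B where B: "B \<in> sets lborel" "colliding_translations n \<C> \<subseteq> B"
      "emeasure lborel B \<le> ennreal A * mean_shadow l"
      using A(2)[OF l(1)] unfolding l(2) by blast
    obtain I where I: "mean_shadow l \<le> ennreal (10 ^ 7 * (real I + 1) ^ 2 / 4 ^ I)" "2 * l + 1 \<le> c * 4 ^ (6 * I)"
      using mean_shadow_decay[of l] unfolding c_def by blast
    have "n \<le> c * 4 ^ (6 * I)" using l(3) I(2) by linarith
    from of_nat_mono[OF this, where 'a=real] have "real n \<le> real c * 4 ^ (6 * I)" by simp
    then have dec: "(real I + 1) ^ 2 / 4 ^ I \<le> Q * real n powr (- 1 / p)" by (rule Q(2)[OF n])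
    have sub: "{(\<alpha>, \<beta>). (\<lambda>z. (\<alpha>, \<beta>) + z) ` \<C> \<inter> four_corner_gen n \<noteq> {}} \<subseteq> B"
    proof
      fix x assume "x \<in> {(\<alpha>, \<beta>). (\<lambda>z. (\<alpha>, \<beta>) + z) ` \<C> \<inter> four_corner_gen n \<noteq> {}}"
      then obtain z where "z \<in> \<C>" "x + z \<in> four_corner_gen n" by auto
      moreover have "x = (x + z) - z" by simp
      ultimately show "x \<in> B" using B(2) unfolding colliding_translations_def by blast
    qed
    have "favard_curve_length \<C> (four_corner_gen n) \<le> emeasure lebesgue B"
      unfolding favard_curve_length_def using B(1) by (intro emeasure_mono sub) auto
    also have "\<dots> = emeasure lborel B" using B(1) by (simp add: emeasure_completion)
    also have "\<dots> \<le> ennreal A * mean_shadow l" by (rule B(3))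
    also have "\<dots> \<le> ennreal A * ennreal (10 ^ 7 * (real I + 1) ^ 2 / 4 ^ I)"
      by (intro mult_left_mono I(1)) auto
    also have "\<dots> = ennreal (A * (10 ^ 7 * ((real I + 1) ^ 2 / 4 ^ I)))"
      using A(1) by (subst ennreal_mult[symmetric]) auto
    also have "\<dots> \<le> ennreal (C * real n powr (- 1 / p))"
    proof (rule ennreal_leI)
      have "A * (10 ^ 7 * ((real I + 1) ^ 2 / 4 ^ I)) \<le> (A + 1) * (10 ^ 7 * (Q * real n powr (- 1 / p)))"
        using A(1) dec by (intro mult_mono) auto
      then show "A * (10 ^ 7 * ((real I + 1) ^ 2 / 4 ^ I)) \<le> C * real n powr (- 1 / p)"
        by (simp only: C_def mult.assoc)
    qed
    finally show ?thesis .
  qed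
  moreover have "0 < C" using A(1) Q(1) by (simp add: C_def)
  ultimately show ?thesis by blast
qed

end
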